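(* Let $p_-<0<p_+$ and $\lambda_-,\lambda_+>0$. Let $(X,E)$ be the piecewise deterministic Markov process on $[0,\infty)\times I$, $I=\{-1,1\}$, obtained by switching between the vector fields $f_{-1}(x)=p_-x-x^2$ and $f_1(x)=p_+x-x^2$ on $[0,\infty)$, with rate $\lambda_-$ of switching from $f_{-1}$ to $f_1$ and rate $\lambda_+$ of switching from $f_1$ to $f_{-1}$. Let $\delta$ be the product of the Dirac measure at $0$ and the probability measure on $I$ assigning mass $\frac{\lambda_+}{\lambda_++\lambda_-}$ to $-1$ and mass $\frac{\lambda_-}{\lambda_++\lambda_-}$ to $1$. Then: 1. If $\frac{\lambda_+}{p_+}<-\frac{\lambda_-}{p_-}$, there are exactly two ergodic invariant probability measures of $(X,E)$: the measure $\delta$ and a measure $\mu$ with $\mu((0,\infty)\times I)=1$. 2. If $\frac{\lambda_+}{p_+}\ge-\frac{\lambda_-}{p_-}$, then $\delta$ is the only invariant probability measure of $(X,E)$.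
   Context: The process $(X,E)$: $E=(E_t)_{t\ge0}$ is the continuous-time Markov chain on $I=\{-1,1\}$ that jumps from $-1$ to $1$ at rate $\lambda_-$ and from $1$ to $-1$ at rate $\lambda_+$ (rates independent of $X$), and $X$ solves $X_t=X_0+\int_0^t f_{E_s}(X_s)\,ds$. The state space is restricted to $[0,\infty)\times I$; the set $[0,\infty)$ is positively invariant for both flows and both vector fields are forward complete there. $(X,E)$ is a Markov process with semigroup $(\mathsf{P}^t)$. An invariant probability measure (IPM) is a probability measure $\mu$ on the state space with $\mu\mathsf{P}^t=\mu$ for all $t\ge0$. An IPM $\nu$ is ergodic if $\nu(A)\in\{0,1\}$ for every measurable set $A$ of the state space such that for all $t\ge0$, $\mathsf{P}^t_z(A)=1$ for $\nu$-almost every $z\in A$. *)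

theory Defs
  imports "HOL-Probability.Probability"
begin

text \<open>
  Two-state switching between vector fields \<open>f (-1)\<close> and \<open>f 1\<close> on \<open>[0,\<infinity>)\<close>;
  \<open>r i\<close> is the rate at which the chain leaves the state \<open>i\<close>.
\<close>

abbreviation state_index :: "int set" where
  "state_index \<equiv> {-1, 1}"

definition state_space :: "(real \<times> int) measure" where
  "state_space = restrict_space borel {0..} \<Otimes>\<^sub>M count_space state_index"

text \<open>
  The chain is realised by its jump chain and holding times: a sample point \<open>w\<close> is the
  sequence of successive holding times. Started at \<open>e\<close>, the chain spends its \<open>k\<close>-th holding
  time (counting from \<open>0\<close>) in the state \<open>e * (-1) ^ k\<close>.
\<close>

definition holding_space :: "(int \<Rightarrow> real) \<Rightarrow> int \<Rightarrow> (nat \<Rightarrow> real) measure" where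
  "holding_space r e =
     (\<Pi>\<^sub>M k\<in>UNIV. density lborel (exponential_density (r (e * (-1) ^ k))))"

definition jump_time :: "(nat \<Rightarrow> real) \<Rightarrow> nat \<Rightarrow> real" where
  "jump_time w n = (\<Sum>k<n. w k)"

text \<open>
  The cardinality below is the number of jumps up to time \<open>t\<close>. It is finite for all \<open>t\<close>
  almost surely; on the exceptional null set \<open>card\<close> returns \<open>0\<close>.
\<close>

definition chain :: "int \<Rightarrow> (nat \<Rightarrow> real) \<Rightarrow> real \<Rightarrow> int" where
  "chain e w t = e * (-1) ^ card {n. 0 < n \<and> jump_time w n \<le> t}"

text \<open>
  \<open>x\<close> solves \<open>x t = x0 + \<integral>\<^sub>0\<^sup>t f (e s) (x s) ds\<close> within \<open>[0,\<infinity>)\<close>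
  (continuity of \<open>x\<close> follows from continuity of the indefinite integral).
\<close>

definition switched_solution ::
  "(int \<Rightarrow> real \<Rightarrow> real) \<Rightarrow> (real \<Rightarrow> int) \<Rightarrow> real \<Rightarrow> (real \<Rightarrow> real) \<Rightarrow> bool" where
  "switched_solution f e x0 x \<longleftrightarrow>
     (\<forall>t\<ge>0. 0 \<le> x t \<and> ((\<lambda>s. f (e s) (x s)) has_integral (x t - x0)) {0..t})"

text \<open>
  A solution is only determined on \<open>[0,\<infinity>)\<close>, so the definite description is applied to its
  value at time \<open>t\<close> and not to the path.
\<close>

definition position ::
  "(int \<Rightarrow> real \<Rightarrow> real) \<Rightarrow> real \<times> int \<Rightarrow> (nat \<Rightarrow> real) \<Rightarrow> real \<Rightarrow> real" where
  "position f z w t =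
     (THE y. \<exists>x. switched_solution f (chain (snd z) w) (fst z) x \<and> x t = y)"

text \<open>\<open>semigroup_P f r t z\<close> is the law of \<open>(X\<^sub>t, E\<^sub>t)\<close> started at \<open>z\<close>.\<close>

definition semigroup_P ::
  "(int \<Rightarrow> real \<Rightarrow> real) \<Rightarrow> (int \<Rightarrow> real) \<Rightarrow> real \<Rightarrow> real \<times> int \<Rightarrow> (real \<times> int) measure" where
  "semigroup_P f r t z =
     distr (holding_space r (snd z)) state_space
       (\<lambda>w. (position f z w t, chain (snd z) w t))"

definition invariant_prob ::
  "(int \<Rightarrow> real \<Rightarrow> real) \<Rightarrow> (int \<Rightarrow> real) \<Rightarrow> (real \<times> int) measure \<Rightarrow> bool" where
  "invariant_prob f r \<mu> \<longleftrightarrow>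
     prob_space \<mu> \<and> sets \<mu> = sets state_space \<and>
     (\<forall>t\<ge>0. \<forall>A\<in>sets state_space.
        (\<integral>\<^sup>+ z. emeasure (semigroup_P f r t z) A \<partial>\<mu>) = emeasure \<mu> A)"

definition ergodic_prob ::
  "(int \<Rightarrow> real \<Rightarrow> real) \<Rightarrow> (int \<Rightarrow> real) \<Rightarrow> (real \<times> int) measure \<Rightarrow> bool" where
  "ergodic_prob f r \<nu> \<longleftrightarrow>
     invariant_prob f r \<nu> \<and>
     (\<forall>A\<in>sets state_space.
        (\<forall>t\<ge>0. AE z in \<nu>. z \<in> A \<longrightarrow> measure (semigroup_P f r t z) A = 1)
        \<longrightarrow> measure \<nu> A \<in> {0, 1})"

definition logistic_field :: "real \<Rightarrow> real \<Rightarrow> int \<Rightarrow> real \<Rightarrow> real" where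
  "logistic_field pm pp i x = (if i = -1 then pm * x - x\<^sup>2 else pp * x - x\<^sup>2)"

definition switch_rate :: "real \<Rightarrow> real \<Rightarrow> int \<Rightarrow> real" where
  "switch_rate lm lp i = (if i = -1 then lm else lp)"

definition extinction_measure :: "real \<Rightarrow> real \<Rightarrow> (real \<times> int) measure" where
  "extinction_measure lm lp =
     return (restrict_space borel {0..}) 0 \<Otimes>\<^sub>M
     point_measure state_index
       (\<lambda>i. ennreal (if i = -1 then lp / (lp + lm) else lm / (lp + lm)))"

end

theory Submission
  imports Defs
begin

text \<open>
  For every path of the environment the logistic equation is solved explicitly by
  \<open>X\<^sub>t = x e\<^sup>A / (1 + x I)\<close> with \<open>A\<close> the integral of the growth rate over \<open>[0,t]\<close> and \<open>I\<close> the
  integral of \<open>e\<^sup>A\<close>. Splitting off the first holding time gives a renewal equation for the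
  semigroup, and it implies that every solution of the integrated stationarity equation of the
  generator is invariant. The Markov property is not used.

  Every invariant measure has the stationary law of the chain as second marginal. If the mean growth
  rate is at most \<open>0\<close>, the stationary mean of \<open>ln (X\<^sub>1 / X\<^sub>0)\<close>, which is \<open>0\<close>, equals the mean growth
  rate minus the mean of \<open>ln (1 + X\<^sub>0 I)\<close>, so no invariant measure charges \<open>x > 0\<close>.
  If it is positive, then \<open>A\<close> tends to infinity in the sense that some negative exponential moment
  decays; since \<open>1/X - 1/X' = e\<^sup>-\<^sup>A (1/x - 1/x')\<close> for two solutions driven by the same path, there is
  at most one invariant measure on \<open>x > 0\<close>. Its distribution functions in the coordinate \<open>1/x\<close>
  solve a linear differential equation and are given explicitly.
\<close>

section \<open>Holding times and the chain\<close>

text \<open>Three obstacles shape the details. \<open>semigroup_P\<close> is a \<open>distr\<close>,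
  which says something only for a measurable map, so the explicit solution is established for every
  sample point, including the null set where jump times accumulate. Expectations live in
  \<open>ennreal\<close>, where subtraction is of little use: signed quantities are shifted by
  \<open>bnd\<close>, and identities are proved with a common finite term on both sides that is then
  cancelled. No integrability of \<open>ln x\<close> or \<open>1/x\<close> under an invariant
  measure is known in advance, hence the truncated logarithms in one case and a coupling error
  capped at 1 in the other. Ergodicity is obtained from uniqueness: conditioning an invariant
  measure on a set that the process does not leave gives an invariant measure again, so a measure
  that is the only invariant one carried by some set is ergodic. The critical case of mean growth 0
  goes with the negative one because \<open>ln (1 + X I)\<close> is strictly positive for
  \<open>x > 0\<close>. The negative exponential moment has a small order because only to first
  order in it does the sign of the mean growth decide.\<close>

abbreviation path_space :: "(nat \<Rightarrow> real) measure" where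
  "path_space \<equiv> \<Pi>\<^sub>M k\<in>UNIV. borel"

lemma sign_power_cases: "e \<in> state_index \<Longrightarrow> e * (-1) ^ k \<in> state_index"
  by (cases "even k") auto

lemma sets_holding_space [measurable_cong]:
  "sets (holding_space r e) = sets (\<Pi>\<^sub>M k\<in>UNIV. (borel :: real measure))"
  unfolding holding_space_def by (intro sets_PiM_cong) auto

lemma space_holding_space [simp]: "space (holding_space r e) = UNIV"
  unfolding holding_space_def by (auto simp: space_PiM)

lemma prob_space_holding_space:
  assumes "\<And>i. 0 < r i"
  shows "prob_space (holding_space r e)"
  unfolding holding_space_def
  by (intro prob_space_PiM prob_space_exponential_density assms)

text \<open>Since \<open>e * (-1) ^ Suc k = (-e) * (-1) ^ k\<close>, the factors after the first are
  exactly those of \<open>holding_space r (-e)\<close>. The renewal equation and the inductions over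
  switches go through this splitting.\<close>

lemma holding_space_first:
  assumes r: "\<And>i. 0 < r i"
  shows "holding_space r e =
    distr (density lborel (exponential_density (r e)) \<Otimes>\<^sub>M holding_space r (-e))
      path_space (\<lambda>(s, w). case_nat s w)"
proof -
  define M where "M = (\<lambda>k::nat. density lborel (exponential_density (r (e * (-1) ^ k))))"
  have P: "prob_space (M k)" for k
    unfolding M_def by (intro prob_space_exponential_density r)
  have sM: "sets (M k) = sets borel" for k by (simp add: M_def)
  let ?N = "path_space"
  let ?R = "\<Pi>\<^sub>M k\<in>range Suc. M k"
  interpret R: prob_space ?R by (intro prob_space_PiM P)
  have H: "holding_space r e = Pi\<^sub>M UNIV M" by (simp add: holding_space_def M_def)
  have H': "holding_space r (-e) = (\<Pi>\<^sub>M k\<in>UNIV. M (Suc k))"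
    by (simp add: holding_space_def M_def)
  have sH: "sets (Pi\<^sub>M UNIV M) = sets ?N" by (intro sets_PiM_cong) (auto simp: sM)
  have sH': "sets (\<Pi>\<^sub>M k\<in>UNIV. M (Suc k)) = sets ?N" by (intro sets_PiM_cong) (auto simp: sM)
  have I: "insert 0 (range Suc) = UNIV" by (metis UNIV_nat_eq)
  \<comment> \<open>Splitting off the first factor leaves factors indexed by
    \<open>range Suc\<close>; the injective map \<open>Suc\<close> reindexes them as a
    sequence.\<close>
  have e1: "distr ?R (\<Pi>\<^sub>M k\<in>UNIV. M (Suc k)) (\<lambda>\<omega>. \<lambda>n\<in>UNIV. \<omega> (Suc n)) = (\<Pi>\<^sub>M k\<in>UNIV. M (Suc k))"
    by (intro distr_PiM_reindex P) auto
  have m1: "(\<lambda>\<omega>. \<lambda>n\<in>UNIV. \<omega> (Suc n)) \<in> ?R \<rightarrow>\<^sub>M (\<Pi>\<^sub>M k\<in>UNIV. M (Suc k))"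
    by (intro measurable_restrict measurable_component_singleton) auto
  have e2: "distr (M 0 \<Otimes>\<^sub>M ?R) (Pi\<^sub>M UNIV M) (\<lambda>(x, X). X(0 := x)) = Pi\<^sub>M UNIV M"
    using distr_pair_PiM_eq_PiM[of "range Suc" M 0] P by (simp add: I)
  have m2: "(\<lambda>(s, w). case_nat s w) \<in> (borel \<Otimes>\<^sub>M ?N) \<rightarrow>\<^sub>M ?N"
  proof (rule measurable_PiM_single')
    fix i :: nat
    show "(\<lambda>p. (case p of (s, w) \<Rightarrow> case_nat s w) i) \<in> (borel \<Otimes>\<^sub>M ?N) \<rightarrow>\<^sub>M borel"
      by (cases i) (auto simp: split_beta')
  qed auto
  have m3: "(\<lambda>(x, w). (x, \<lambda>n\<in>UNIV. w (Suc n))) \<in> M 0 \<Otimes>\<^sub>M ?R \<rightarrow>\<^sub>M M 0 \<Otimes>\<^sub>M (\<Pi>\<^sub>M k\<in>UNIV. M (Suc k))"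
    using m1 by (simp add: split_beta')
  have e3: "M 0 \<Otimes>\<^sub>M (\<Pi>\<^sub>M k\<in>UNIV. M (Suc k)) =
     distr (M 0 \<Otimes>\<^sub>M ?R) (M 0 \<Otimes>\<^sub>M (\<Pi>\<^sub>M k\<in>UNIV. M (Suc k))) (\<lambda>(x, w). (x, \<lambda>n\<in>UNIV. w (Suc n)))"
  proof -
    have "distr (M 0) (M 0) (\<lambda>x. x) \<Otimes>\<^sub>M distr ?R (\<Pi>\<^sub>M k\<in>UNIV. M (Suc k)) (\<lambda>\<omega>. \<lambda>n\<in>UNIV. \<omega> (Suc n)) =
       distr (M 0 \<Otimes>\<^sub>M ?R) (M 0 \<Otimes>\<^sub>M (\<Pi>\<^sub>M k\<in>UNIV. M (Suc k))) (\<lambda>(x, w). (x, \<lambda>n\<in>UNIV. w (Suc n)))"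
    proof (rule pair_measure_distr)
      interpret N: prob_space "distr ?R (\<Pi>\<^sub>M k\<in>UNIV. M (Suc k)) (\<lambda>\<omega>. \<lambda>n\<in>UNIV. \<omega> (Suc n))"
        by (intro R.prob_space_distr m1)
      show "sigma_finite_measure (distr ?R (\<Pi>\<^sub>M k\<in>UNIV. M (Suc k)) (\<lambda>\<omega>. \<lambda>n\<in>UNIV. \<omega> (Suc n)))" ..
    qed (use m1 in auto)
    then show ?thesis by (simp add: e1 distr_id)
  qed
  have m2': "(\<lambda>(s, w). case_nat s w) \<in> (M 0 \<Otimes>\<^sub>M (\<Pi>\<^sub>M k\<in>UNIV. M (Suc k))) \<rightarrow>\<^sub>M ?N"
    using m2 by (subst measurable_cong_sets[OF sets_pair_measure_cong[OF sM sH'] refl])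
  have "distr (M 0 \<Otimes>\<^sub>M (\<Pi>\<^sub>M k\<in>UNIV. M (Suc k))) ?N (\<lambda>(s, w). case_nat s w) =
     distr (M 0 \<Otimes>\<^sub>M ?R) ?N ((\<lambda>(s, w). case_nat s w) \<circ> (\<lambda>(x, w). (x, \<lambda>n\<in>UNIV. w (Suc n))))"
    by (subst e3, rule distr_distr[OF m2' m3])
  also have "\<dots> = distr (M 0 \<Otimes>\<^sub>M ?R) (Pi\<^sub>M UNIV M) (\<lambda>(x, X). X(0 := x))"
    by (intro distr_cong) (auto simp: sH fun_eq_iff split: nat.split)
  also have "\<dots> = Pi\<^sub>M UNIV M" by (rule e2)
  finally show ?thesis by (simp add: H H' M_def)
qed

lemma case_nat_measurable [measurable]:
  "(\<lambda>(s, w). case_nat s w) \<in> (borel \<Otimes>\<^sub>M path_space) \<rightarrow>\<^sub>M path_space"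
proof (rule measurable_PiM_single')
  fix i :: nat
  show "(\<lambda>p. (case p of (s, w) \<Rightarrow> case_nat s w) i) \<in> (borel \<Otimes>\<^sub>M path_space) \<rightarrow>\<^sub>M borel"
    by (cases i) (auto simp: split_beta')
qed auto

lemma case_nat_measurable2 [measurable]:
  assumes [measurable]: "f \<in> borel_measurable M" "g \<in> M \<rightarrow>\<^sub>M path_space"
  shows "(\<lambda>x. case_nat (f x) (g x)) \<in> M \<rightarrow>\<^sub>M path_space"
  using measurable_compose[OF _ case_nat_measurable, of "\<lambda>x. (f x, g x)" M] by simp

lemma nn_integral_holding_space:
  assumes r: "\<And>i. 0 < r i"
    and h [measurable]: "h \<in> borel_measurable path_space"
  shows "(\<integral>\<^sup>+ w. h w \<partial>holding_space r e) =
    (\<integral>\<^sup>+ s. ennreal (exponential_density (r e) s) * (\<integral>\<^sup>+ w. h (case_nat s w) \<partial>holding_space r (-e)) \<partial>lborel)"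
proof -
  interpret A: prob_space "holding_space r (-e)" by (rule prob_space_holding_space) (rule r)
  have [measurable]: "(\<lambda>(s, w). case_nat s w) \<in> density lborel (exponential_density (r e)) \<Otimes>\<^sub>M holding_space r (-e) \<rightarrow>\<^sub>M
     path_space"
    using case_nat_measurable by (subst measurable_cong_sets[OF sets_pair_measure_cong refl])
       (auto simp: sets_holding_space)
  have "(\<integral>\<^sup>+ w. h w \<partial>holding_space r e) =
    (\<integral>\<^sup>+ p. h (case p of (s, w) \<Rightarrow> case_nat s w) \<partial>(density lborel (exponential_density (r e)) \<Otimes>\<^sub>M holding_space r (-e)))"
    by (subst holding_space_first[where r=r and e=e, OF r], subst nn_integral_distr) auto
  also have "\<dots> = (\<integral>\<^sup>+ s. \<integral>\<^sup>+ w. h (case_nat s w) \<partial>holding_space r (-e) \<partial>density lborel (exponential_density (r e)))"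
    by (subst A.nn_integral_fst[symmetric]) (auto simp: split_beta')
  also have "\<dots> = (\<integral>\<^sup>+ s. ennreal (exponential_density (r e) s) * (\<integral>\<^sup>+ w. h (case_nat s w) \<partial>holding_space r (-e)) \<partial>lborel)"
    by (subst nn_integral_density) auto
  finally show ?thesis .
qed

lemma jump_time_measurable [measurable]:
  assumes [measurable]: "g \<in> M \<rightarrow>\<^sub>M path_space"
  shows "(\<lambda>x. jump_time (g x) n) \<in> borel_measurable M"
  unfolding jump_time_def by measurable

lemma jump_time_case_nat: "jump_time (case_nat s w) (Suc n) = s + jump_time w n"
  unfolding jump_time_def by (subst sum.lessThan_Suc_shift) simp

lemma chain_measurable [measurable]:
  assumes [measurable]: "g \<in> M \<rightarrow>\<^sub>M path_space" "f \<in> borel_measurable M"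
  shows "(\<lambda>x. chain e (g x) (f x)) \<in> M \<rightarrow>\<^sub>M count_space UNIV"
  unfolding chain_def by measurable

lemma chain_in_state_index: "e \<in> state_index \<Longrightarrow> chain e w t \<in> state_index"
  unfolding chain_def by (rule sign_power_cases)

section \<open>Non-explosion of the chain\<close>

definition regular :: "(nat \<Rightarrow> real) \<Rightarrow> bool" where
  "regular w \<longleftrightarrow> (\<forall>k. 0 < w k) \<and> (\<forall>t. finite {n. jump_time w n \<le> t})"

text \<open>Exponential tilting: the density of rate \<open>l\<close> times
  \<open>exp (- (a * s))\<close> is a multiple of the density of rate \<open>l + a\<close>.\<close>

lemma exponential_laplace:
  assumes "0 < (l::real)" "0 \<le> a"
  shows "(\<integral>\<^sup>+ s. ennreal (exponential_density l s) * ennreal (exp (- (a * s))) \<partial>lborel) = ennreal (l / (l + a))"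
proof -
  have eq: "exponential_density l s * exp (- (a * s)) = l / (l + a) * exponential_density (l + a) s" for s
    using assms by (auto simp: exponential_density_def exp_add[symmetric] field_simps)
  have "(\<integral>\<^sup>+ s. ennreal (exponential_density l s) * ennreal (exp (- (a * s))) \<partial>lborel) =
     (\<integral>\<^sup>+ s. ennreal (l / (l + a)) * ennreal (exponential_density (l + a) s) \<partial>lborel)"
    using assms by (intro nn_integral_cong)
      (simp only: ennreal_mult'[symmetric] ennreal_mult''[symmetric] exp_ge_zero eq
        exponential_density_nonneg add_pos_nonneg)
  also have "\<dots> = ennreal (l / (l + a)) * (\<integral>\<^sup>+ s. ennreal (exponential_density (l + a) s) \<partial>lborel)"
    by (intro nn_integral_cmult) auto
  also have "(\<integral>\<^sup>+ s. ennreal (exponential_density (l + a) s) \<partial>lborel) = 1"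
  proof -
    interpret prob_space "density lborel (exponential_density (l + a))"
      using assms by (intro prob_space_exponential_density) auto
    show ?thesis using emeasure_space_1 by (simp add: emeasure_density)
  qed
  finally show ?thesis by simp
qed

text \<open>Every holding time contributes its Laplace transform at 1, a factor
  \<open>r i / (r i + 1)\<close>. The induction keeps \<open>e\<close> general because removing the
  first holding time flips it.\<close>

lemma nn_integral_exp_jump_time:
  assumes r: "\<And>i. 0 < r i" and q: "\<And>i. r i / (r i + 1) \<le> q"
  shows "(\<integral>\<^sup>+ w. ennreal (exp (- jump_time w n)) \<partial>holding_space r e) \<le> ennreal (q ^ n)"
proof (induction n arbitrary: e)
  case 0
  interpret prob_space "holding_space r e" by (rule prob_space_holding_space) (rule r)
  show ?case using emeasure_space_1 by (simp add: jump_time_def)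
next
  case (Suc n)
  have q0: "0 \<le> q" using r[of 0] by (intro order_trans[OF _ q[of 0]]) (simp add: less_imp_le)
  have "(\<integral>\<^sup>+ w. ennreal (exp (- jump_time w (Suc n))) \<partial>holding_space r e) =
    (\<integral>\<^sup>+ s. ennreal (exponential_density (r e) s) *
      (\<integral>\<^sup>+ w. ennreal (exp (- s)) * ennreal (exp (- jump_time w n)) \<partial>holding_space r (-e)) \<partial>lborel)"
    by (subst nn_integral_holding_space[OF r])
      (auto simp: jump_time_case_nat exp_diff exp_minus_inverse ennreal_mult'[symmetric] exp_add[symmetric])
  also have "\<dots> = (\<integral>\<^sup>+ s. ennreal (exponential_density (r e) s) *
      (ennreal (exp (- s)) * (\<integral>\<^sup>+ w. ennreal (exp (- jump_time w n)) \<partial>holding_space r (-e))) \<partial>lborel)"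
    by (subst nn_integral_cmult) auto
  also have "\<dots> \<le> (\<integral>\<^sup>+ s. ennreal (exponential_density (r e) s) * (ennreal (exp (- s)) * ennreal (q ^ n)) \<partial>lborel)"
    by (intro nn_integral_mono mult_left_mono Suc) auto
  also have "\<dots> = (\<integral>\<^sup>+ s. ennreal (exponential_density (r e) s) * ennreal (exp (- (1 * s))) \<partial>lborel) * ennreal (q ^ n)"
    by (subst nn_integral_multc[symmetric]) (auto simp: mult.assoc)
  also have "\<dots> = ennreal (r e / (r e + 1)) * ennreal (q ^ n)"
    using r by (subst exponential_laplace) auto
  also have "\<dots> \<le> ennreal (q ^ Suc n)"
    using q0 mult_right_mono[OF q[of e], of "q ^ n"]
    by (subst ennreal_mult''[symmetric]) (auto intro!: ennreal_leI)
  finally show ?case .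
qed

text \<open>The means of \<open>exp (- jump_time w n)\<close> are dominated by a geometric series,
  so the sum over \<open>n\<close> is almost surely finite, its terms tend to 0 and the jump times
  tend to infinity.\<close>

lemma AE_regular:
  assumes r: "\<And>i. 0 < r i" and q: "\<And>i. r i / (r i + 1) \<le> q" "q < 1"
  shows "AE w in holding_space r e. regular w"
proof -
  let ?H = "holding_space r e"
  interpret prob_space ?H by (rule prob_space_holding_space) (rule r)
  have q0: "0 \<le> q" using r[of 0] by (intro order_trans[OF _ q(1)[of 0]]) (simp add: less_imp_le)
  have 1: "AE w in ?H. 0 < w k" for k
    unfolding holding_space_def
  proof (rule AE_PiM_component)
    \<comment> \<open>The exponential density is positive at 0 as well, so this point has to be
      excluded as a Lebesgue null set.\<close>
    have "(s::real) \<noteq> 0 \<Longrightarrow> 0 < exponential_density l s \<Longrightarrow> 0 < s" for l s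
      by (auto simp: exponential_density_def split: if_splits)
    then show "AE x in density lborel (\<lambda>x. ennreal (exponential_density (r (e * (- 1) ^ k)) x)). 0 < x"
      using AE_lborel_singleton[of 0] by (subst AE_density) (auto elim!: eventually_mono)
  qed (auto intro!: prob_space_exponential_density r)
  have "(\<integral>\<^sup>+ w. (\<Sum>n. ennreal (exp (- jump_time w n))) \<partial>?H) =
      (\<Sum>n. \<integral>\<^sup>+ w. ennreal (exp (- jump_time w n)) \<partial>?H)"
    by (intro nn_integral_suminf) auto
  also have "\<dots> \<le> (\<Sum>n. ennreal (q ^ n))"
    by (intro suminf_le nn_integral_exp_jump_time r q) auto
  also have "\<dots> < \<infinity>"
    using q0 q(2) by (subst suminf_ennreal2) (auto intro: summable_geometric)
  finally have "AE w in ?H. (\<Sum>n. ennreal (exp (- jump_time w n))) \<noteq> \<infinity>"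
    by (intro nn_integral_PInf_AE) auto
  then have 2: "AE w in ?H. \<forall>t. finite {n. jump_time w n \<le> t}"
  proof eventually_elim
    case (elim w)
    have s: "summable (\<lambda>n. exp (- jump_time w n))"
      using elim by (intro summable_suminf_not_top) auto
    show ?case
    proof
      fix t
      have "\<forall>\<^sub>F n in sequentially. exp (- jump_time w n) < exp (- t)"
        using summable_LIMSEQ_zero[OF s] by (rule order_tendstoD) simp
      then obtain N where "\<And>n. n \<ge> N \<Longrightarrow> t < jump_time w n"
        by (auto simp: eventually_sequentially)
      then have "{n. jump_time w n \<le> t} \<subseteq> {..<N}"
        using not_le by (auto simp: not_less[symmetric])
      then show "finite {n. jump_time w n \<le> t}" using finite_subset by blast
    qed
  qed
  from 1 have "AE w in ?H. \<forall>k. 0 < w k" by (simp add: AE_all_countable)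
  with 2 show ?thesis by eventually_elim (simp add: regular_def)
qed

lemma jump_time_nonneg: "regular w \<Longrightarrow> 0 \<le> jump_time w n"
  unfolding regular_def jump_time_def by (intro sum_nonneg) (auto intro: less_imp_le)

lemma chain_case_nat:
  assumes "regular w" "0 \<le> s"
  shows "chain e (case_nat s w) t = (if t < s then e else chain (-e) w (t - s))"
proof -
  have im: "{n. 0 < n \<and> jump_time (case_nat s w) n \<le> t} = Suc ` {m. jump_time w m \<le> t - s}"
    by (auto simp: image_iff gr0_conv_Suc jump_time_case_nat)
  show ?thesis
  proof (cases "t < s")
    case True
    then have "{m. jump_time w m \<le> t - s} = {}"
      by (auto simp: not_le intro: less_le_trans[OF _ jump_time_nonneg[OF assms(1)]])
    then show ?thesis using True unfolding chain_def im by simp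
  next
    case False
    have 0: "jump_time w 0 = 0" by (simp add: jump_time_def)
    \<comment> \<open>Index 0 of \<open>w\<close> stands for the jump at time \<open>s\<close>
      itself, the one extra sign that turns \<open>e\<close> into \<open>-e\<close>. Finiteness
      matters: \<open>card\<close> of an infinite set would not grow by the insertion.\<close>
    have "{m. jump_time w m \<le> t - s} = insert 0 {m. 0 < m \<and> jump_time w m \<le> t - s}"
      using False 0 by (auto simp: gr0_conv_Suc)
    moreover have "finite {m. 0 < m \<and> jump_time w m \<le> t - s}"
      using assms(1) by (auto simp: regular_def intro: finite_subset[of _ "{m. jump_time w m \<le> t - s}"])
    ultimately have "card (Suc ` {m. jump_time w m \<le> t - s}) = Suc (card {m. 0 < m \<and> jump_time w m \<le> t - s})"
      by (subst card_image) auto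
    then show ?thesis using False unfolding chain_def im by simp
  qed
qed

section \<open>Explicit solution of the switched equation\<close>

locale logistic_switching =
  fixes pm pp lm lp :: real
  assumes pm: "pm < 0" and pp: "0 < pp" and lm: "0 < lm" and lp: "0 < lp"
begin

abbreviation "rate \<equiv> switch_rate lm lp"
abbreviation "field \<equiv> logistic_field pm pp"
abbreviation "holding \<equiv> holding_space rate"

definition growth :: "int \<Rightarrow> real" where
  "growth i = (if i = -1 then pm else pp)"

lemma field_eq: "field i x = growth i * x - x\<^sup>2"
  by (simp add: logistic_field_def growth_def)

lemma rate_pos: "0 < rate i"
  using lm lp by (simp add: switch_rate_def)

lemma growth_nonzero: "growth i \<noteq> 0"
  using pm pp by (simp add: growth_def)

text \<open>As \<open>pm < 0 < pp\<close>, this dominates both growth rates in absolute value. It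
  also serves as a shift: \<open>bnd - growth i\<close> is nonnegative and can be integrated in
  \<open>ennreal\<close>.\<close>

definition bnd :: real where "bnd = pp - pm"

lemma bnd_pos: "0 < bnd" using pm pp by (simp add: bnd_def)

lemma abs_growth: "\<bar>growth i\<bar> \<le> bnd"
  using pm pp by (simp add: growth_def bnd_def)

lemma AE_regular_holding: "AE w in holding e. regular w"
proof -
  define M where "M = max lm lp"
  have M: "rate i \<le> M" "0 < M" for i using lm lp by (auto simp: switch_rate_def M_def)
  show ?thesis
  proof (rule AE_regular[where q = "M / (M + 1)"])
    show "rate i / (rate i + 1) \<le> M / (M + 1)" for i
      using M(1)[of i] rate_pos[of i] by (simp add: field_simps)
    show "M / (M + 1) < 1" using M by (simp add: field_simps)
  qed (rule rate_pos)
qed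

lemma prob_holding: "prob_space (holding e)"
  by (rule prob_space_holding_space) (rule rate_pos)

text \<open>Together with \<open>path_mass\<close>, the quantities \<open>A\<close> and
  \<open>I\<close> of the overview. As Lebesgue integrals they are jointly measurable in time and
  sample point; \<open>path_growth_integral\<close> and \<open>path_mass_integral\<close> switch to
  the gauge integral for calculus.\<close>

definition path_growth :: "int \<Rightarrow> (nat \<Rightarrow> real) \<Rightarrow> real \<Rightarrow> real" where
  "path_growth e w t = (LINT s:{0..t}|lborel. growth (chain e w s))"

definition path_mass :: "int \<Rightarrow> (nat \<Rightarrow> real) \<Rightarrow> real \<Rightarrow> real" where
  "path_mass e w t = (LINT s:{0..t}|lborel. exp (path_growth e w s))"

lemma chain_meas_s [measurable]: "(\<lambda>s. chain e w s) \<in> borel \<rightarrow>\<^sub>M count_space UNIV"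
  by (rule chain_measurable) (auto simp: space_PiM)

lemma growth_set_integrable: "set_integrable lborel {a..b} (\<lambda>s. growth (chain e w s))"
proof -
  have "integrable lborel (\<lambda>s. bnd * indicator {a..b} s)"
    by (intro integrable_mult_right integrable_real_indicator) (auto simp: emeasure_lborel_Icc_eq)
  then show ?thesis unfolding set_integrable_def
    by (rule Bochner_Integration.integrable_bound)
      (use abs_growth bnd_pos in \<open>auto simp: indicator_def\<close>)
qed

lemma growth_integrable_on: "(\<lambda>s. growth (chain e w s)) integrable_on {a..b}"
  using set_borel_integral_eq_integral(1)[OF growth_set_integrable] .

lemma path_growth_integral: "path_growth e w t = integral {0..t} (\<lambda>s. growth (chain e w s))"
  unfolding path_growth_def using set_borel_integral_eq_integral(2)[OF growth_set_integrable] .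

lemma path_growth_continuous: "continuous_on {0..t} (path_growth e w)"
  using indefinite_integral_continuous_1[OF growth_integrable_on]
  by (simp add: path_growth_integral[abs_def])

lemma path_growth_set_integrable: "set_integrable lborel {0..t} (\<lambda>s. exp (path_growth e w s))"
  by (intro borel_integrable_compact[unfolded set_integrable_def[symmetric]] continuous_intros path_growth_continuous) auto

lemma path_mass_integral: "path_mass e w t = integral {0..t} (\<lambda>s. exp (path_growth e w s))"
  unfolding path_mass_def using set_borel_integral_eq_integral(2)[OF path_growth_set_integrable] .

lemma path_growth_measurable_pair:
  "(\<lambda>(t, w). path_growth e w t) \<in> borel_measurable (borel \<Otimes>\<^sub>M path_space)"
proof -
  have [measurable]: "growth \<in> count_space UNIV \<rightarrow>\<^sub>M borel" by simp
  have "(\<lambda>(p, s). indicator {0..fst p} s *\<^sub>R growth (chain e (snd p) s)) \<in> borel_measurable ((borel \<Otimes>\<^sub>M path_space) \<Otimes>\<^sub>M lborel)"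
  proof -
    have "(\<lambda>x. (if 0 \<le> snd x \<and> snd x \<le> fst (fst x) then 1 else 0) * growth (chain e (snd (fst x)) (snd x))) \<in> borel_measurable ((borel \<Otimes>\<^sub>M path_space) \<Otimes>\<^sub>M (lborel :: real measure))"
      by measurable
    also have "(\<lambda>x::(real \<times> (nat \<Rightarrow> real)) \<times> real. (if 0 \<le> snd x \<and> snd x \<le> fst (fst x) then 1 else 0) * growth (chain e (snd (fst x)) (snd x))) =
       (\<lambda>(p, s). indicator {0..fst p} s *\<^sub>R growth (chain e (snd p) s))"
      by (auto simp: fun_eq_iff indicator_def)
    finally show ?thesis .
  qed
  then have "(\<lambda>p. \<integral>s. indicator {0..fst p} s *\<^sub>R growth (chain e (snd p) s) \<partial>lborel) \<in> borel_measurable (borel \<Otimes>\<^sub>M path_space)"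
    by (rule lborel.borel_measurable_lebesgue_integral)
  then show ?thesis
    by (simp add: path_growth_def set_lebesgue_integral_def split_beta')
qed

lemma path_growth_measurable [measurable]:
  assumes "g \<in> M \<rightarrow>\<^sub>M path_space" "f \<in> borel_measurable M"
  shows "(\<lambda>x. path_growth e (g x) (f x)) \<in> borel_measurable M"
  using measurable_compose[OF _ path_growth_measurable_pair, of "\<lambda>x. (f x, g x)" M] assms by simp

lemma path_mass_measurable_pair:
  "(\<lambda>(t, w). path_mass e w t) \<in> borel_measurable (borel \<Otimes>\<^sub>M path_space)"
proof -
  have "(\<lambda>(p, s). indicator {0..fst p} s *\<^sub>R exp (path_growth e (snd p) s)) \<in> borel_measurable ((borel \<Otimes>\<^sub>M path_space) \<Otimes>\<^sub>M lborel)"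
  proof -
    have "(\<lambda>x. (if 0 \<le> snd x \<and> snd x \<le> fst (fst x) then 1 else 0) * exp (path_growth e (snd (fst x)) (snd x))) \<in> borel_measurable ((borel \<Otimes>\<^sub>M path_space) \<Otimes>\<^sub>M (lborel :: real measure))"
      by measurable
    also have "(\<lambda>x::(real \<times> (nat \<Rightarrow> real)) \<times> real. (if 0 \<le> snd x \<and> snd x \<le> fst (fst x) then 1 else 0) * exp (path_growth e (snd (fst x)) (snd x))) =
       (\<lambda>(p, s). indicator {0..fst p} s *\<^sub>R exp (path_growth e (snd p) s))"
      by (auto simp: fun_eq_iff indicator_def)
    finally show ?thesis .
  qed
  then have "(\<lambda>p. \<integral>s. indicator {0..fst p} s *\<^sub>R exp (path_growth e (snd p) s) \<partial>lborel) \<in> borel_measurable (borel \<Otimes>\<^sub>M path_space)"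
    by (rule lborel.borel_measurable_lebesgue_integral)
  then show ?thesis
    by (simp add: path_mass_def set_lebesgue_integral_def split_beta')
qed

lemma path_mass_measurable [measurable]:
  assumes "g \<in> M \<rightarrow>\<^sub>M path_space" "f \<in> borel_measurable M"
  shows "(\<lambda>x. path_mass e (g x) (f x)) \<in> borel_measurable M"
  using measurable_compose[OF _ path_mass_measurable_pair, of "\<lambda>x. (f x, g x)" M] assms by simp

lemma path_mass_nonneg: "0 \<le> path_mass e w t"
  unfolding path_mass_integral by (intro integral_nonneg set_borel_integral_eq_integral(1)[OF path_growth_set_integrable]) auto

lemma abs_path_growth:
  assumes "0 \<le> t" shows "\<bar>path_growth e w t\<bar> \<le> bnd * t"
proof -
  have "norm (integral {0..t} (\<lambda>s. growth (chain e w s))) \<le> integral {0..t} (\<lambda>s. bnd)"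
    by (intro integral_norm_bound_integral growth_integrable_on) (auto simp: abs_growth)
  then show ?thesis using assms by (simp add: path_growth_integral content_real mult.commute)
qed

lemma path_growth_le: "0 \<le> t \<Longrightarrow> path_growth e w t \<le> bnd * t"
  using abs_path_growth[of t e w] by linarith

text \<open>The integrand is at least \<open>exp (- (bnd * t))\<close>. Strictness is what later
  excludes positive invariant measures even for mean growth 0.\<close>

lemma path_mass_pos:
  assumes "0 < t" shows "0 < path_mass e w t"
proof -
  have "integral {0..t} (\<lambda>s. exp (- (bnd * t))) \<le> path_mass e w t"
    unfolding path_mass_integral
  proof (intro integral_le set_borel_integral_eq_integral(1)[OF path_growth_set_integrable])
    fix s assume s: "s \<in> {0..t}"
    have "- path_growth e w s \<le> bnd * s" using abs_path_growth[of s e w] s by auto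
    also have "\<dots> \<le> bnd * t" using s bnd_pos by (intro mult_left_mono) auto
    finally show "exp (- (bnd * t)) \<le> exp (path_growth e w s)" by simp
  qed auto
  moreover have "0 < integral {0..t} (\<lambda>s. exp (- (bnd * t)))" using assms by (simp add: content_real)
  ultimately show ?thesis by linarith
qed

lemma path_growth_0 [simp]: "path_growth e w 0 = 0"
  by (simp add: path_growth_integral)
lemma path_mass_0 [simp]: "path_mass e w 0 = 0"
  by (simp add: path_mass_integral)

text \<open>The absolute value makes the flow a semigroup on all of \<open>\<real>\<close>; on \<open>[0,\<infinity>)\<close> it has no effect.\<close>

definition flow :: "real \<Rightarrow> real \<Rightarrow> real \<Rightarrow> real" where
  "flow a m x = \<bar>x\<bar> * exp a / (1 + \<bar>x\<bar> * m)"

text \<open>In the coordinate \<open>1/x\<close> the map \<open>flow a m\<close> is affine, sending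
  \<open>y\<close> to \<open>exp (- a) * (y + m)\<close>. This is the composition rule of such maps,
  and also the rule by which \<open>path_growth\<close> and \<open>path_mass\<close> combine when a
  path is cut in two.\<close>

lemma flow_flow:
  assumes "0 \<le> m" "0 \<le> n"
  shows "flow b n (flow a m x) = flow (a + b) (m + exp a * n) x"
proof -
  have p: "0 < 1 + \<bar>x\<bar> * m" using assms by (simp add: add_pos_nonneg)
  have "flow a m x \<ge> 0" using assms by (simp add: flow_def)
  moreover have "1 + flow a m x * n = (1 + \<bar>x\<bar> * (m + exp a * n)) / (1 + \<bar>x\<bar> * m)"
    using p by (simp add: flow_def field_simps)
  ultimately show ?thesis using p by (simp add: flow_def[of b n] exp_add flow_def)
qed

lemma flow_nonneg: "0 \<le> m \<Longrightarrow> 0 \<le> flow a m x"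
  by (simp add: flow_def)

end

section \<open>Calculus along paths of the chain\<close>

lemma chain_locally_constant:
  assumes fin: "finite {n. jump_time w n \<le> T}" and s: "s < T" "s \<notin> range (jump_time w)"
  shows "\<forall>\<^sub>F u in at s. chain e w u = chain e w s"
proof -
  \<comment> \<open>Up to time \<open>T\<close> the chain compares \<open>u\<close> with finitely
    many jump times only, and each comparison is stable near a point that is not a jump time. The
    jump times need not be ordered, as \<open>w\<close> may take negative values.\<close>
  let ?F = "{n. jump_time w n \<le> T}"
  have "\<forall>\<^sub>F u in at s. (jump_time w n \<le> u) = (jump_time w n \<le> s)" for n
  proof (cases "jump_time w n < s")
    case True
    then show ?thesis by (auto intro: eventually_mono[OF order_tendstoD(1)[OF tendsto_ident_at True]])
  next
    case False
    then have l: "s < jump_time w n" using s(2) by (metis linorder_cases rangeI)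
    then show ?thesis by (auto intro: eventually_mono[OF order_tendstoD(2)[OF tendsto_ident_at l]])
  qed
  then have "\<forall>\<^sub>F u in at s. \<forall>n\<in>?F. (jump_time w n \<le> u) = (jump_time w n \<le> s)"
    using fin by (intro eventually_ball_finite) auto
  moreover have "\<forall>\<^sub>F u in at s. u < T"
    using order_tendstoD(2)[OF tendsto_ident_at s(1)] .
  ultimately show ?thesis
  proof eventually_elim
    case (elim u)
    have "{n. 0 < n \<and> jump_time w n \<le> u} = {n. 0 < n \<and> jump_time w n \<le> s}"
      using elim s by force
    then show ?case by (simp add: chain_def)
  qed
qed

lemma chain_after_explosion:
  assumes inf: "infinite {n. jump_time w n \<le> T}" and s: "T < s"
  shows "chain e w s = e"
proof -
  have "infinite {n. 0 < n \<and> jump_time w n \<le> s}"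
  proof
    assume "finite {n. 0 < n \<and> jump_time w n \<le> s}"
    then have "finite (insert 0 {n. 0 < n \<and> jump_time w n \<le> s})" by simp
    moreover have "{n. jump_time w n \<le> T} \<subseteq> insert 0 {n. 0 < n \<and> jump_time w n \<le> s}"
      using s by auto
    ultimately show False using inf finite_subset by blast
  qed
  then show ?thesis by (simp add: chain_def)
qed

text \<open>
  The jump times may accumulate, but only at one time \<open>c\<close>: before it there are finitely many
  discontinuities on compact intervals, after it the chain is constant by the convention on \<open>card\<close>.
\<close>

lemma has_integral_chain:
  fixes F g :: "real \<Rightarrow> real"
  assumes T: "0 \<le> T" and cont: "continuous_on {0..T} F" and int: "g integrable_on {0..T}"
    and deriv: "\<And>s. 0 < s \<Longrightarrow> s < T \<Longrightarrow> (\<forall>\<^sub>F u in at s. chain e w u = chain e w s) \<Longrightarrow>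
      (F has_vector_derivative g s) (at s)"
  shows "(g has_integral (F T - F 0)) {0..T}"
proof -
  have fin: "(g has_integral (F t - F 0)) {0..t}"
    if t: "0 \<le> t" "t \<le> T" "finite {n. jump_time w n \<le> t}" for t
  proof (rule fundamental_theorem_of_calculus_interior_strong)
    show "finite (jump_time w ` {n. jump_time w n \<le> t})" using t(3) by simp
    fix x assume x: "x \<in> {0<..<t} - jump_time w ` {n. jump_time w n \<le> t}"
    then have "x \<notin> range (jump_time w)" by force
    then show "(F has_vector_derivative g x) (at x)"
      using x t by (intro deriv chain_locally_constant[of w t]) auto
  qed (use t cont in \<open>auto elim: continuous_on_subset\<close>)
  show ?thesis
  proof (cases "finite {n. jump_time w n \<le> T}")
    case True
    then show ?thesis using fin T by auto
  next
    case False
    define X where "X = {s\<in>{0..T}. infinite {n. jump_time w n \<le> s}}"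
    define c where "c = Inf X"
    have TX: "T \<in> X" using False T by (simp add: X_def)
    have bdd: "bdd_below X" by (auto simp: X_def bdd_below_def)
    have c: "0 \<le> c" "c \<le> T"
      using TX bdd unfolding c_def by (auto intro: cInf_lower cInf_greatest simp: X_def)
    have before: "finite {n. jump_time w n \<le> t}" if "0 \<le> t" "t < c" for t
    proof (rule ccontr)
      assume "infinite {n. jump_time w n \<le> t}"
      then have "t \<in> X" using that c by (simp add: X_def)
      then have "c \<le> t" unfolding c_def using bdd by (rule cInf_lower)
      then show False using that by simp
    qed
    have after: "\<forall>\<^sub>F u in at s. chain e w u = chain e w s" if cs: "c < s" for s
    proof -
      obtain t where t: "t \<in> X" "t < s"
        using cInf_lessD[of X s] TX cs unfolding c_def by auto
      then have inf: "infinite {n. jump_time w n \<le> t}" by (simp add: X_def)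
      have "\<forall>\<^sub>F u in at s. t < u" using order_tendstoD(1)[OF tendsto_ident_at t(2)] .
      then show ?thesis
        by eventually_elim (use chain_after_explosion[OF inf] t in auto)
    qed
    have i0: "g integrable_on {0..c}" using int c by (rule_tac integrable_on_subinterval[OF int]) auto
    \<comment> \<open>The identity is known on \<open>{0..t}\<close> for every \<open>t < c\<close>;
      both sides are continuous in \<open>t\<close>, so it reaches the accumulation time
      \<open>c\<close> itself.\<close>
    have "integral {0..c} g - (F c - F 0) = 0"
    proof (cases "c = 0")
      case False
      have cl: "closure {0..<c} = {0..c}" using False c by simp
      have "continuous_on (closure {0..<c}) (\<lambda>t. integral {0..t} g - (F t - F 0))"
        unfolding cl using cont c
        by (intro continuous_intros indefinite_integral_continuous_1[OF i0]) (auto elim: continuous_on_subset)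
      then show ?thesis
      proof (rule continuous_constant_on_closure)
        show "integral {0..t} g - (F t - F 0) = 0" if "t \<in> {0..<c}" for t
          using integral_unique[OF fin[of t]] that before c by auto
      qed (use cl c in auto)
    qed simp
    then have 1: "(g has_integral (F c - F 0)) {0..c}"
      using integrable_integral[OF i0] by simp
    have 2: "(g has_integral (F T - F c)) {c..T}"
    proof (rule fundamental_theorem_of_calculus_interior_strong)
      show "(F has_vector_derivative g x) (at x)" if "x \<in> {c<..<T} - {}" for x
        using that c by (intro deriv after) auto
    qed (use c cont in \<open>auto elim: continuous_on_subset\<close>)
    show ?thesis using has_integral_combine[OF c 1 2] by simp
  qed
qed

context logistic_switching begin

lemma path_growth_measurable_time [measurable]: "path_growth e w \<in> borel_measurable borel"
  using path_growth_measurable[of "\<lambda>_. w" borel "\<lambda>t. t" e] by (simp add: space_PiM)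

lemma path_mass_measurable_time [measurable]: "path_mass e w \<in> borel_measurable borel"
  using path_mass_measurable[of "\<lambda>_. w" borel "\<lambda>t. t" e] by (simp add: space_PiM)

lemma path_mass_continuous: "continuous_on {0..t} (path_mass e w)"
  using indefinite_integral_continuous_1[OF set_borel_integral_eq_integral(1)[OF path_growth_set_integrable]]
  by (simp add: path_mass_integral[abs_def])

lemma path_growth_deriv:
  assumes "0 < s" and ev: "\<forall>\<^sub>F u in at s. chain e w u = chain e w s"
  shows "(path_growth e w has_real_derivative growth (chain e w s)) (at s)"
proof -
  have "isCont (\<lambda>u. growth (chain e w u)) s"
    unfolding isCont_def
    by (rule tendsto_eventually) (use ev in eventually_elim, simp)
  then have "continuous (at s within {0..s+1} - {}) (\<lambda>u. growth (chain e w u))"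
    by (rule continuous_at_imp_continuous_at_within)
  from integral_has_vector_derivative_continuous_at[OF growth_integrable_on _ _ this]
  have "(path_growth e w has_real_derivative growth (chain e w s)) (at s within {0..s+1})"
    using assms by (auto simp: has_real_derivative_iff_has_vector_derivative path_growth_integral[abs_def])
  then show ?thesis using assms by (subst (asm) at_within_Icc_at) auto
qed

lemma path_mass_deriv:
  assumes "0 < s"
  shows "(path_mass e w has_real_derivative exp (path_growth e w s)) (at s)"
proof -
  have "continuous_on {0..s+1} (\<lambda>u. exp (path_growth e w u))"
    by (intro continuous_intros path_growth_continuous)
  from integral_has_real_derivative[OF this, of s]
  have "(path_mass e w has_real_derivative exp (path_growth e w s)) (at s within {0..s+1})"
    using assms by (auto simp: path_mass_integral[abs_def])
  then show ?thesis using assms by (subst (asm) at_within_Icc_at) auto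
qed

definition path :: "int \<Rightarrow> (nat \<Rightarrow> real) \<Rightarrow> real \<Rightarrow> real \<Rightarrow> real" where
  "path e w x t = flow (path_growth e w t) (path_mass e w t) x"

lemma path_measurable [measurable]:
  assumes [measurable]: "g \<in> M \<rightarrow>\<^sub>M path_space" "f \<in> borel_measurable M"
    "h \<in> borel_measurable M"
  shows "(\<lambda>x. path e (g x) (h x) (f x)) \<in> borel_measurable M"
  unfolding path_def flow_def by measurable

lemma path_measurable_time [measurable]: "path e w x \<in> borel_measurable borel"
  using path_measurable[of "\<lambda>_. w" borel "\<lambda>t. t" "\<lambda>_. x" e] by (simp add: space_PiM)

lemma path_denominator_pos: "0 < 1 + \<bar>x\<bar> * path_mass e w t"
  by (simp add: add_pos_nonneg path_mass_nonneg)

lemma path_nonneg: "0 \<le> path e w x t"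
  unfolding path_def by (rule flow_nonneg) (rule path_mass_nonneg)

lemma path_continuous: "continuous_on {0..t} (path e w x)"
  unfolding path_def[abs_def] flow_def using path_denominator_pos[of x e w]
  by (intro continuous_intros path_growth_continuous path_mass_continuous) (metis less_irrefl)

lemma path_solution:
  assumes "0 \<le> x"
  shows "switched_solution field (chain e w) x (path e w x)"
  unfolding switched_solution_def
proof (intro allI impI conjI path_nonneg)
  fix t :: real assume t: "0 \<le> t"
  have "((\<lambda>s. field (chain e w s) (path e w x s)) has_integral (path e w x t - path e w x 0)) {0..t}"
  proof (rule has_integral_chain[OF t path_continuous])
    \<comment> \<open>The growth rate may switch infinitely often before \<open>t\<close>, so this
      part is integrable as a bounded measurable function, while the quadratic part is
      continuous.\<close>
    have "set_integrable lborel {0..t} (\<lambda>s. growth (chain e w s) * path e w x s)"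
    proof -
      have "integrable lborel (\<lambda>s. indicator {0..t} s *\<^sub>R (bnd * path e w x s))"
        by (intro borel_integrable_compact continuous_intros path_continuous) auto
      moreover have [measurable]: "growth \<in> count_space UNIV \<rightarrow>\<^sub>M borel" by simp
      ultimately show ?thesis unfolding set_integrable_def
        by (rule_tac Bochner_Integration.integrable_bound)
          (use abs_growth bnd_pos in \<open>auto simp: indicator_def abs_mult path_nonneg intro!: mult_right_mono AE_I2\<close>)
    qed
    moreover have "(\<lambda>s. (path e w x s)\<^sup>2) integrable_on {0..t}"
      by (intro integrable_continuous_real continuous_intros path_continuous)
    ultimately show "(\<lambda>s. field (chain e w s) (path e w x s)) integrable_on {0..t}"
      unfolding field_eq using set_borel_integral_eq_integral(1) by (intro integrable_diff) auto
  next
    fix s assume s: "0 < s" "\<forall>\<^sub>F u in at s. chain e w u = chain e w s"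
    have alg: "(X * (a * g) * m - X * a * (X * a)) / (m * m) = g * (X * a / m) - (X * a / m)\<^sup>2"
      if "m \<noteq> 0" for m X a g :: real
      using that by (simp add: field_simps power2_eq_square)
    let ?m = "1 + \<bar>x\<bar> * path_mass e w s" and ?a = "exp (path_growth e w s)"
    have "(path e w x has_real_derivative
      (\<bar>x\<bar> * (?a * growth (chain e w s)) * ?m - \<bar>x\<bar> * ?a * (\<bar>x\<bar> * ?a)) / (?m * ?m)) (at s)"
      unfolding path_def[abs_def] flow_def using path_denominator_pos[of x e w s]
      by (auto intro!: derivative_eq_intros path_growth_deriv path_mass_deriv s)
    also have "(\<bar>x\<bar> * (?a * growth (chain e w s)) * ?m - \<bar>x\<bar> * ?a * (\<bar>x\<bar> * ?a)) / (?m * ?m) =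
        field (chain e w s) (path e w x s)"
      using alg[of ?m "\<bar>x\<bar>" ?a] path_denominator_pos[of x e w s] by (simp add: field_eq path_def flow_def)
    finally show "(path e w x has_vector_derivative field (chain e w s) (path e w x s)) (at s)"
      by (simp add: has_real_derivative_iff_has_vector_derivative)
  qed
  moreover have "path e w x 0 = x" using assms by (simp add: path_def flow_def)
  ultimately show "((\<lambda>s. field (chain e w s) (path e w x s)) has_integral (path e w x t - x)) {0..t}"
    by simp
qed

text \<open>Gronwall in integrated form, since a solution may have no derivative at a switch. The
  integral \<open>D\<close> of \<open>|x - y|\<close> is differentiable inside the interval,
  satisfies \<open>D' \<le> K * D\<close> and starts at 0.\<close>

lemma solution_unique:
  assumes x: "switched_solution field (chain e w) x0 x" and y: "switched_solution field (chain e w) x0 y"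
    and T: "0 \<le> T"
  shows "x T = y T"
proof -
  have cont: "continuous_on {0..T} z" if z: "switched_solution field (chain e w) x0 z" for z
  proof -
    have i: "(\<lambda>s. field (chain e w s) (z s)) integrable_on {0..T}"
      using z T by (auto simp: switched_solution_def)
    have "continuous_on {0..T} (\<lambda>t. x0 + integral {0..t} (\<lambda>s. field (chain e w s) (z s)))"
      by (intro continuous_intros indefinite_integral_continuous_1 i)
    then show ?thesis
    proof (rule continuous_on_eq)
      fix t assume "t \<in> {0..T}"
      then have "((\<lambda>s. field (chain e w s) (z s)) has_integral (z t - x0)) {0..t}"
        using z by (simp add: switched_solution_def)
      from integral_unique[OF this] show "x0 + integral {0..t} (\<lambda>s. field (chain e w s) (z s)) = z t"
        by simp
    qed
  qed
  have nonneg: "0 \<le> x t" "0 \<le> y t" if "0 \<le> t" for t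
    using that x y by (auto simp: switched_solution_def)
  have bdd: "\<exists>B. \<forall>t\<in>{0..T}. z t \<le> B" if "switched_solution field (chain e w) x0 z" for z
    using continuous_attains_sup[OF compact_Icc _ cont[OF that]] T by (auto simp: Bex_def)
  obtain Bx By where Bx: "\<And>t. t \<in> {0..T} \<Longrightarrow> x t \<le> Bx" and By: "\<And>t. t \<in> {0..T} \<Longrightarrow> y t \<le> By"
    using bdd[OF x] bdd[OF y] by blast
  \<comment> \<open>The difference of the fields factors as
    \<open>(growth - x - y) * (x - y)\<close>; \<open>K\<close> bounds the first factor on
    \<open>{0..T}\<close>.\<close>
  define K where "K = bnd + Bx + By"
  define z where "z = (\<lambda>t. \<bar>x t - y t\<bar>)"
  define D where "D = (\<lambda>t. integral {0..t} z)"
  have cz: "continuous_on {0..T} z" unfolding z_def by (intro continuous_intros cont x y)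
  have cz': "continuous_on {0..t} z" if "t \<le> T" for t
    using continuous_on_subset[OF cz] that by auto
  have bound: "z t \<le> K * D t" if t: "t \<in> {0..T}" for t
  proof -
    have "((\<lambda>s. field (chain e w s) (x s) - field (chain e w s) (y s)) has_integral (x t - x0 - (y t - x0))) {0..t}"
      using x y t by (intro has_integral_diff) (auto simp: switched_solution_def)
    then have 1: "((\<lambda>s. field (chain e w s) (x s) - field (chain e w s) (y s)) has_integral (x t - y t)) {0..t}"
      by simp
    have 2: "(\<lambda>s. K * z s) integrable_on {0..t}"
      using t by (intro integrable_continuous_real continuous_intros cz') auto
    have "norm (integral {0..t} (\<lambda>s. field (chain e w s) (x s) - field (chain e w s) (y s))) \<le> integral {0..t} (\<lambda>s. K * z s)"
    proof (rule integral_norm_bound_integral[OF has_integral_integrable[OF 1] 2])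
      fix s assume s: "s \<in> {0..t}"
      have "field (chain e w s) (x s) - field (chain e w s) (y s) = (growth (chain e w s) - x s - y s) * (x s - y s)"
        by (simp add: field_eq algebra_simps power2_eq_square)
      moreover have "\<bar>growth (chain e w s) - x s - y s\<bar> \<le> K"
        using abs_growth[of "chain e w s"] nonneg[of s] Bx[of s] By[of s] s t
        unfolding K_def by (auto simp: abs_le_iff)
      ultimately show "norm (field (chain e w s) (x s) - field (chain e w s) (y s)) \<le> K * z s"
        by (simp add: abs_mult z_def mult_right_mono)
    qed
    then show ?thesis using integral_unique[OF 1] by (simp add: z_def D_def)
  qed
  have "exp (- K * T) * D T \<le> exp (- K * 0) * D 0"
  proof (rule DERIV_nonpos_imp_decreasing_open[OF T])
    fix t assume t: "0 < t" "t < T"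
    have "(D has_real_derivative z t) (at t within {0..T})"
      unfolding D_def using t by (intro integral_has_real_derivative cz) auto
    then have "(D has_real_derivative z t) (at t)" using t by (subst (asm) at_within_Icc_at) auto
    then have "((\<lambda>t. exp (- K * t) * D t) has_real_derivative (exp (- K * t) * z t - K * exp (- K * t) * D t)) (at t)"
      by (auto intro!: derivative_eq_intros)
    moreover have "exp (- K * t) * z t - K * exp (- K * t) * D t \<le> 0"
      using bound[of t] t by (simp add: algebra_simps)
    ultimately show "\<exists>y. ((\<lambda>t. exp (- K * t) * D t) has_real_derivative y) (at t) \<and> y \<le> 0" by blast
  qed (auto simp: D_def intro!: continuous_intros indefinite_integral_continuous_1 integrable_continuous_real cz)
  then have "D T \<le> 0" by (simp add: D_def mult_le_0_iff)
  moreover have "0 \<le> D T" unfolding D_def z_def by (intro integral_nonneg integrable_continuous_real cz[unfolded z_def]) auto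
  ultimately have "z T \<le> 0" using bound[of T] T by simp
  then show ?thesis by (simp add: z_def)
qed

text \<open>Valid for every \<open>w\<close>, so the map under \<open>distr\<close> in
  \<open>semigroup_P\<close> is the measurable map \<open>path\<close>; an almost sure identity
  would leave its measurability open.\<close>

lemma position_eq:
  assumes "0 \<le> x" "0 \<le> t"
  shows "position field (x, e) w t = path e w x t"
  unfolding position_def
proof (rule the_equality)
  show "\<exists>y. switched_solution field (chain (snd (x, e)) w) (fst (x, e)) y \<and> y t = path e w x t"
    using path_solution[OF assms(1)] by auto
  show "y = path e w x t" if "\<exists>z. switched_solution field (chain (snd (x, e)) w) (fst (x, e)) z \<and> z t = y" for y
    using that solution_unique[OF _ path_solution[OF assms(1)] assms(2), of e w] by auto
qed

section \<open>Splitting a path at the first holding time\<close>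

definition mass :: "real \<Rightarrow> real \<Rightarrow> real" where
  "mass p s = (exp (p * s) - 1) / p"

lemma mass_nonneg: "p \<noteq> 0 \<Longrightarrow> 0 \<le> s \<Longrightarrow> 0 \<le> mass p s"
  unfolding mass_def by (cases "0 < p") (auto simp: divide_le_0_iff zero_le_divide_iff mult_nonpos_nonneg)

lemma path_growth_case_nat:
  assumes w: "regular w" and s: "0 \<le> s"
  shows "path_growth e (case_nat s w) t =
    (if t < s then (if 0 \<le> t then growth e * t else 0) else growth e * s + path_growth (-e) w (t - s))"
proof (cases "t < s")
  case True
  have "integral {0..t} (\<lambda>u. growth (chain e (case_nat s w) u)) = integral {0..t} (\<lambda>u. growth e)"
    using True by (intro integral_cong) (auto simp: chain_case_nat[OF w s])
  then show ?thesis using True by (simp add: path_growth_integral content_real mult.commute)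
next
  case False
  have "((\<lambda>u. growth e) has_integral (growth e * s)) {0..s}"
    using has_integral_const_real[of "growth e" 0 s] s by (simp add: content_real mult.commute)
  \<comment> \<open>At time \<open>s\<close> the chain has already switched, so the integrand may
    differ from \<open>growth e\<close> at that single point.\<close>
  then have 1: "((\<lambda>u. growth (chain e (case_nat s w) u)) has_integral (growth e * s)) {0..s}"
    by (rule has_integral_spike_finite[of "{s}", rotated 2]) (auto simp: chain_case_nat[OF w s])
  have "((\<lambda>u. growth (chain (-e) w u)) has_integral path_growth (-e) w (t - s)) {0..t-s}"
    unfolding path_growth_integral by (rule integrable_integral) (rule growth_integrable_on)
  then have "(((\<lambda>u. growth (chain e (case_nat s w) u)) \<circ> (+) s) has_integral path_growth (-e) w (t - s)) {0..t-s}"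
    by (rule has_integral_eq[rotated]) (auto simp: chain_case_nat[OF w s])
  then have 2: "((\<lambda>u. growth (chain e (case_nat s w) u)) has_integral path_growth (-e) w (t - s)) {s..t}"
    by (subst (asm) has_integral_shift_Icc_real) simp
  from integral_unique[OF has_integral_combine[OF s _ 1 2]] False show ?thesis
    by (simp add: path_growth_integral[of e])
qed

lemma has_integral_exp_growth:
  assumes "0 \<le> s" "p \<noteq> 0"
  shows "((\<lambda>u. exp (p * u)) has_integral mass p s) {0..s}"
proof -
  have "((\<lambda>u. exp (p * u)) has_integral (exp (p * s) / p - exp (p * 0) / p)) {0..s}"
    using assms by (intro fundamental_theorem_of_calculus)
      (auto intro!: derivative_eq_intros simp: has_real_derivative_iff_has_vector_derivative[symmetric])
  then show ?thesis by (simp add: mass_def diff_divide_distrib)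
qed

lemma path_mass_case_nat:
  assumes w: "regular w" and s: "0 \<le> s" and t: "0 \<le> t"
  shows "path_mass e (case_nat s w) t =
    (if t < s then mass (growth e) t else mass (growth e) s + exp (growth e * s) * path_mass (-e) w (t - s))"
proof (cases "t < s")
  case True
  have "((\<lambda>u. exp (path_growth e (case_nat s w) u)) has_integral mass (growth e) t) {0..t}"
    using has_integral_exp_growth[OF t growth_nonzero[of e]]
    by (rule has_integral_eq[rotated]) (use True in \<open>auto simp: path_growth_case_nat[OF w s]\<close>)
  then show ?thesis using True by (simp add: path_mass_integral integral_unique)
next
  case False
  have 1: "((\<lambda>u. exp (path_growth e (case_nat s w) u)) has_integral mass (growth e) s) {0..s}"
    using has_integral_exp_growth[OF s growth_nonzero[of e]]
    by (rule has_integral_eq[rotated]) (auto simp: path_growth_case_nat[OF w s])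
  have "((\<lambda>u. exp (growth e * s) * exp (path_growth (-e) w u)) has_integral exp (growth e * s) * path_mass (-e) w (t - s)) {0..t-s}"
    unfolding path_mass_integral
    by (intro has_integral_mult_right integrable_integral set_borel_integral_eq_integral(1)[OF path_growth_set_integrable])
  then have "(((\<lambda>u. exp (path_growth e (case_nat s w) u)) \<circ> (+) s) has_integral exp (growth e * s) * path_mass (-e) w (t - s)) {0..t-s}"
    by (rule has_integral_eq[rotated]) (auto simp: path_growth_case_nat[OF w s] exp_add)
  then have 2: "((\<lambda>u. exp (path_growth e (case_nat s w) u)) has_integral exp (growth e * s) * path_mass (-e) w (t - s)) {s..t}"
    by (subst (asm) has_integral_shift_Icc_real) simp
  from integral_unique[OF has_integral_combine[OF s _ 1 2]] False show ?thesis
    by (simp add: path_mass_integral[of e])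
qed

text \<open>The flow of the single field \<open>field e\<close> for time \<open>s\<close>:
  \<open>mass p s\<close> is the integral of \<open>exp (p * u)\<close> over \<open>{0..s}\<close>,
  hence the value of \<open>path_mass\<close> as long as no switch occurs.\<close>

definition leg :: "int \<Rightarrow> real \<Rightarrow> real \<Rightarrow> real" where
  "leg e s x = flow (growth e * s) (mass (growth e) s) x"

lemma leg_measurable [measurable]:
  assumes [measurable]: "f \<in> borel_measurable M" "g \<in> borel_measurable M"
  shows "(\<lambda>x. leg e (f x) (g x)) \<in> borel_measurable M"
  unfolding leg_def flow_def mass_def by measurable

text \<open>The pathwise form of the renewal equation; after the first switch it is the composition
  rule \<open>flow_flow\<close>.\<close>

lemma path_case_nat:
  assumes w: "regular w" and s: "0 \<le> s" and t: "0 \<le> t"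
  shows "path e (case_nat s w) x t = (if t < s then leg e t x else path (-e) w (leg e s x) (t - s))"
proof (cases "t < s")
  case False
  then show ?thesis
    unfolding path_def leg_def path_growth_case_nat[OF w s] path_mass_case_nat[OF w s t]
    by (simp add: flow_flow path_mass_nonneg mass_nonneg s growth_nonzero)
qed (use t in \<open>simp add: path_def leg_def path_growth_case_nat[OF w s] path_mass_case_nat[OF w s t]\<close>)

end

section \<open>The semigroup and its renewal equation\<close>

lemma space_state_space: "space state_space = {0..} \<times> state_index"
  by (simp add: state_space_def space_pair_measure space_restrict_space)

lemma fst_state_space [measurable]: "fst \<in> state_space \<rightarrow>\<^sub>M borel"
proof -
  have "fst \<in> state_space \<rightarrow>\<^sub>M restrict_space borel {0::real..}" by (simp add: state_space_def)
  then show ?thesis by (simp add: measurable_restrict_space2_iff)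
qed

lemma snd_state_space': "snd \<in> state_space \<rightarrow>\<^sub>M count_space state_index"
  by (simp add: state_space_def)

lemma snd_state_space [measurable]: "snd \<in> state_space \<rightarrow>\<^sub>M count_space UNIV"
  by (rule measurable_compose[OF snd_state_space']) simp

lemma indexed_measurable:
  fixes h :: "int \<Rightarrow> real \<Rightarrow> 'a::topological_space"
  assumes "\<And>i. h i \<in> borel_measurable borel" and "k \<in> M \<rightarrow>\<^sub>M count_space UNIV"
    and "f \<in> borel_measurable M"
  shows "(\<lambda>x. h (k x) (f x)) \<in> borel_measurable M"
  by (rule measurable_compose_countable'[where I = UNIV and f = "\<lambda>i x. h i (f x)"])
    (use assms in \<open>auto intro: measurable_compose\<close>)

lemma pair_in_state_space:
  assumes [measurable]: "f \<in> borel_measurable M" "k \<in> M \<rightarrow>\<^sub>M count_space UNIV"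
    and "\<And>x. x \<in> space M \<Longrightarrow> 0 \<le> f x" "\<And>x. x \<in> space M \<Longrightarrow> k x \<in> state_index"
  shows "(\<lambda>x. (f x, k x)) \<in> M \<rightarrow>\<^sub>M state_space"
  unfolding state_space_def
proof (rule measurable_Pair)
  show "f \<in> M \<rightarrow>\<^sub>M restrict_space borel {0..}"
    using assms by (intro measurable_restrict_space2) auto
  have "k \<in> M \<rightarrow>\<^sub>M restrict_space (count_space UNIV) state_index"
    using assms by (intro measurable_restrict_space2) auto
  then show "k \<in> M \<rightarrow>\<^sub>M count_space state_index"
    by (simp add: restrict_count_space)
qed

text \<open>Test functions are taken on the whole real line, one for each state. The map
  \<open>max 0\<close> retracts the line into the state space, so that a section becomes a
  preimage.\<close>

lemma section_borel:
  assumes "A \<in> sets state_space" shows "{x. (x, i) \<in> A} \<in> sets borel"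
proof (cases "i \<in> state_index")
  case True
  have "(\<lambda>x. (max 0 x, i)) \<in> borel \<rightarrow>\<^sub>M state_space"
    using True by (intro pair_in_state_space) auto
  then have "(\<lambda>x. (max 0 x, i)) -` A \<inter> space borel \<inter> {0..} \<in> sets (borel :: real measure)"
    using assms by (intro sets.Int measurable_sets) auto
  also have "(\<lambda>x. (max 0 x, i)) -` A \<inter> space borel \<inter> {0..} = {x. (x, i) \<in> A}"
    using sets.sets_into_space[OF assms] by (auto simp: space_state_space max_def)
  finally show ?thesis .
next
  case False
  then have "{x. (x, i) \<in> A} = {}" using sets.sets_into_space[OF assms] by (auto simp: space_state_space)
  then show ?thesis by simp
qed

lemma indicator_section_measurable:
  assumes "A \<in> sets state_space" shows "(\<lambda>x. indicator A (x, i) :: ennreal) \<in> borel_measurable borel"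
proof -
  have "(\<lambda>x. indicator A (x, i) :: ennreal) = indicator {x. (x, i) \<in> A}" by (auto simp: indicator_def fun_eq_iff)
  then show ?thesis using section_borel[OF assms] by simp
qed

lemma nn_integral_exponential_weight:
  assumes "0 < l" "0 \<le> t"
  shows "(\<integral>\<^sup>+ s. ennreal (l * exp (- (l * s))) * indicator {0..t} s \<partial>lborel) = ennreal (1 - exp (- (l * t)))"
proof -
  have "(\<integral>\<^sup>+ s. ennreal (l * exp (- (l * s))) * indicator {0..t} s \<partial>lborel) =
    - exp (- (l * t)) - (- exp (- (l * 0)))"
    using assms by (intro nn_integral_FTC_Icc) (auto intro!: derivative_eq_intros)
  then show ?thesis by simp
qed

lemma nn_integral_exponential_tail:
  assumes "0 < l" "0 \<le> t"
  shows "(\<integral>\<^sup>+ s. ennreal (l * exp (- (l * s))) * indicator {t..} s \<partial>lborel) = ennreal (exp (- (l * t)))"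
proof -
  have "filterlim (\<lambda>s. l * s) at_top at_top"
    using assms by (intro filterlim_tendsto_pos_mult_at_top[OF tendsto_const]) (auto simp: filterlim_ident)
  then have "((\<lambda>s. - exp (- (l * s))) \<longlongrightarrow> - 0) at_top"
    by (intro tendsto_intros filterlim_compose[OF exp_at_bot] filterlim_compose[OF filterlim_uminus_at_bot_at_top])
  then have "(\<integral>\<^sup>+ s. ennreal (l * exp (- (l * s))) * indicator {t..} s \<partial>lborel) = 0 - (- exp (- (l * t)))"
    using assms by (intro nn_integral_FTC_atLeast) (auto intro!: derivative_eq_intros)
  then show ?thesis by simp
qed

context logistic_switching begin

abbreviation mean :: "(real \<times> int) measure \<Rightarrow> (int \<Rightarrow> real \<Rightarrow> ennreal) \<Rightarrow> ennreal" where
  "mean \<mu> h \<equiv> \<integral>\<^sup>+ z. h (snd z) (fst z) \<partial>\<mu>"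

text \<open>The semigroup acting on \<open>h\<close>, whose first argument is the state. It makes
  sense for all real \<open>x\<close> and all integers \<open>e\<close>, which keeps measurability
  apart from the restricted state space; \<open>nn_integral_P\<close> ties it to
  \<open>semigroup_P\<close>.\<close>

definition expect :: "(int \<Rightarrow> real \<Rightarrow> ennreal) \<Rightarrow> real \<Rightarrow> int \<Rightarrow> real \<Rightarrow> ennreal" where
  "expect h t e x = (\<integral>\<^sup>+ w. h (chain e w t) (path e w x t) \<partial>holding e)"

definition weight :: "int \<Rightarrow> real \<Rightarrow> ennreal" where
  "weight e s = ennreal (rate e * exp (- (rate e * s)))"

lemma weight_measurable [measurable]: "weight e \<in> borel_measurable borel"
  unfolding weight_def[abs_def] by measurable

lemma expect_measurable [measurable (raw)]:
  assumes h[measurable]: "\<And>i. h i \<in> borel_measurable borel"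
    and [measurable]: "f \<in> borel_measurable M" "g \<in> borel_measurable M"
  shows "(\<lambda>x. expect h (f x) e (g x)) \<in> borel_measurable M"
proof -
  note [measurable (raw)] = indexed_measurable[OF h]
  interpret prob_space "holding e" by (rule prob_holding)
  have "(\<lambda>p. expect h (fst p) e (snd p)) \<in> borel_measurable (borel \<Otimes>\<^sub>M borel)"
    unfolding expect_def by measurable
  from measurable_compose[OF _ this, of "\<lambda>x. (f x, g x)" M] show ?thesis by simp
qed

lemma expect_measurable2 [measurable (raw)]:
  assumes h[measurable]: "\<And>i. h i \<in> borel_measurable borel"
    and [measurable]: "f \<in> borel_measurable M" "g \<in> borel_measurable M" "k \<in> M \<rightarrow>\<^sub>M count_space UNIV"
  shows "(\<lambda>x. expect h (f x) (k x) (g x)) \<in> borel_measurable M"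
  by (rule measurable_compose_countable'[where I = UNIV and f = "\<lambda>i x. expect h (f x) i (g x)"]) auto

text \<open>Condition on the first holding time \<open>s\<close>. If \<open>s > t\<close>, the
  position has moved along one flow up to \<open>t\<close>; otherwise the remaining holding times
  drive an independent path from \<open>leg e s x\<close> in the state \<open>-e\<close> for the
  time \<open>t - s\<close>.\<close>

lemma expect_renewal:
  assumes h[measurable]: "\<And>i. h i \<in> borel_measurable borel" and t: "0 \<le> t"
  shows "expect h t e x = ennreal (exp (- (rate e * t))) * h e (leg e t x) +
    (\<integral>\<^sup>+ s. weight e s * indicator {0..t} s * expect h (t - s) (-e) (leg e s x) \<partial>lborel)"
proof -
  note [measurable (raw)] = indexed_measurable[OF h]
  interpret H: prob_space "holding (-e)" by (rule prob_holding)
  have "expect h t e x = (\<integral>\<^sup>+ s. ennreal (exponential_density (rate e) s) *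
     (\<integral>\<^sup>+ w. h (chain e (case_nat s w) t) (path e (case_nat s w) x t) \<partial>holding (-e)) \<partial>lborel)"
    unfolding expect_def by (rule nn_integral_holding_space[OF rate_pos]) measurable
  also have "\<dots> = (\<integral>\<^sup>+ s. weight e s * indicator {t..} s * h e (leg e t x) +
      weight e s * indicator {0..t} s * expect h (t - s) (-e) (leg e s x) \<partial>lborel)"
  proof (intro nn_integral_cong_AE)
    show "AE s in lborel. ennreal (exponential_density (rate e) s) *
       (\<integral>\<^sup>+ w. h (chain e (case_nat s w) t) (path e (case_nat s w) x t) \<partial>holding (-e)) =
       weight e s * indicator {t..} s * h e (leg e t x) +
      weight e s * indicator {0..t} s * expect h (t - s) (-e) (leg e s x)"
      \<comment> \<open>The intervals \<open>{t..}\<close> and \<open>{0..t}\<close> overlap in the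
        point \<open>t\<close>, which is a null set.\<close>
      using AE_lborel_singleton[of t]
    proof eventually_elim
      case (elim s)
      show ?case
      proof (cases "s < 0")
        case True
        then show ?thesis using t by (simp add: exponential_density_def)
      next
        case False
        then have s: "0 \<le> s" by simp
        have w: "ennreal (exponential_density (rate e) s) = weight e s"
          using False by (simp add: exponential_density_def weight_def mult.commute)
        have "(\<integral>\<^sup>+ w. h (chain e (case_nat s w) t) (path e (case_nat s w) x t) \<partial>holding (-e)) =
          (\<integral>\<^sup>+ w. (if t < s then h e (leg e t x) else h (chain (-e) w (t - s)) (path (-e) w (leg e s x) (t - s)))
             \<partial>holding (-e))"
        proof (intro nn_integral_cong_AE)
          show "AE w in holding (-e). h (chain e (case_nat s w) t) (path e (case_nat s w) x t) =
             (if t < s then h e (leg e t x) else h (chain (-e) w (t - s)) (path (-e) w (leg e s x) (t - s)))"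
            using AE_regular_holding by eventually_elim (simp add: chain_case_nat path_case_nat s t)
        qed
        also have "\<dots> = (if t < s then h e (leg e t x) else expect h (t - s) (-e) (leg e s x))"
          using H.emeasure_space_1 by (simp add: expect_def)
        finally show ?thesis using elim s by (auto simp: w indicator_def)
      qed
    qed
  qed
  also have "\<dots> = (\<integral>\<^sup>+ s. weight e s * indicator {t..} s \<partial>lborel) * h e (leg e t x) +
      (\<integral>\<^sup>+ s. weight e s * indicator {0..t} s * expect h (t - s) (-e) (leg e s x) \<partial>lborel)"
    by (subst nn_integral_add) (auto simp: nn_integral_multc)
  finally show ?thesis unfolding weight_def nn_integral_exponential_tail[OF rate_pos t] .
qed

section \<open>Transition kernel and invariance\<close>

abbreviation "P \<equiv> semigroup_P field rate"
abbreviation "invariant \<equiv> invariant_prob field rate"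
abbreviation "ergodic \<equiv> ergodic_prob field rate"

lemma P_eq:
  assumes "0 \<le> x" "0 \<le> t"
  shows "P t (x, e) = distr (holding e) state_space (\<lambda>w. (path e w x t, chain e w t))"
  by (simp add: semigroup_P_def position_eq[OF assms])

lemma state_measurable:
  assumes "e \<in> state_index"
  shows "(\<lambda>w. (path e w x t, chain e w t)) \<in> holding e \<rightarrow>\<^sub>M state_space"
  using assms by (intro pair_in_state_space chain_in_state_index path_nonneg) auto

lemma nn_integral_P:
  assumes h[measurable]: "\<And>i. h i \<in> borel_measurable borel" and z: "z \<in> space state_space" "0 \<le> t"
  shows "(\<integral>\<^sup>+ y. h (snd y) (fst y) \<partial>P t z) = expect h t (snd z) (fst z)"
proof -
  note [measurable (raw)] = indexed_measurable[OF h]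
  obtain x e where z': "z = (x, e)" "0 \<le> x" "e \<in> state_index" using z by (auto simp: space_state_space)
  have "(\<integral>\<^sup>+ y. h (snd y) (fst y) \<partial>P t z) = expect h t e x"
    unfolding z' P_eq[OF z'(2) z(2)] expect_def
    by (subst nn_integral_distr[OF state_measurable]) (use z' in auto)
  then show ?thesis by (simp add: z')
qed

lemma sets_P: "sets (P t z) = sets state_space" by (simp add: semigroup_P_def)

lemma emeasure_P:
  assumes A: "A \<in> sets state_space" and z: "z \<in> space state_space" "0 \<le> t"
  shows "emeasure (P t z) A = expect (\<lambda>i x. indicator A (x, i)) t (snd z) (fst z)"
  using nn_integral_P[OF indicator_section_measurable[OF A] z, of "\<lambda>i. i"] A by (simp add: sets_P)

lemma prob_space_P:
  assumes z: "z \<in> space state_space" "0 \<le> t"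
  shows "prob_space (P t z)"
proof -
  obtain x e where z': "z = (x, e)" "0 \<le> x" "e \<in> state_index" using z by (auto simp: space_state_space)
  interpret prob_space "holding e" by (rule prob_holding)
  show ?thesis unfolding z' P_eq[OF z'(2) z(2)] by (intro prob_space_distr state_measurable z')
qed

lemma P_kernel:
  assumes t: "0 \<le> t" and [measurable_cong]: "sets M = sets state_space"
  shows "P t \<in> M \<rightarrow>\<^sub>M subprob_algebra state_space"
proof (rule measurable_subprob_algebra)
  have sp: "space M = space state_space" using assms by (intro sets_eq_imp_space_eq)
  show "subprob_space (P t a)" if "a \<in> space M" for a
    using prob_space_P[OF _ t] that sp by (simp add: prob_space_imp_subprob_space)
  fix A assume A: "A \<in> sets state_space"
  have [measurable]: "\<And>i. (\<lambda>x. indicator A (x, i) :: ennreal) \<in> borel_measurable borel"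
    using indicator_section_measurable[OF A] .
  have "(\<lambda>z. expect (\<lambda>i x. indicator A (x, i)) t (snd z) (fst z)) \<in> borel_measurable M"
    by measurable
  then show "(\<lambda>a. emeasure (P t a) A) \<in> borel_measurable M"
    by (subst measurable_cong[OF emeasure_P[OF A _ t]]) (auto simp: sp)
qed (rule sets_P)

text \<open>Invariance passes from sets to test functions through the equation of measures
  \<open>\<mu> \<bind> P t = \<mu>\<close>; conversely, indicators are test functions.\<close>

lemma invariant_iff:
  "invariant \<mu> \<longleftrightarrow> prob_space \<mu> \<and> sets \<mu> = sets state_space \<and>
    (\<forall>t\<ge>0. \<forall>h. (\<forall>i. h i \<in> borel_measurable borel) \<longrightarrow>
      mean \<mu> (expect h t) = mean \<mu> h)"
proof (cases "prob_space \<mu> \<and> sets \<mu> = sets state_space")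
  case True
  then interpret prob_space \<mu> by simp
  have S[measurable_cong]: "sets \<mu> = sets state_space" using True by simp
  have sp: "space \<mu> = space state_space" using S by (rule sets_eq_imp_space_eq)
  have ne: "space \<mu> \<noteq> {}" by (rule not_empty)
  show ?thesis
  proof (intro iffI conjI allI impI)
    assume inv: "invariant \<mu>"
    fix t :: real and h :: "int \<Rightarrow> real \<Rightarrow> ennreal"
    assume t: "0 \<le> t" and h: "\<forall>i. h i \<in> borel_measurable borel"
    have [measurable]: "h i \<in> borel_measurable borel" for i using h by simp
    note [measurable (raw)] = indexed_measurable[OF this]
    have "\<mu> \<bind> P t = \<mu>"
    proof (rule measure_eqI)
      show "sets (\<mu> \<bind> P t) = sets \<mu>"
        using ne by (subst sets_bind[of _ _ state_space]) (auto simp: sets_P S)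
      fix A assume "A \<in> sets (\<mu> \<bind> P t)"
      then have A: "A \<in> sets state_space" using ne by (subst (asm) sets_bind[of _ _ state_space]) (auto simp: sets_P)
      show "emeasure (\<mu> \<bind> P t) A = emeasure \<mu> A"
        using inv t A by (subst emeasure_bind[OF ne P_kernel[OF t S]]) (auto simp: invariant_prob_def)
    qed
    then have "mean \<mu> h = (\<integral>\<^sup>+ z. h (snd z) (fst z) \<partial>(\<mu> \<bind> P t))" by simp
    also have "\<dots> = (\<integral>\<^sup>+ y. \<integral>\<^sup>+ z. h (snd z) (fst z) \<partial>P t y \<partial>\<mu>)"
      by (rule nn_integral_bind[OF _ P_kernel[OF t S]]) measurable
    also have "\<dots> = mean \<mu> (expect h t)"
      using t by (intro nn_integral_cong nn_integral_P) (auto simp: sp)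
    finally show "mean \<mu> (expect h t) = mean \<mu> h" by simp
  next
    assume R: "prob_space \<mu> \<and> sets \<mu> = sets state_space \<and>
      (\<forall>t\<ge>0. \<forall>h. (\<forall>i. h i \<in> borel_measurable borel) \<longrightarrow>
      mean \<mu> (expect h t) = mean \<mu> h)"
    show "invariant \<mu>"
      unfolding invariant_prob_def
    proof (intro conjI allI impI ballI)
      fix t :: real and A assume t: "0 \<le> t" and A: "A \<in> sets state_space"
      have "(\<integral>\<^sup>+ z. emeasure (P t z) A \<partial>\<mu>) = (\<integral>\<^sup>+ z. expect (\<lambda>i x. indicator A (x, i)) t (snd z) (fst z) \<partial>\<mu>)"
        using t A by (intro nn_integral_cong emeasure_P) (auto simp: sp)
      also have "\<dots> = (\<integral>\<^sup>+ z. indicator A (fst z, snd z) \<partial>\<mu>)"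
        using R t indicator_section_measurable[OF A] by auto
      finally show "(\<integral>\<^sup>+ z. emeasure (P t z) A \<partial>\<mu>) = emeasure \<mu> A" using A S by simp
    qed (use True in auto)
  qed (use True in auto)
qed (auto simp: invariant_prob_def)

end

section \<open>Integrated stationarity\<close>

lemma minus_count_space [measurable]:
  fixes k :: "'a \<Rightarrow> int"
  assumes "k \<in> M \<rightarrow>\<^sub>M count_space UNIV" shows "(\<lambda>x. - k x) \<in> M \<rightarrow>\<^sub>M count_space UNIV"
  by (rule measurable_compose[OF assms]) simp

lemma nn_integral_reflect:
  fixes k :: "real \<Rightarrow> ennreal"
  assumes [measurable]: "k \<in> borel_measurable borel"
  shows "(\<integral>\<^sup>+ s. indicator {0..t} s * k (t - s) \<partial>lborel) = (\<integral>\<^sup>+ s. indicator {0..t} s * k s \<partial>lborel)"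
  by (subst nn_integral_real_affine[of "\<lambda>s. indicator {0..t} s * k s" "-1" t])
    (auto intro!: nn_integral_cong simp: indicator_def)

text \<open>Substituting \<open>s = v + s'\<close> turns the left side into an integral over
  nonnegative \<open>v\<close> and \<open>s'\<close> with \<open>v + s' \<le> t\<close>. It
  identifies the double integrals that two different expansions produce in
  \<open>mild_invariant\<close>.\<close>

lemma nn_integral_triangle:
  fixes J :: "real \<Rightarrow> real \<Rightarrow> ennreal"
  assumes J[measurable]: "(\<lambda>p. J (fst p) (snd p)) \<in> borel_measurable (borel \<Otimes>\<^sub>M borel)"
  shows "(\<integral>\<^sup>+ s. indicator {0..t} s * (\<integral>\<^sup>+ v. indicator {0..s} v * J v (t - s) \<partial>lborel) \<partial>lborel) =
    (\<integral>\<^sup>+ s. indicator {0..t} s * (\<integral>\<^sup>+ v. indicator {0..t-s} v * J v (t - s - v) \<partial>lborel) \<partial>lborel)"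
proof -
  have Jm2 [measurable (raw)]: "(\<lambda>x. J (f x) (g x)) \<in> borel_measurable M"
    if "f \<in> borel_measurable M" "g \<in> borel_measurable M" for f g and M :: "(real \<times> real) measure"
    using measurable_compose[OF _ J, of "\<lambda>x. (f x, g x)" M] that by simp
  have Jm1 [measurable (raw)]: "(\<lambda>x. J (f x) (g x)) \<in> borel_measurable M"
    if "f \<in> borel_measurable M" "g \<in> borel_measurable M" for f g and M :: "real measure"
    using measurable_compose[OF _ J, of "\<lambda>x. (f x, g x)" M] that by simp
  let ?T = "\<lambda>s v. if 0 \<le> v \<and> v \<le> s \<and> s \<le> t then 1 else 0 :: ennreal"
  let ?T' = "\<lambda>s v. if 0 \<le> v \<and> 0 \<le> s \<and> s + v \<le> t then 1 else 0 :: ennreal"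
  have "(\<integral>\<^sup>+ s. indicator {0..t} s * (\<integral>\<^sup>+ v. indicator {0..s} v * J v (t - s) \<partial>lborel) \<partial>lborel) =
     (\<integral>\<^sup>+ s. \<integral>\<^sup>+ v. ?T s v * J v (t - s) \<partial>lborel \<partial>lborel)"
    by (subst nn_integral_cmult[symmetric]) (auto intro!: nn_integral_cong simp: indicator_def)
  also have "\<dots> = (\<integral>\<^sup>+ v. \<integral>\<^sup>+ s. ?T s v * J v (t - s) \<partial>lborel \<partial>lborel)"
    by (rule lborel_pair.Fubini') measurable
  also have "\<dots> = (\<integral>\<^sup>+ v. \<integral>\<^sup>+ s. ?T' s v * J v (t - s - v) \<partial>lborel \<partial>lborel)"
  proof (rule nn_integral_cong)
    fix v :: real
    have "(\<integral>\<^sup>+ s. ?T s v * J v (t - s) \<partial>lborel) = (\<integral>\<^sup>+ s. ?T (v + 1 * s) v * J v (t - (v + 1 * s)) \<partial>lborel)"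
      by (subst nn_integral_real_affine[where c = 1 and t = v]) auto
    also have "\<dots> = (\<integral>\<^sup>+ s. ?T' s v * J v (t - s - v) \<partial>lborel)"
      by (intro nn_integral_cong) (auto simp: algebra_simps)
    finally show "(\<integral>\<^sup>+ s. ?T s v * J v (t - s) \<partial>lborel) = (\<integral>\<^sup>+ s. ?T' s v * J v (t - s - v) \<partial>lborel)" .
  qed
  also have "\<dots> = (\<integral>\<^sup>+ s. \<integral>\<^sup>+ v. ?T' s v * J v (t - s - v) \<partial>lborel \<partial>lborel)"
    by (rule lborel_pair.Fubini') measurable
  also have "\<dots> = (\<integral>\<^sup>+ s. indicator {0..t} s * (\<integral>\<^sup>+ v. indicator {0..t-s} v * J v (t - s - v) \<partial>lborel) \<partial>lborel)"
    by (subst nn_integral_cmult[symmetric]) (auto intro!: nn_integral_cong simp: indicator_def)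
  finally show ?thesis .
qed

context logistic_switching begin

text \<open>
  With \<open>killed\<close> the semigroup of the flow killed at the first switch and \<open>jump\<close> the switching
  operator, the measures satisfying \<open>mild\<close> are those that solve the stationarity equation
  of the generator in integrated form.
\<close>

definition killed :: "(int \<Rightarrow> real \<Rightarrow> ennreal) \<Rightarrow> real \<Rightarrow> int \<Rightarrow> real \<Rightarrow> ennreal" where
  "killed h t e x = ennreal (exp (- (rate e * t))) * h e (leg e t x)"

definition jump :: "(int \<Rightarrow> real \<Rightarrow> ennreal) \<Rightarrow> int \<Rightarrow> real \<Rightarrow> ennreal" where
  "jump h e x = ennreal (rate e) * h (-e) x"

definition mild :: "(real \<times> int) measure \<Rightarrow> bool" where
  "mild \<mu> \<longleftrightarrow> (\<forall>t\<ge>0. \<forall>h. (\<forall>i. h i \<in> borel_measurable borel) \<longrightarrow>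
     mean \<mu> (killed h t) +
     (\<integral>\<^sup>+ s. indicator {0..t} s * mean \<mu> (jump (killed h s)) \<partial>lborel) =
     mean \<mu> h)"

lemma leg_measurable2 [measurable (raw)]:
  assumes [measurable]: "f \<in> borel_measurable M" "g \<in> borel_measurable M" "k \<in> M \<rightarrow>\<^sub>M count_space UNIV"
  shows "(\<lambda>x. leg (k x) (f x) (g x)) \<in> borel_measurable M"
  by (rule measurable_compose_countable'[where I = UNIV and f = "\<lambda>i x. leg i (f x) (g x)"]) auto

text \<open>Duhamel's formula, with the switch as perturbation of the killed flow.\<close>

lemma expect_renewal':
  assumes h: "\<And>i. h i \<in> borel_measurable borel" and t: "0 \<le> t"
  shows "expect h t e x = killed h t e x +
    (\<integral>\<^sup>+ s. indicator {0..t} s * killed (jump (expect h (t - s))) s e x \<partial>lborel)"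
proof -
  have w: "weight e s = ennreal (exp (- (rate e * s))) * ennreal (rate e)" for s
    unfolding weight_def by (subst ennreal_mult'[symmetric]) (auto simp: mult.commute less_imp_le[OF rate_pos])
  show ?thesis
    unfolding expect_renewal[OF h t] killed_def jump_def w
    by (intro arg_cong2[where f = "(+)"] nn_integral_cong refl) (simp only: mult_ac)
qed

lemma expect_le_1:
  assumes "\<And>i x. h i x \<le> 1" shows "expect h t e x \<le> 1"
proof -
  interpret prob_space "holding e" by (rule prob_holding)
  have "expect h t e x \<le> (\<integral>\<^sup>+ w. 1 \<partial>holding e)"
    unfolding expect_def by (intro nn_integral_mono assms)
  then show ?thesis using emeasure_space_1 by simp
qed

text \<open>Write \<open>m\<close> for the mean, \<open>K\<close> for \<open>killed\<close>,
  \<open>J\<close> for \<open>jump\<close> and \<open>P\<close> for \<open>expect\<close>. The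
  renewal equation expands \<open>m P_t h\<close> into \<open>m K_t h\<close> and the integral of
  \<open>m K_s J P_(t-s) h\<close>. Applied to \<open>h\<close> and to \<open>J P_(t-s) h\<close>,
  the property \<open>mild\<close> replaces each \<open>m K\<close> by \<open>m\<close> at the price
  of the terms \<open>?B\<close> and \<open>?D\<close>. What remains besides \<open>m h\<close>, the
  integral of \<open>m J P_(t-s) h\<close>, expands by the renewal equation into the same
  \<open>?B\<close> and \<open>?D\<close>, which cancel.\<close>

lemma mild_invariant:
  assumes "prob_space \<mu>" and S[measurable_cong]: "sets \<mu> = sets state_space" and m: "mild \<mu>"
  shows "invariant \<mu>"
  unfolding invariant_prob_def
proof (intro conjI allI impI ballI assms)
  fix t :: real and A assume t: "0 \<le> t" and A: "A \<in> sets state_space"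
  interpret prob_space \<mu> by fact
  have sp: "space \<mu> = space state_space" using S by (rule sets_eq_imp_space_eq)
  define h where "h = (\<lambda>i x. indicator A (x, i :: int) :: ennreal)"
  have h [measurable]: "h i \<in> borel_measurable borel" for i
    unfolding h_def using indicator_section_measurable[OF A] .
  note [measurable (raw)] = indexed_measurable[OF h]
  have h1: "h i x \<le> 1" for i x by (simp add: h_def indicator_def)
  let ?m = "mean \<mu>"
  let ?a = "\<lambda>u. ?m (jump (expect h u))"
  let ?b = "\<lambda>u. ?m (jump (killed h u))"
  let ?J = "\<lambda>v u. ?m (jump (killed (jump (expect h u)) v))"
  have E1: "?m (expect h t) = ?m (killed h t) +
     (\<integral>\<^sup>+ s. indicator {0..t} s * ?m (killed (jump (expect h (t - s))) s) \<partial>lborel)"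
  proof -
    have "?m (expect h t) = (\<integral>\<^sup>+ z. killed h t (snd z) (fst z) +
      (\<integral>\<^sup>+ s. indicator {0..t} s * killed (jump (expect h (t - s))) s (snd z) (fst z) \<partial>lborel) \<partial>\<mu>)"
      by (subst expect_renewal'[OF h t]) simp
    also have "\<dots> = ?m (killed h t) +
       (\<integral>\<^sup>+ z. \<integral>\<^sup>+ s. indicator {0..t} s * killed (jump (expect h (t - s))) s (snd z) (fst z) \<partial>lborel \<partial>\<mu>)"
      unfolding killed_def jump_def by (intro nn_integral_add) measurable
    also have "(\<integral>\<^sup>+ z. \<integral>\<^sup>+ s. indicator {0..t} s * killed (jump (expect h (t - s))) s (snd z) (fst z) \<partial>lborel \<partial>\<mu>) =
       (\<integral>\<^sup>+ s. \<integral>\<^sup>+ z. indicator {0..t} s * killed (jump (expect h (t - s))) s (snd z) (fst z) \<partial>\<mu> \<partial>lborel)"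
      unfolding killed_def jump_def
      by (rule pair_sigma_finite.Fubini'[symmetric]) (auto intro!: pair_sigma_finite.intro sigma_finite_lborel sigma_finite_measure_axioms)
    also have "\<dots> = (\<integral>\<^sup>+ s. indicator {0..t} s * ?m (killed (jump (expect h (t - s))) s) \<partial>lborel)"
      unfolding killed_def jump_def by (subst nn_integral_cmult) auto
    finally show ?thesis .
  qed
  have E2: "?m (killed h t) + (\<integral>\<^sup>+ s. indicator {0..t} s * ?b s \<partial>lborel) = ?m h"
    using m t h unfolding mild_def by auto
  have E3: "?m (killed (jump (expect h (t - s))) s) + (\<integral>\<^sup>+ v. indicator {0..s} v * ?J v (t - s) \<partial>lborel) = ?a (t - s)"
    if "0 \<le> s" for s
  proof -
    have "jump (expect h (t - s)) i \<in> borel_measurable borel" for i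
      unfolding jump_def[abs_def] by measurable
    then show ?thesis using m that unfolding mild_def by blast
  qed
  have E4: "?a u = ?b u + (\<integral>\<^sup>+ v. indicator {0..u} v * ?J v (u - v) \<partial>lborel)" if u: "0 \<le> u" for u
  proof -
    have "?a u = (\<integral>\<^sup>+ z. jump (killed h u) (snd z) (fst z) +
      (\<integral>\<^sup>+ v. indicator {0..u} v * jump (killed (jump (expect h (u - v))) v) (snd z) (fst z) \<partial>lborel) \<partial>\<mu>)"
      unfolding jump_def
      apply (subst expect_renewal'[OF h u])
      unfolding distrib_left killed_def jump_def
      by (subst nn_integral_cmult[symmetric]) (auto simp: mult_ac)
    also have "\<dots> = ?b u +
       (\<integral>\<^sup>+ z. \<integral>\<^sup>+ v. indicator {0..u} v * jump (killed (jump (expect h (u - v))) v) (snd z) (fst z) \<partial>lborel \<partial>\<mu>)"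
      unfolding killed_def jump_def by (intro nn_integral_add) measurable
    also have "(\<integral>\<^sup>+ z. \<integral>\<^sup>+ v. indicator {0..u} v * jump (killed (jump (expect h (u - v))) v) (snd z) (fst z) \<partial>lborel \<partial>\<mu>) =
       (\<integral>\<^sup>+ v. \<integral>\<^sup>+ z. indicator {0..u} v * jump (killed (jump (expect h (u - v))) v) (snd z) (fst z) \<partial>\<mu> \<partial>lborel)"
      unfolding killed_def jump_def
      by (rule pair_sigma_finite.Fubini'[symmetric]) (auto intro!: pair_sigma_finite.intro sigma_finite_lborel sigma_finite_measure_axioms)
    also have "\<dots> = (\<integral>\<^sup>+ v. indicator {0..u} v * ?J v (u - v) \<partial>lborel)"
      unfolding killed_def jump_def by (subst nn_integral_cmult) auto
    finally show ?thesis .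
  qed
  have Jm: "(\<lambda>p. ?J (fst p) (snd p)) \<in> borel_measurable (borel \<Otimes>\<^sub>M borel)"
    unfolding killed_def jump_def by measurable
  have Jm' [measurable (raw)]: "(\<lambda>x. ?J (f x) (g x)) \<in> borel_measurable M"
    if "f \<in> borel_measurable M" "g \<in> borel_measurable M" for f g and M :: "(real \<times> real) measure"
    using measurable_compose[OF _ Jm, of "\<lambda>x. (f x, g x)" M] that by simp
  have am [measurable]: "?a \<in> borel_measurable borel" unfolding jump_def by measurable
  have bm [measurable]: "?b \<in> borel_measurable borel" unfolding killed_def jump_def by measurable
  let ?D = "\<integral>\<^sup>+ s. indicator {0..t} s * (\<integral>\<^sup>+ v. indicator {0..s} v * ?J v (t - s) \<partial>lborel) \<partial>lborel"
  let ?B = "\<integral>\<^sup>+ s. indicator {0..t} s * ?b s \<partial>lborel"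
  have km [measurable]: "(\<lambda>s. ?m (killed (jump (expect h (t - s))) s)) \<in> borel_measurable borel"
    unfolding killed_def jump_def by measurable
  have dm [measurable]: "(\<lambda>s. \<integral>\<^sup>+ v. indicator {0..s} v * ?J v (t - s) \<partial>lborel) \<in> borel_measurable borel"
    unfolding indicator_def atLeastAtMost_iff by measurable
  have dm2 [measurable]: "(\<lambda>s. \<integral>\<^sup>+ v. indicator {0..t-s} v * ?J v (t - s - v) \<partial>lborel) \<in> borel_measurable borel"
    unfolding indicator_def atLeastAtMost_iff by measurable
  have "?m (expect h t) + (?B + ?D) = ?m (killed h t) + ?B +
    (\<integral>\<^sup>+ s. indicator {0..t} s * (?m (killed (jump (expect h (t - s))) s) + (\<integral>\<^sup>+ v. indicator {0..s} v * ?J v (t - s) \<partial>lborel)) \<partial>lborel)"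
  proof -
    have "(\<integral>\<^sup>+ s. indicator {0..t} s * (?m (killed (jump (expect h (t - s))) s) + (\<integral>\<^sup>+ v. indicator {0..s} v * ?J v (t - s) \<partial>lborel)) \<partial>lborel) =
      (\<integral>\<^sup>+ s. indicator {0..t} s * ?m (killed (jump (expect h (t - s))) s) \<partial>lborel) + ?D"
      unfolding distrib_left by (rule nn_integral_add) measurable
    then show ?thesis unfolding E1 by (simp only: ac_simps)
  qed
  also have "\<dots> = ?m h + (\<integral>\<^sup>+ s. indicator {0..t} s * ?a (t - s) \<partial>lborel)"
    unfolding E2
  proof (intro arg_cong2[where f = "(+)"] refl nn_integral_cong)
    fix s
    show "indicator {0..t} s * (?m (killed (jump (expect h (t - s))) s) + (\<integral>\<^sup>+ v. indicator {0..s} v * ?J v (t - s) \<partial>lborel)) =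
      indicator {0..t} s * ?a (t - s)"
    proof (cases "s \<in> {0..t}")
      case True
      then have "0 \<le> s" by simp
      from E3[OF this] show ?thesis by (simp only:)
    next
      case False
      show ?thesis by (simp only: indicator_simps(2)[OF False] mult_zero_left)
    qed
  qed
  also have "(\<integral>\<^sup>+ s. indicator {0..t} s * ?a (t - s) \<partial>lborel) =
    (\<integral>\<^sup>+ s. indicator {0..t} s * ?b (t - s) + indicator {0..t} s * (\<integral>\<^sup>+ v. indicator {0..t-s} v * ?J v (t - s - v) \<partial>lborel) \<partial>lborel)"
  proof (intro nn_integral_cong)
    fix s
    show "indicator {0..t} s * ?a (t - s) = indicator {0..t} s * ?b (t - s) +
      indicator {0..t} s * (\<integral>\<^sup>+ v. indicator {0..t-s} v * ?J v (t - s - v) \<partial>lborel)"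
    proof (cases "s \<in> {0..t}")
      case True
      then have "0 \<le> t - s" by simp
      from E4[OF this] show ?thesis by (simp only: distrib_left)
    next
      case False
      show ?thesis by (simp only: indicator_simps(2)[OF False] mult_zero_left add_0_left)
    qed
  qed
  also have "\<dots> = (\<integral>\<^sup>+ s. indicator {0..t} s * ?b (t - s) \<partial>lborel) + ?D"
    unfolding nn_integral_triangle[OF Jm] by (intro nn_integral_add) measurable
  also have "(\<integral>\<^sup>+ s. indicator {0..t} s * ?b (t - s) \<partial>lborel) = ?B"
    by (rule nn_integral_reflect) measurable
  finally have eq: "?m (expect h t) + (?B + ?D) = ?m h + (?B + ?D)" .
  \<comment> \<open>Cancellation in \<open>ennreal\<close> needs \<open>?B + ?D\<close> finite:
    \<open>h\<close> and its images under \<open>expect\<close> and \<open>killed\<close> are at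
    most 1, and each \<open>jump\<close> costs at most a factor \<open>R\<close>.\<close>
  define R where "R = ennreal (lm + lp)"
  have R: "ennreal (rate i) \<le> R" for i using lm lp by (auto simp: switch_rate_def R_def)
  have jR: "jump f e x \<le> R * c" if "\<And>i x. f i x \<le> c" for f e x c
    unfolding jump_def by (intro mult_mono R that) auto
  have kc: "killed f s e x \<le> c" if "\<And>i x. f i x \<le> c" "0 \<le> s" for f e x c s
  proof -
    have "killed f s e x \<le> 1 * c" unfolding killed_def
      using that rate_pos[of e] by (intro mult_mono) (auto simp: less_imp_le)
    then show ?thesis by simp
  qed
  have mc: "?m f \<le> c" if "\<And>i x. f i x \<le> c" for f c
  proof -
    have "?m f \<le> (\<integral>\<^sup>+ z. c \<partial>\<mu>)" by (intro nn_integral_mono that)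
    then show ?thesis using emeasure_space_1 by simp
  qed
  have ind: "(\<integral>\<^sup>+ v. indicator {0..s} v * k v \<partial>lborel) \<le> ennreal s * c" if "\<And>v. 0 \<le> v \<Longrightarrow> v \<le> s \<Longrightarrow> k v \<le> c" "0 \<le> s" for k c s
  proof -
    have "(\<integral>\<^sup>+ v. indicator {0..s} v * k v \<partial>lborel) \<le> (\<integral>\<^sup>+ v. c * indicator {0..s} v \<partial>lborel)"
      by (intro nn_integral_mono) (auto simp: indicator_def that)
    then show ?thesis using that(2) by (simp add: nn_integral_cmult mult.commute)
  qed
  have "?B \<le> ennreal t * (R * 1)"
    by (intro ind t mc jR kc h1)
  also have "\<dots> < \<infinity>" by (simp add: R_def ennreal_mult_less_top)
  finally have B: "?B < \<infinity>" .
  have "?D \<le> ennreal t * (ennreal t * (R * (R * 1)))"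
  proof (intro ind t)
    fix s assume s: "0 \<le> s" "s \<le> t"
    have "(\<integral>\<^sup>+ v. indicator {0..s} v * ?J v (t - s) \<partial>lborel) \<le> ennreal s * (R * (R * 1))"
      by (intro ind s mc jR kc expect_le_1 h1)
    also have "\<dots> \<le> ennreal t * (R * (R * 1))" using s by (intro mult_right_mono) (auto intro: ennreal_leI)
    finally show "(\<integral>\<^sup>+ v. indicator {0..s} v * ?J v (t - s) \<partial>lborel) \<le> \<dots>" .
  qed
  also have "\<dots> < \<infinity>" by (simp add: R_def ennreal_mult_less_top)
  finally have "?B + ?D < \<infinity>" using B by simp
  then have "?m (expect h t) = ?m h"
    using eq by (auto simp: ennreal_add_left_cancel add.commute[of _ "?B + ?D"])
  moreover have "(\<integral>\<^sup>+ z. emeasure (P t z) A \<partial>\<mu>) = ?m (expect h t)"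
    unfolding h_def using t A by (intro nn_integral_cong emeasure_P) (auto simp: sp)
  moreover have "?m h = emeasure \<mu> A" using A S by (simp add: h_def)
  ultimately show "(\<integral>\<^sup>+ z. emeasure (P t z) A \<partial>\<mu>) = emeasure \<mu> A" by simp
qed

end

section \<open>Marginals, absorbing sets and ergodicity\<close>

lemma nn_integral_cmult2:
  assumes [measurable]: "k \<in> borel_measurable M"
  shows "(\<integral>\<^sup>+ x. a * (b * k x) \<partial>M) = a * (b * (\<integral>\<^sup>+ x. k x \<partial>M))"
  by (subst nn_integral_cmult, measurable) (simp add: nn_integral_cmult)

lemma sum_state_index: "(\<Sum>e\<in>state_index. f e) = f (-1) + (f 1 :: 'a::comm_monoid_add)"
  by simp

lemma ennreal_eq_of_le_sum:
  fixes x y a b :: ennreal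
  assumes "x \<le> a" "y \<le> b" "x + y = a + b" "b < \<infinity>"
  shows "x = a"
proof (rule antisym)
  have "b + a \<le> b + x" using assms(2,3) by (metis add.commute add_left_mono)
  then show "a \<le> x" using assms(4) by (auto simp: ennreal_add_left_cancel_le)
qed fact

context logistic_switching begin

definition chain_weight :: "int \<Rightarrow> real" where
  "chain_weight e = (if e = -1 then lp / (lp + lm) else lm / (lp + lm))"

lemma chain_weight_pos: "0 < chain_weight e"
  using lm lp by (simp add: chain_weight_def)

lemma chain_weight_sum: "chain_weight (-1) + chain_weight 1 = 1"
  using lm lp by (simp add: chain_weight_def add_divide_distrib[symmetric])

lemma ennreal_chain_weight_sum: "ennreal (chain_weight (-1)) + ennreal (chain_weight 1) = 1"
  using chain_weight_sum less_imp_le[OF chain_weight_pos]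
  by (simp add: ennreal_plus[symmetric] del: ennreal_plus)

text \<open>The stationary law of a two-state chain is reversible; thus the inflow into
  \<open>e\<close> can be written with the rate out of \<open>e\<close>.\<close>

lemma detailed_balance: "e \<in> state_index \<Longrightarrow> chain_weight (-e) * rate (-e) = chain_weight e * rate e"
  by (auto simp: chain_weight_def switch_rate_def)

lemma killed_measurable [measurable]:
  assumes h[measurable]: "\<And>i. h i \<in> borel_measurable borel"
  shows "killed h t e \<in> borel_measurable borel"
  unfolding killed_def[abs_def] by measurable

lemma jump_measurable [measurable]:
  assumes h[measurable]: "\<And>i. h i \<in> borel_measurable borel"
  shows "jump h e \<in> borel_measurable borel"
  unfolding jump_def[abs_def] by measurable

text \<open>\<open>N e\<close> is the law of the position given the state \<open>e\<close>. Sorting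
  the switches by the state entered and using reversibility separates stationarity into one equation
  per state, in which the weights of the chain no longer occur.\<close>

lemma mild_mixture:
  assumes rep: "\<And>h. (\<And>i. h i \<in> borel_measurable borel) \<Longrightarrow>
      mean \<mu> h = (\<Sum>e\<in>state_index. chain_weight e * (\<integral>\<^sup>+ x. h e x \<partial>N e))"
    and N: "\<And>e. prob_space (N e)" and sN[measurable_cong]: "\<And>e. sets (N e) = sets borel"
    and eq: "\<And>e k t. e \<in> state_index \<Longrightarrow> k \<in> borel_measurable borel \<Longrightarrow> 0 \<le> t \<Longrightarrow>
      ennreal (exp (- (rate e * t))) * (\<integral>\<^sup>+ x. k (leg e t x) \<partial>N e) +
      (\<integral>\<^sup>+ s. indicator {0..t} s * (weight e s * (\<integral>\<^sup>+ x. k (leg e s x) \<partial>N (-e))) \<partial>lborel) = (\<integral>\<^sup>+ x. k x \<partial>N e)"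
  shows "mild \<mu>"
  unfolding mild_def
proof (intro allI impI)
  fix t :: real and h :: "int \<Rightarrow> real \<Rightarrow> ennreal"
  assume t: "0 \<le> t" and h': "\<forall>i. h i \<in> borel_measurable borel"
  then have h [measurable]: "h i \<in> borel_measurable borel" for i by simp
  interpret N: prob_space "N e" for e by (rule N)
  have 1: "mean \<mu> (killed h t) =
     (\<Sum>e\<in>state_index. chain_weight e * (ennreal (exp (- (rate e * t))) * (\<integral>\<^sup>+ x. h e (leg e t x) \<partial>N e)))"
  proof (subst rep)
    show "(\<Sum>e\<in>state_index. ennreal (chain_weight e) * (\<integral>\<^sup>+ x. killed h t e x \<partial>N e)) =
      (\<Sum>e\<in>state_index. chain_weight e * (ennreal (exp (- (rate e * t))) * (\<integral>\<^sup>+ x. h e (leg e t x) \<partial>N e)))"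
      unfolding killed_def by (intro sum.cong refl arg_cong2[where f = "(*)"] nn_integral_cmult) measurable
  qed measurable
  have 2: "mean \<mu> (jump (killed h s)) =
     (\<Sum>e\<in>state_index. chain_weight e * (weight e s * (\<integral>\<^sup>+ x. h e (leg e s x) \<partial>N (-e))))" for s
  proof -
    have "mean \<mu> (jump (killed h s)) =
      (\<Sum>e\<in>state_index. chain_weight e * (ennreal (rate e) * (ennreal (exp (- (rate (-e) * s))) * (\<integral>\<^sup>+ x. h (-e) (leg (-e) s x) \<partial>N e))))"
    proof (subst rep)
      show "(\<Sum>e\<in>state_index. ennreal (chain_weight e) * (\<integral>\<^sup>+ x. jump (killed h s) e x \<partial>N e)) =
        (\<Sum>e\<in>state_index. chain_weight e * (ennreal (rate e) * (ennreal (exp (- (rate (-e) * s))) * (\<integral>\<^sup>+ x. h (-e) (leg (-e) s x) \<partial>N e))))"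
        unfolding killed_def jump_def
        by (intro sum.cong refl arg_cong2[where f = "(*)"] nn_integral_cmult2) measurable
    qed measurable
    \<comment> \<open>Renaming \<open>e\<close> to \<open>-e\<close> indexes the summands by the
      state entered.\<close>
    also have "\<dots> = (\<Sum>e\<in>state_index. chain_weight (-e) * (ennreal (rate (-e)) * (ennreal (exp (- (rate e * s))) * (\<integral>\<^sup>+ x. h e (leg e s x) \<partial>N (-e)))))"
      by (simp add: add.commute)
    also have "\<dots> = (\<Sum>e\<in>state_index. chain_weight e * (weight e s * (\<integral>\<^sup>+ x. h e (leg e s x) \<partial>N (-e))))"
    proof (intro sum.cong refl)
      fix e :: int assume e: "e \<in> state_index"
      have "ennreal (chain_weight (-e)) * ennreal (rate (-e)) = ennreal (chain_weight e) * ennreal (rate e)"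
        using detailed_balance[OF e] by (simp add: ennreal_mult'[symmetric] less_imp_le[OF chain_weight_pos])
      moreover have "weight e s = ennreal (rate e) * ennreal (exp (- (rate e * s)))"
        unfolding weight_def by (intro ennreal_mult less_imp_le[OF rate_pos]) auto
      ultimately show "chain_weight (-e) * (ennreal (rate (-e)) * (ennreal (exp (- (rate e * s))) * (\<integral>\<^sup>+ x. h e (leg e s x) \<partial>N (-e)))) =
        chain_weight e * (weight e s * (\<integral>\<^sup>+ x. h e (leg e s x) \<partial>N (-e)))"
        by (simp only: mult.assoc[symmetric])
    qed
    finally show ?thesis .
  qed
  have "(\<integral>\<^sup>+ s. indicator {0..t} s * mean \<mu> (jump (killed h s)) \<partial>lborel) =
    (\<integral>\<^sup>+ s. (\<Sum>e\<in>state_index. chain_weight e * (indicator {0..t} s * (weight e s * (\<integral>\<^sup>+ x. h e (leg e s x) \<partial>N (-e))))) \<partial>lborel)"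
    unfolding 2 sum_distrib_left by (simp only: mult_ac)
  also have "\<dots> = (\<Sum>e\<in>state_index. chain_weight e * (\<integral>\<^sup>+ s. indicator {0..t} s * (weight e s * (\<integral>\<^sup>+ x. h e (leg e s x) \<partial>N (-e))) \<partial>lborel))"
  proof (subst nn_integral_sum)
    have m [measurable]: "(\<lambda>s. \<integral>\<^sup>+ x. h e (leg e s x) \<partial>N (-e)) \<in> borel_measurable borel" for e
      by measurable
    show "(\<lambda>s. ennreal (chain_weight e) * (indicator {0..t} s * (weight e s * (\<integral>\<^sup>+ x. h e (leg e s x) \<partial>N (-e))))) \<in> borel_measurable lborel" for e
      by measurable
    show "(\<Sum>e\<in>state_index. \<integral>\<^sup>+ s. ennreal (chain_weight e) * (indicator {0..t} s * (weight e s * (\<integral>\<^sup>+ x. h e (leg e s x) \<partial>N (-e)))) \<partial>lborel) =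
      (\<Sum>e\<in>state_index. chain_weight e * (\<integral>\<^sup>+ s. indicator {0..t} s * (weight e s * (\<integral>\<^sup>+ x. h e (leg e s x) \<partial>N (-e))) \<partial>lborel))"
      by (intro sum.cong refl nn_integral_cmult) measurable
  qed
  finally have 3: "(\<integral>\<^sup>+ s. indicator {0..t} s * mean \<mu> (jump (killed h s)) \<partial>lborel) =
    (\<Sum>e\<in>state_index. chain_weight e * (\<integral>\<^sup>+ s. indicator {0..t} s * (weight e s * (\<integral>\<^sup>+ x. h e (leg e s x) \<partial>N (-e))) \<partial>lborel))" .
  show "mean \<mu> (killed h t) +
     (\<integral>\<^sup>+ s. indicator {0..t} s * mean \<mu> (jump (killed h s)) \<partial>lborel) =
     mean \<mu> h"
    unfolding 1 3 rep[of h, OF h] sum.distrib[symmetric] distrib_left[symmetric]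
    by (intro sum.cong refl arg_cong2[where f = "(*)"] eq h t)
qed

lemma exponential_split: "0 \<le> t \<Longrightarrow>
  ennreal (exp (- (rate e * t))) + (\<integral>\<^sup>+ s. indicator {0..t} s * weight e s \<partial>lborel) = 1"
  using nn_integral_exponential_weight[OF rate_pos, of t e] rate_pos[of e]
  by (simp add: weight_def mult.commute ennreal_plus[symmetric] del: ennreal_plus)

section \<open>The extinction measure\<close>

abbreviation "\<delta> \<equiv> extinction_measure lm lp"

lemma sets_extinction: "sets \<delta> = sets state_space"
  unfolding extinction_measure_def state_space_def
  by (intro sets_pair_measure_cong) (auto simp: sets_point_measure)

lemma nn_integral_extinction:
  fixes h :: "int \<Rightarrow> real \<Rightarrow> ennreal"
  assumes h: "\<And>i. h i \<in> borel_measurable borel"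
  shows "mean \<delta> h = (\<Sum>e\<in>state_index. chain_weight e * h e 0)"
proof -
  note [measurable (raw)] = indexed_measurable[OF h]
  let ?R = "return (restrict_space borel {0::real..}) 0"
  let ?Q = "point_measure state_index (\<lambda>i. ennreal (chain_weight i))"
  have d: "\<delta> = ?R \<Otimes>\<^sub>M ?Q"
    by (simp add: extinction_measure_def chain_weight_def[abs_def] if_distrib)
  interpret Q: finite_measure ?Q
    by (rule finite_measureI) (auto simp: space_point_measure emeasure_point_measure_finite)
  have [measurable_cong]: "sets \<delta> = sets state_space" by (rule sets_extinction)
  have "(\<lambda>z. h (snd z) (fst z)) \<in> borel_measurable \<delta>" by measurable
  then have m: "(\<lambda>z. h (snd z) (fst z)) \<in> borel_measurable (?R \<Otimes>\<^sub>M ?Q)" by (simp add: d)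
  have "mean \<delta> h = (\<integral>\<^sup>+ x. \<integral>\<^sup>+ e. h e x \<partial>?Q \<partial>?R)"
    unfolding d using Q.nn_integral_fst[OF m] by simp
  also have "\<dots> = (\<integral>\<^sup>+ x. (\<Sum>e\<in>state_index. chain_weight e * h e x) \<partial>?R)"
    by (intro nn_integral_cong) (simp add: nn_integral_point_measure_finite)
  also have "\<dots> = (\<Sum>e\<in>state_index. chain_weight e * h e 0)"
  proof (rule nn_integral_return)
    show "(\<lambda>x. \<Sum>e\<in>state_index. ennreal (chain_weight e) * h e x) \<in> borel_measurable (restrict_space borel {0..})"
      using h by (intro measurable_restrict_space1 borel_measurable_sum borel_measurable_times_ennreal borel_measurable_const) auto
  qed (simp add: space_restrict_space)
  finally show ?thesis .
qed

lemma prob_extinction: "prob_space \<delta>"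
proof
  have "mean \<delta> (\<lambda>i x. 1 :: ennreal) = (\<Sum>e\<in>state_index. ennreal (chain_weight e) * 1)"
    by (rule nn_integral_extinction) auto
  also have "\<dots> = 1" unfolding sum_state_index by (simp add: ennreal_chain_weight_sum)
  finally show "emeasure \<delta> (space \<delta>) = 1" by simp
qed

lemma leg_0 [simp]: "leg e s 0 = 0" by (simp add: leg_def flow_def)

text \<open>The point 0 is fixed by both flows, so the equation of each state reduces to
  \<open>exponential_split\<close>: the holding time either exceeds \<open>t\<close> or does
  not.\<close>

lemma invariant_extinction: "invariant \<delta>"
proof (rule mild_invariant[OF prob_extinction sets_extinction], rule mild_mixture[where N = "\<lambda>_. return borel 0"])
  fix h :: "int \<Rightarrow> real \<Rightarrow> ennreal" assume [measurable]: "\<And>i. h i \<in> borel_measurable borel"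
  show "mean \<delta> h = (\<Sum>e\<in>state_index. chain_weight e * (\<integral>\<^sup>+ x. h e x \<partial>return borel 0))"
    using nn_integral_extinction[of h] by (simp add: nn_integral_return)
next
  fix e :: int and k :: "real \<Rightarrow> ennreal" and t :: real assume [measurable]: "k \<in> borel_measurable borel" and t: "0 \<le> t"
  have [simp]: "(\<integral>\<^sup>+ x. k (leg e s x) \<partial>return borel 0) = k 0" for s
    by (subst nn_integral_return) auto
  have "ennreal (exp (- (rate e * t))) * k 0 + (\<integral>\<^sup>+ s. indicator {0..t} s * (weight e s * k 0) \<partial>lborel) =
     (ennreal (exp (- (rate e * t))) + (\<integral>\<^sup>+ s. indicator {0..t} s * weight e s \<partial>lborel)) * k 0"
    by (simp add: distrib_right nn_integral_multc[symmetric] mult.assoc)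
  also have "\<dots> = k 0" using exponential_split[OF t, of e] by simp
  finally show "ennreal (exp (- (rate e * t))) * (\<integral>\<^sup>+ x. k (leg e t x) \<partial>return borel 0) +
      (\<integral>\<^sup>+ s. indicator {0..t} s * (weight e s * (\<integral>\<^sup>+ x. k (leg e s x) \<partial>return borel 0)) \<partial>lborel) = (\<integral>\<^sup>+ x. k x \<partial>return borel 0)"
    by (simp add: nn_integral_return)
qed (auto intro: prob_space_return)

section \<open>The second marginal of an invariant measure\<close>

definition transition :: "int \<Rightarrow> int \<Rightarrow> real \<Rightarrow> ennreal" where
  "transition e i t = expect (\<lambda>j x. indicator {i} j) t e 0"

text \<open>The chain does not see the position, so the starting point 0 in
  \<open>transition\<close> is an arbitrary choice.\<close>

lemma expect_transition: "expect (\<lambda>j x. indicator {i} j) t e x = transition e i t"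
  by (simp add: transition_def expect_def)

lemma transition_sum:
  assumes "e \<in> state_index" shows "transition e (-1) t + transition e 1 t = 1"
proof -
  interpret prob_space "holding e" by (rule prob_holding)
  have "transition e (-1) t + transition e 1 t =
     (\<integral>\<^sup>+ w. indicator {-1} (chain e w t) + indicator {1} (chain e w t) \<partial>holding e)"
  proof -
    have "(\<lambda>w. indicator {i} (chain e w t) :: ennreal) \<in> borel_measurable (holding e)" for i
      by (rule measurable_compose[OF chain_measurable]) auto
    then show ?thesis unfolding transition_def expect_def by (intro nn_integral_add[symmetric]) auto
  qed
  also have "\<dots> = (\<integral>\<^sup>+ w. 1 \<partial>holding e)"
    using chain_in_state_index[OF assms] by (intro nn_integral_cong) (auto simp: indicator_def)
  finally show ?thesis using emeasure_space_1 by simp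
qed

text \<open>It suffices to switch once before time 1 and then to stay. Positivity keeps the balance
  equation at time 1 from degenerating.\<close>

lemma transition_pos: "0 < transition 1 (-1) 1"
proof -
  have ge: "ennreal (exp (- lm)) \<le> transition (-1) (-1) u" if "u \<in> {0..1}" for u
  proof -
    have "ennreal (exp (- lm)) \<le> ennreal (exp (- (lm * u)))"
      using that lm by (intro ennreal_leI) simp
    also have "\<dots> \<le> transition (-1) (-1) u"
      unfolding transition_def using that by (subst expect_renewal) (auto simp: switch_rate_def)
    finally show ?thesis .
  qed
  have "0 < ennreal (1 - exp (- lp)) * ennreal (exp (- lm))"
    using lp by (simp add: ennreal_zero_less_mult_iff)
  also have "\<dots> = (\<integral>\<^sup>+ s. indicator {0..1} s * weight 1 s * ennreal (exp (- lm)) \<partial>lborel)"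
    using nn_integral_exponential_weight[of lp 1] lp
    by (subst nn_integral_multc) (auto simp: weight_def switch_rate_def mult.commute)
  also have "\<dots> \<le> (\<integral>\<^sup>+ s. weight 1 s * indicator {0..1} s * transition (-1) (-1) (1 - s) \<partial>lborel)"
    using ge by (intro nn_integral_mono) (auto simp: indicator_def intro!: mult_left_mono)
  also have "\<dots> = transition 1 (-1) 1"
    unfolding transition_def by (subst (2) expect_renewal) (auto simp: expect_transition[symmetric])
  finally show ?thesis .
qed

lemma nn_integral_index:
  assumes "prob_space \<nu>" and [measurable_cong]: "sets \<nu> = sets state_space"
  shows "(\<integral>\<^sup>+ z. f (snd z) \<partial>\<nu>) =
    f (-1) * emeasure \<nu> {z\<in>space \<nu>. snd z = -1} + f 1 * emeasure \<nu> {z\<in>space \<nu>. snd z = 1}"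
proof -
  have sp: "space \<nu> = space state_space" using assms(2) by (rule sets_eq_imp_space_eq)
  have "(\<integral>\<^sup>+ z. f (snd z) \<partial>\<nu>) =
    (\<integral>\<^sup>+ z. f (-1) * indicator {z\<in>space \<nu>. snd z = -1} z + f 1 * indicator {z\<in>space \<nu>. snd z = 1} z \<partial>\<nu>)"
    by (intro nn_integral_cong) (auto simp: sp space_state_space indicator_def)
  also have "\<dots> = f (-1) * emeasure \<nu> {z\<in>space \<nu>. snd z = -1} + f 1 * emeasure \<nu> {z\<in>space \<nu>. snd z = 1}"
    by (subst nn_integral_add) (auto simp: nn_integral_cmult)
  finally show ?thesis .
qed

text \<open>\<open>(a, b)\<close> and \<open>(c, d)\<close> are probability vectors that solve the
  same balance equation, with \<open>S\<close> and \<open>T\<close> the chances to end in the first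
  state. Subtracting gives \<open>(a - c) * ((1 - S) + T) = 0\<close> in the reals, and the second
  factor is positive.\<close>

lemma balance_cancel:
  fixes a b c d T S R :: ennreal
  assumes "a * S + b * T = a" "c * S + d * T = c" "a + b = 1" "c + d = 1" "R + S = 1" "0 < T" "T \<le> 1"
  shows "a = c"
proof -
  have fin: "a \<noteq> \<infinity>" "b \<noteq> \<infinity>" "c \<noteq> \<infinity>" "d \<noteq> \<infinity>" "S \<noteq> \<infinity>" "T \<noteq> \<infinity>"
    using assms by (auto simp: top_unique)
  have ex: "\<exists>r\<ge>0. x = ennreal r" if "x \<noteq> \<infinity>" for x :: ennreal
    using that by (cases x) auto
  obtain a' b' c' d' S' T' where
    r: "a = ennreal a'" "b = ennreal b'" "c = ennreal c'" "d = ennreal d'" "S = ennreal S'" "T = ennreal T'"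
    and nn: "0 \<le> a'" "0 \<le> b'" "0 \<le> c'" "0 \<le> d'" "0 \<le> S'" "0 \<le> T'"
    using fin[THEN ex] by blast
  have e: "a' * S' + b' * T' = a'" "c' * S' + d' * T' = c'" "a' + b' = 1" "c' + d' = 1"
    using assms(1-4) nn unfolding r by (auto simp: ennreal_mult[symmetric] ennreal_plus[symmetric] simp del: ennreal_plus)
  have "S \<le> 1" using assms(5) by (metis le_add2 add.commute le_iff_add)
  then have s: "S' \<le> 1" "0 < T'" using assms(6) nn unfolding r by auto
  have "(a' - c') * ((1 - S') + T') = 0" proof -
    have b: "b' = 1 - a'" and d: "d' = 1 - c'" using e by auto
    show ?thesis using e(1,2) unfolding b d by (simp add: algebra_simps)
  qed
  then have "a' = c'" using s by auto
  then show ?thesis by (simp add: r)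
qed

text \<open>The second marginals of \<open>\<nu>\<close> and of the known invariant measure
  \<open>\<delta>\<close> solve the same balance equation at time 1. This comparison replaces a
  computation of the transition probabilities.\<close>

lemma invariant_index:
  assumes inv: "invariant \<nu>" and e: "e \<in> state_index"
  shows "emeasure \<nu> {z\<in>space \<nu>. snd z = e} = ennreal (chain_weight e)"
proof -
  have I: "invariant \<nu> \<Longrightarrow> prob_space \<nu> \<and> sets \<nu> = sets state_space" for \<nu>
    by (simp add: invariant_prob_def)
  let ?A = "\<lambda>\<nu> e. emeasure \<nu> {z\<in>space \<nu>. snd z = e}"
  have *: "?A \<nu> (-1) * transition (-1) (-1) 1 + ?A \<nu> 1 * transition 1 (-1) 1 = ?A \<nu> (-1) \<and> ?A \<nu> (-1) + ?A \<nu> 1 = 1"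
    if inv: "invariant \<nu>" for \<nu>
  proof -
    interpret prob_space \<nu> using I[OF inv] by simp
    have "(\<integral>\<^sup>+ z. transition (snd z) (-1) 1 \<partial>\<nu>) = (\<integral>\<^sup>+ z. indicator {-1} (snd z) \<partial>\<nu>)"
    proof -
      have "\<forall>t\<ge>0. \<forall>h. (\<forall>i. h i \<in> borel_measurable borel) \<longrightarrow>
          mean \<nu> (expect h t) = mean \<nu> h"
        using inv by (simp add: invariant_iff)
      from this[rule_format, of 1 "\<lambda>j x. indicator {-1} j"] show ?thesis
        by (simp add: expect_transition)
    qed
    moreover have "(\<integral>\<^sup>+ z. (1::ennreal) \<partial>\<nu>) = 1" using emeasure_space_1 by simp
    ultimately show ?thesis
      using nn_integral_index[of \<nu> "\<lambda>i. transition i (-1) 1"] nn_integral_index[of \<nu> "\<lambda>i. indicator {-1} i"]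
        nn_integral_index[of \<nu> "\<lambda>i. 1"] I[OF inv]
      by (simp add: mult.commute)
  qed
  have T: "transition 1 (-1) 1 \<le> 1" "transition (-1) 1 1 + transition (-1) (-1) 1 = 1"
    using transition_sum[of "1" 1] transition_sum[of "-1" 1] by (auto simp: add.commute le_iff_add)
  have w: "?A \<delta> e = ennreal (chain_weight e)" if "e \<in> state_index" for e
  proof -
    have [measurable_cong]: "sets \<delta> = sets state_space" by (rule sets_extinction)
    have "?A \<delta> e = mean \<delta> (\<lambda>i x. indicator {e} i)"
    proof -
      have "?A \<delta> e = (\<integral>\<^sup>+ z. indicator {z\<in>space \<delta>. snd z = e} z \<partial>\<delta>)" by simp
      also have "\<dots> = (\<integral>\<^sup>+ z. indicator {e} (snd z) \<partial>\<delta>)"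
        by (intro nn_integral_cong) (auto simp: indicator_def)
      finally show ?thesis by simp
    qed
    also have "\<dots> = (\<Sum>i\<in>state_index. ennreal (chain_weight i) * indicator {e} i)"
      by (rule nn_integral_extinction) auto
    finally show ?thesis using that by (auto simp: indicator_def)
  qed
  have m: "?A \<nu> (-1) = ?A \<delta> (-1)"
    using balance_cancel[of "?A \<nu> (-1)" "transition (-1) (-1) 1" "?A \<nu> 1" "transition 1 (-1) 1" "?A \<delta> (-1)" "?A \<delta> 1" "transition (-1) 1 1"]
      *[OF inv] *[OF invariant_extinction] T transition_pos by simp
  moreover have "?A \<nu> 1 = ?A \<delta> 1"
  proof -
    have "?A \<delta> (-1) + ?A \<nu> 1 = ?A \<delta> (-1) + ?A \<delta> 1"
      using *[OF inv] *[OF invariant_extinction] m by simp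
    then show ?thesis using w[of "-1"] by (simp add: ennreal_add_left_cancel)
  qed
  ultimately show ?thesis using w[OF e] e by auto
qed

text \<open>From almost every point of \<open>A\<close> the process is in \<open>A\<close> at time
  \<open>t\<close> with probability 1, so the mass that it carries from \<open>A\<close> into a set
  \<open>C\<close> is at most the mass of \<open>A \<inter> C\<close>. Conservation of mass forces
  equality.\<close>

lemma absorbing_conditional:
  assumes inv: "invariant \<nu>" and A: "A \<in> sets state_space"
    and abs: "\<And>t. 0 \<le> t \<Longrightarrow> AE z in \<nu>. z \<in> A \<longrightarrow> measure (P t z) A = 1"
    and pos: "emeasure \<nu> A \<noteq> 0"
  shows "invariant (uniform_measure \<nu> A)" "emeasure (uniform_measure \<nu> A) A = 1"
proof -
  interpret prob_space \<nu> using inv by (simp add: invariant_prob_def)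
  have S[measurable_cong]: "sets \<nu> = sets state_space" using inv by (simp add: invariant_prob_def)
  have sp: "space \<nu> = space state_space" using S by (rule sets_eq_imp_space_eq)
  have [measurable]: "A \<in> sets \<nu>" using A S by simp
  have inv': "(\<integral>\<^sup>+ z. emeasure (P t z) B \<partial>\<nu>) = emeasure \<nu> B" if "0 \<le> t" "B \<in> sets state_space" for t B
    using inv that by (auto simp: invariant_prob_def)
  show "emeasure (uniform_measure \<nu> A) A = 1"
    using pos A S by (subst emeasure_uniform_measure) (auto simp: emeasure_eq_measure)
  show "invariant (uniform_measure \<nu> A)"
    unfolding invariant_prob_def
  proof (intro conjI allI impI ballI)
    show "prob_space (uniform_measure \<nu> A)"
      using pos by (intro prob_space_uniform_measure) (auto simp: emeasure_eq_measure)
    show "sets (uniform_measure \<nu> A) = sets state_space" using S by simp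
    fix t :: real and B assume t: "0 \<le> t" and B: "B \<in> sets state_space"
    have km [measurable]: "(\<lambda>z. emeasure (P t z) C) \<in> borel_measurable \<nu>" if "C \<in> sets state_space" for C
      using measurable_emeasure_kernel[OF P_kernel[OF t S] that] .
    have le: "(\<integral>\<^sup>+ z. emeasure (P t z) C * indicator A z \<partial>\<nu>) \<le> emeasure \<nu> (A \<inter> C)" if C: "C \<in> sets state_space" for C
    proof -
      have "(\<integral>\<^sup>+ z. emeasure (P t z) C * indicator A z \<partial>\<nu>) \<le> (\<integral>\<^sup>+ z. emeasure (P t z) (A \<inter> C) \<partial>\<nu>)"
      proof (rule nn_integral_mono_AE)
        show "AE z in \<nu>. emeasure (P t z) C * indicator A z \<le> emeasure (P t z) (A \<inter> C)"
          using abs[OF t] AE_space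
        proof eventually_elim
          case (elim z)
          interpret Pz: prob_space "P t z" using prob_space_P[OF _ t] elim sp by simp
          show ?case
          proof (cases "z \<in> A")
            case True
            then have "AE y in P t z. y \<in> A"
              using elim A by (subst Pz.AE_in_set_eq_1) (auto simp: sets_P)
            then have "emeasure (P t z) C = emeasure (P t z) (A \<inter> C)"
              using A C by (intro emeasure_eq_AE) (auto simp: sets_P)
            then show ?thesis using True by simp
          qed simp
        qed
      qed
      also have "\<dots> = emeasure \<nu> (A \<inter> C)" using A C by (intro inv' t) auto
      finally show ?thesis .
    qed
    \<comment> \<open>The inequality holds for \<open>B\<close> and for its complement, and the two
      sides have the same finite total, so neither inequality is strict.\<close>
    let ?B' = "space state_space - B"
    have "(\<integral>\<^sup>+ z. emeasure (P t z) B * indicator A z \<partial>\<nu>) + (\<integral>\<^sup>+ z. emeasure (P t z) ?B' * indicator A z \<partial>\<nu>) =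
      (\<integral>\<^sup>+ z. emeasure (P t z) B * indicator A z + emeasure (P t z) ?B' * indicator A z \<partial>\<nu>)"
      using B by (intro nn_integral_add[symmetric]) auto
    also have "\<dots> = (\<integral>\<^sup>+ z. indicator A z \<partial>\<nu>)"
    proof (intro nn_integral_cong)
      fix z assume "z \<in> space \<nu>"
      then interpret Pz: prob_space "P t z" using prob_space_P[OF _ t] sp by simp
      have "emeasure (P t z) B + emeasure (P t z) ?B' = emeasure (P t z) (B \<union> ?B')"
        using B by (intro plus_emeasure) (auto simp: sets_P)
      also have "B \<union> ?B' = space (P t z)"
        using sets.sets_into_space[OF B] sets_eq_imp_space_eq[OF sets_P[of t z]] by auto
      finally show "emeasure (P t z) B * indicator A z + emeasure (P t z) ?B' * indicator A z = indicator A z"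
        using Pz.emeasure_space_1 by (simp add: distrib_right[symmetric])
    qed
    also have "\<dots> = emeasure \<nu> (A \<inter> B) + emeasure \<nu> (A \<inter> ?B')"
      using A B S sets.sets_into_space[OF A]
      by (subst plus_emeasure) (auto intro!: arg_cong[where f = "emeasure \<nu>"])
    finally have sum: "(\<integral>\<^sup>+ z. emeasure (P t z) B * indicator A z \<partial>\<nu>) + (\<integral>\<^sup>+ z. emeasure (P t z) ?B' * indicator A z \<partial>\<nu>) =
        emeasure \<nu> (A \<inter> B) + emeasure \<nu> (A \<inter> ?B')" .
    have "(\<integral>\<^sup>+ z. emeasure (P t z) B * indicator A z \<partial>\<nu>) = emeasure \<nu> (A \<inter> B)"
    proof (rule ennreal_eq_of_le_sum[OF le[OF B] _ sum])
      show "(\<integral>\<^sup>+ z. emeasure (P t z) ?B' * indicator A z \<partial>\<nu>) \<le> emeasure \<nu> (A \<inter> ?B')"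
        using B by (intro le) auto
    qed (auto simp: emeasure_eq_measure)
    then show "(\<integral>\<^sup>+ z. emeasure (P t z) B \<partial>uniform_measure \<nu> A) = emeasure (uniform_measure \<nu> A) B"
      using A B S pos by (subst nn_integral_uniform_measure) (auto simp: emeasure_uniform_measure)
  qed
qed

text \<open>Conditioning on a non-null absorbing set \<open>A\<close> yields an invariant measure
  that is again carried by \<open>S\<close>. By uniqueness it is \<open>\<nu>\<close>, so
  \<open>\<nu>\<close> gives \<open>A\<close> mass 1.\<close>

lemma ergodic_if_unique:
  assumes inv: "invariant \<nu>" and S: "S \<in> sets state_space" "emeasure \<nu> S = 1"
    and uniq: "\<And>\<nu>'. invariant \<nu>' \<Longrightarrow> emeasure \<nu>' S = 1 \<Longrightarrow> \<nu>' = \<nu>"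
  shows "ergodic \<nu>"
  unfolding ergodic_prob_def
proof (intro conjI ballI impI inv)
  fix A assume A: "A \<in> sets state_space" and abs: "\<forall>t\<ge>0. AE z in \<nu>. z \<in> A \<longrightarrow> measure (P t z) A = 1"
  interpret prob_space \<nu> using inv by (simp add: invariant_prob_def)
  have s\<nu>: "sets \<nu> = sets state_space" using inv by (simp add: invariant_prob_def)
  show "measure \<nu> A \<in> {0, 1}"
  proof (cases "emeasure \<nu> A = 0")
    case True
    then show ?thesis by (simp add: measure_def)
  next
    case False
    let ?u = "uniform_measure \<nu> A"
    have u: "invariant ?u" "emeasure ?u A = 1"
      using absorbing_conditional[OF inv A _ False] abs by auto
    interpret u: prob_space ?u using u by (simp add: invariant_prob_def)
    have "AE z in \<nu>. z \<in> S" using S s\<nu> by (subst AE_in_set_eq_1) (auto simp: measure_def)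
    then have AE: "AE z in ?u. z \<in> S"
      using A s\<nu> by (intro AE_uniform_measureI) auto
    have "S \<in> sets ?u" unfolding sets_uniform_measure s\<nu> by (rule S(1))
    from u.emeasure_eq_1_AE[OF this AE] have "?u = \<nu>" by (rule uniq[OF u(1)])
    then show ?thesis using u(2) by (simp add: measure_def)
  qed
qed

section \<open>Absorption in x = 0 and in x > 0\<close>

abbreviation "Zero \<equiv> {0} \<times> state_index"
abbreviation "Pos \<equiv> {0<..} \<times> state_index"

lemma Zero_sets: "{0::real} \<times> state_index \<in> sets state_space"
  unfolding state_space_def by (intro pair_measureI) (auto simp: sets_restrict_space_iff)
lemma Pos_sets: "{0::real<..} \<times> state_index \<in> sets state_space"
  unfolding state_space_def by (intro pair_measureI) (auto simp: sets_restrict_space_iff)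

lemma path_zero [simp]: "path e w 0 t = 0" by (simp add: path_def flow_def)
lemma path_pos: "0 < x \<Longrightarrow> 0 < path e w x t"
  using path_denominator_pos[of x e w t] by (simp add: path_def flow_def)

lemma Zero_absorbing:
  assumes "z \<in> Zero" "0 \<le> t" shows "emeasure (P t z) Zero = 1"
proof -
  interpret prob_space "holding (snd z)" by (rule prob_holding)
  have "emeasure (P t z) Zero = expect (\<lambda>i x. indicator Zero (x, i)) t (snd z) (fst z)"
    using assms by (intro emeasure_P Zero_sets) (auto simp: space_state_space)
  also have "\<dots> = (\<integral>\<^sup>+ w. 1 \<partial>holding (snd z))"
    unfolding expect_def
  proof (intro nn_integral_cong)
    fix w
    have "chain (snd z) w t \<in> state_index" using assms by (intro chain_in_state_index) auto
    then show "indicator Zero (path (snd z) w (fst z) t, chain (snd z) w t) = (1 :: ennreal)"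
      using assms by (auto simp: indicator_def)
  qed
  finally show ?thesis using emeasure_space_1 by simp
qed

lemma Pos_absorbing:
  assumes "z \<in> Pos" "0 \<le> t" shows "emeasure (P t z) Pos = 1"
proof -
  interpret prob_space "holding (snd z)" by (rule prob_holding)
  have "emeasure (P t z) Pos = expect (\<lambda>i x. indicator Pos (x, i)) t (snd z) (fst z)"
    using assms by (intro emeasure_P Pos_sets) (auto simp: space_state_space)
  also have "\<dots> = (\<integral>\<^sup>+ w. 1 \<partial>holding (snd z))"
    unfolding expect_def
  proof (intro nn_integral_cong)
    fix w
    have "chain (snd z) w t \<in> state_index" using assms by (intro chain_in_state_index) auto
    then show "indicator Pos (path (snd z) w (fst z) t, chain (snd z) w t) = (1 :: ennreal)"
      using assms path_pos by (auto simp: indicator_def)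
  qed
  finally show ?thesis using emeasure_space_1 by simp
qed

text \<open>On \<open>Zero\<close> only the state is random, and its law is forced by
  \<open>invariant_index\<close>.\<close>

lemma extinction_unique:
  assumes inv: "invariant \<nu>" and Z: "emeasure \<nu> Zero = 1"
  shows "\<nu> = \<delta>"
proof (rule measure_eqI)
  interpret prob_space \<nu> using inv by (simp add: invariant_prob_def)
  have S: "sets \<nu> = sets state_space" using inv by (simp add: invariant_prob_def)
  show "sets \<nu> = sets \<delta>" by (simp add: S sets_extinction)
  fix B assume "B \<in> sets \<nu>"
  then have B: "B \<in> sets state_space" using S by simp
  have AE: "AE z in \<nu>. z \<in> Zero"
    using Z S Zero_sets by (subst AE_in_set_eq_1) (auto simp: measure_def)
  have "emeasure \<nu> B = (\<integral>\<^sup>+ z. indicator B z \<partial>\<nu>)" using B S by simp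
  also have "\<dots> = (\<integral>\<^sup>+ z. indicator B (0, snd z) \<partial>\<nu>)"
    using AE by (intro nn_integral_cong_AE) (auto elim!: eventually_mono)
  also have "\<dots> = (\<Sum>e\<in>state_index. ennreal (chain_weight e) * indicator B (0, e))"
    using invariant_index[OF inv, of "-1"] invariant_index[OF inv, of 1]
    unfolding nn_integral_index[OF prob_space_axioms S, of "\<lambda>e. indicator B (0, e)"] sum_state_index
    by (simp add: mult.commute)
  also have "\<dots> = (\<integral>\<^sup>+ z. indicator B (fst z, snd z) \<partial>\<delta>)"
    using nn_integral_extinction[OF indicator_section_measurable[OF B], of "\<lambda>i. i"] by simp
  also have "\<dots> = emeasure \<delta> B" using B sets_extinction by simp
  finally show "emeasure \<nu> B = emeasure \<delta> B" .
qed

lemma emeasure_extinction_Zero: "emeasure \<delta> Zero = 1"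
proof -
  have "emeasure \<delta> Zero = (\<integral>\<^sup>+ z. indicator Zero (fst z, snd z) \<partial>\<delta>)" using Zero_sets sets_extinction by simp
  also have "\<dots> = (\<Sum>e\<in>state_index. ennreal (chain_weight e) * indicator Zero (0::real, e))"
    using nn_integral_extinction[OF indicator_section_measurable[OF Zero_sets], of "\<lambda>i. i"] by simp
  also have "\<dots> = 1" unfolding sum_state_index by (simp add: ennreal_chain_weight_sum)
  finally show ?thesis .
qed

lemma ergodic_extinction: "ergodic \<delta>"
  by (rule ergodic_if_unique[OF invariant_extinction Zero_sets emeasure_extinction_Zero extinction_unique])

lemma emeasure_Zero_Pos:
  assumes "invariant \<nu>"
  shows "emeasure \<nu> Zero + emeasure \<nu> Pos = 1"
proof -
  interpret prob_space \<nu> using assms by (simp add: invariant_prob_def)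
  have S: "sets \<nu> = sets state_space" using assms by (simp add: invariant_prob_def)
  have "emeasure \<nu> Zero + emeasure \<nu> Pos = emeasure \<nu> (Zero \<union> Pos)"
  proof (rule plus_emeasure)
    show "Zero \<in> events" "Pos \<in> events" unfolding S by (rule Zero_sets, rule Pos_sets)
  qed auto
  also have "Zero \<union> Pos = space \<nu>"
    unfolding sets_eq_imp_space_eq[OF S] space_state_space by (auto simp: less_le)
  finally show ?thesis using emeasure_space_1 by simp
qed

text \<open>\<open>Pos\<close> is absorbing, so an invariant measure charging it could be
  conditioned on it.\<close>

lemma no_positive_imp_extinction:
  assumes inv: "invariant \<nu>"
    and none: "\<And>\<nu>'. invariant \<nu>' \<Longrightarrow> emeasure \<nu>' Pos \<noteq> 1"
  shows "\<nu> = \<delta>"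
proof -
  have "emeasure \<nu> Pos = 0"
  proof (rule ccontr)
    assume pos: "emeasure \<nu> Pos \<noteq> 0"
    have abs: "AE z in \<nu>. z \<in> Pos \<longrightarrow> measure (P t z) Pos = 1" if "0 \<le> t" for t
      using Pos_absorbing[OF _ that] by (intro AE_I2 impI) (simp add: measure_def)
    show False
      using none[OF absorbing_conditional(1)[OF inv Pos_sets abs pos]]
        absorbing_conditional(2)[OF inv Pos_sets abs pos] by blast
  qed
  then show ?thesis using emeasure_Zero_Pos[OF inv] extinction_unique[OF inv] by simp
qed

lemma ergodic_Zero_or_Pos:
  assumes "ergodic \<nu>"
  shows "emeasure \<nu> Zero = 1 \<or> emeasure \<nu> Pos = 1"
proof -
  have inv: "invariant \<nu>" using assms by (simp add: ergodic_prob_def)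
  interpret prob_space \<nu> using inv by (simp add: invariant_prob_def)
  have "\<forall>t\<ge>0. AE z in \<nu>. z \<in> Zero \<longrightarrow> measure (P t z) Zero = 1"
    using Zero_absorbing by (intro allI AE_I2 impI) (simp add: measure_def)
  then have "measure \<nu> Zero \<in> {0, 1}"
    using assms Zero_sets unfolding ergodic_prob_def by blast
  then show ?thesis using emeasure_Zero_Pos[OF inv] by (auto simp: emeasure_eq_measure)
qed

section \<open>Nonpositive mean growth\<close>

definition mean_growth :: real where
  "mean_growth = chain_weight (-1) * pm + chain_weight 1 * pp"

text \<open>\<open>mean_growth\<close> is \<open>lp * pm + lm * pp\<close> divided by the positive
  number \<open>lp + lm\<close>; this is the link to the hypotheses on the rates.\<close>

lemma mean_growth_le_0_iff: "mean_growth \<le> 0 \<longleftrightarrow> - (lm / pm) \<le> lp / pp"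
proof -
  have "mean_growth = (lp * pm + lm * pp) / (lp + lm)"
    by (simp add: mean_growth_def chain_weight_def add_divide_distrib)
  then have "mean_growth \<le> 0 \<longleftrightarrow> lp * pm + lm * pp \<le> 0"
    using lm lp by (simp add: divide_le_0_iff)
  also have "\<dots> \<longleftrightarrow> lm / (- pm) \<le> lp / pp"
    using pm pp by (auto simp: field_simps)
  finally show ?thesis by simp
qed

lemma mean_growth_index: "ennreal (chain_weight (-1)) * ennreal (bnd - growth (-1)) + ennreal (chain_weight 1) * ennreal (bnd - growth 1) =
  ennreal (bnd - mean_growth)"
proof -
  have "chain_weight (-1) * (bnd - growth (-1)) + chain_weight 1 * (bnd - growth 1) =
    (chain_weight (-1) + chain_weight 1) * bnd - mean_growth"
    by (simp add: mean_growth_def growth_def algebra_simps)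
  moreover have "0 \<le> bnd - growth i" for i using abs_growth[of i] by linarith
  ultimately show ?thesis
    using chain_weight_sum less_imp_le[OF chain_weight_pos]
    by (simp add: ennreal_mult'[symmetric] ennreal_plus[symmetric] del: ennreal_plus)
qed

text \<open>The measure \<open>holding (k x)\<close> varies with \<open>x\<close>, but only through
  a countable index, which can therefore be fixed.\<close>

lemma holding_integral_measurable:
  assumes F: "\<And>e. (\<lambda>p. F e (fst p) (snd p)) \<in> borel_measurable (path_space \<Otimes>\<^sub>M borel)"
    and k: "k \<in> M \<rightarrow>\<^sub>M count_space UNIV" and f: "f \<in> borel_measurable M"
  shows "(\<lambda>x. \<integral>\<^sup>+ w. F (k x) w (f x) \<partial>holding (k x)) \<in> borel_measurable M"
proof (rule measurable_compose_countable'[where I = UNIV and f = "\<lambda>i x. \<integral>\<^sup>+ w. F i w (f x) \<partial>holding i"])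
  fix e :: int
  interpret prob_space "holding e" by (rule prob_holding)
  have "(\<lambda>p. F e (snd p) (fst p)) \<in> borel_measurable (borel \<Otimes>\<^sub>M holding e)"
    using measurable_compose[OF _ F[of e], of "\<lambda>p. (snd p, fst p)" "borel \<Otimes>\<^sub>M holding e"]
    by simp
  then have "(\<lambda>x. \<integral>\<^sup>+ w. F e w x \<partial>holding e) \<in> borel_measurable borel"
    by (intro borel_measurable_nn_integral) (simp add: split_beta')
  then show "(\<lambda>x. \<integral>\<^sup>+ w. F e w (f x) \<partial>holding e) \<in> borel_measurable M"
    by (rule measurable_compose[OF f])
qed (use k in auto)

lemma invariantD:
  assumes "invariant \<nu>"
  shows "prob_space \<nu>" "sets \<nu> = sets state_space"
    "\<And>t h. 0 \<le> t \<Longrightarrow> (\<And>i. h i \<in> borel_measurable borel) \<Longrightarrow>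
      mean \<nu> (expect h t) = mean \<nu> h"
  using assms by (auto simp: invariant_iff)

lemma nn_integral_invariant_index:
  assumes "invariant \<nu>"
  shows "(\<integral>\<^sup>+ z. f (snd z) \<partial>\<nu>) = ennreal (chain_weight (-1)) * f (-1) + ennreal (chain_weight 1) * f 1"
  using nn_integral_index[OF invariantD(1,2)[OF assms], of f] invariant_index[OF assms]
  by (simp add: mult.commute)

lemma path_growth_defect:
  assumes t: "0 \<le> t"
  shows "ennreal (bnd * t - path_growth e w t) =
    (\<integral>\<^sup>+ s. ennreal (bnd - growth (chain e w s)) * indicator {0..t} s \<partial>lborel)"
proof (rule nn_integral_has_integral_lebesgue'[symmetric])
  show "((\<lambda>s. bnd - growth (chain e w s)) has_integral bnd * t - path_growth e w t) {0..t}"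
    unfolding path_growth_integral
    using has_integral_const_real[of bnd 0 t] t
    by (intro has_integral_diff integrable_integral growth_integrable_on) (simp add: content_real mult.commute)
qed (use abs_growth in \<open>auto simp: abs_le_iff\<close>)

text \<open>By invariance \<open>bnd - growth\<close> has its stationary mean at every time
  \<open>s\<close>; Tonelli brings this under the time integral over \<open>{0..1}\<close>.\<close>

lemma nn_integral_path_growth:
  assumes inv: "invariant \<nu>"
  shows "(\<integral>\<^sup>+ z. \<integral>\<^sup>+ w. ennreal (bnd - path_growth (snd z) w 1) \<partial>holding (snd z) \<partial>\<nu>) = ennreal (bnd - mean_growth)"
proof -
  interpret prob_space \<nu> by (rule invariantD(1)[OF inv])
  have S[measurable_cong]: "sets \<nu> = sets state_space" by (rule invariantD(2)[OF inv])
  define h where "h = (\<lambda>i (x::real). ennreal (bnd - growth i))"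
  have hm [measurable]: "h i \<in> borel_measurable borel" for i by (simp add: h_def)
  have c1: "(\<lambda>p. ennreal (bnd - growth (chain e (fst p) (snd p))) * indicator {0..1} (snd p)) \<in> borel_measurable (holding e \<Otimes>\<^sub>M lborel)" for e
  proof -
    have "(\<lambda>p. growth (chain e (fst p) (snd p))) \<in> borel_measurable (holding e \<Otimes>\<^sub>M lborel)"
      by (rule measurable_compose[OF chain_measurable]) auto
    then show ?thesis by measurable
  qed
  have "(\<integral>\<^sup>+ z. \<integral>\<^sup>+ w. ennreal (bnd - path_growth (snd z) w 1) \<partial>holding (snd z) \<partial>\<nu>) =
    (\<integral>\<^sup>+ z. \<integral>\<^sup>+ s. expect h s (snd z) (fst z) * indicator {0..1} s \<partial>lborel \<partial>\<nu>)"
  proof (rule nn_integral_cong)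
    fix z :: "real \<times> int"
    interpret H: prob_space "holding (snd z)" by (rule prob_holding)
    interpret pair_sigma_finite "holding (snd z)" lborel ..
    have "(\<integral>\<^sup>+ w. ennreal (bnd - path_growth (snd z) w 1) \<partial>holding (snd z)) =
      (\<integral>\<^sup>+ w. \<integral>\<^sup>+ s. ennreal (bnd - growth (chain (snd z) w s)) * indicator {0..1} s \<partial>lborel \<partial>holding (snd z))"
      using path_growth_defect[of 1 "snd z"] by simp
    also have "\<dots> = (\<integral>\<^sup>+ s. \<integral>\<^sup>+ w. ennreal (bnd - growth (chain (snd z) w s)) * indicator {0..1} s \<partial>holding (snd z) \<partial>lborel)"
      using c1[of "snd z"] by (intro Fubini'[symmetric]) (simp add: split_beta')
    also have "\<dots> = (\<integral>\<^sup>+ s. expect h s (snd z) (fst z) * indicator {0..1} s \<partial>lborel)"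
      unfolding expect_def h_def
    proof (intro nn_integral_cong nn_integral_multc)
      fix s :: real
      show "(\<lambda>w. ennreal (bnd - growth (chain (snd z) w s))) \<in> borel_measurable (holding (snd z))"
        by (rule measurable_compose[OF chain_measurable]) auto
    qed
    finally show "(\<integral>\<^sup>+ w. ennreal (bnd - path_growth (snd z) w 1) \<partial>holding (snd z)) =
      (\<integral>\<^sup>+ s. expect h s (snd z) (fst z) * indicator {0..1} s \<partial>lborel)" .
  qed
  also have "\<dots> = (\<integral>\<^sup>+ s. \<integral>\<^sup>+ z. expect h s (snd z) (fst z) * indicator {0..1} s \<partial>\<nu> \<partial>lborel)"
    by (rule pair_sigma_finite.Fubini'[symmetric]) (auto intro!: pair_sigma_finite.intro sigma_finite_lborel sigma_finite_measure_axioms)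
  also have "\<dots> = (\<integral>\<^sup>+ s. ennreal (bnd - mean_growth) * indicator {0..1::real} s \<partial>lborel)"
  proof (rule nn_integral_cong)
    fix s :: real
    show "(\<integral>\<^sup>+ z. expect h s (snd z) (fst z) * indicator {0..1} s \<partial>\<nu>) = ennreal (bnd - mean_growth) * indicator {0..1} s"
    proof (cases "s \<in> {0..1}")
      case True
      have "mean \<nu> (expect h s) = mean \<nu> h"
        using True by (intro invariantD(3)[OF inv] hm) auto
      also have "\<dots> = ennreal (bnd - mean_growth)"
        unfolding h_def nn_integral_invariant_index[OF inv, of "\<lambda>i. ennreal (bnd - growth i)"] by (rule mean_growth_index)
      finally show ?thesis using True by simp
    qed simp
  qed
  also have "\<dots> = ennreal (bnd - mean_growth)"
    by (simp add: nn_integral_cmult)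
  finally show ?thesis .
qed

section \<open>Logarithmic increments\<close>

definition truncated_ln :: "nat \<Rightarrow> real \<Rightarrow> real" where
  "truncated_ln N x = max (- real N) (min (real N) (ln x))"

lemma truncated_ln_bounds: "- real N \<le> truncated_ln N x" "truncated_ln N x \<le> real N"
  by (auto simp: truncated_ln_def)

lemma ln_path:
  assumes "0 < x"
  shows "ln (path e w x t) = ln x + path_growth e w t - ln (1 + x * path_mass e w t)"
  using assms path_denominator_pos[of x e w t]
  by (simp add: path_def flow_def ln_div ln_mult)

lemma ln_denominator_nonneg: "0 < x \<Longrightarrow> 0 \<le> ln (1 + x * path_mass e w t)"
  using path_mass_nonneg[of e w t] by (intro ln_ge_zero) simp

text \<open>Clamping is monotone and does not enlarge increments, and the logarithm of the position
  grows by at most \<open>bnd\<close> in unit time.\<close>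

lemma truncated_ln_path:
  assumes "0 < x"
  shows "truncated_ln N (path e w x 1) - truncated_ln N x \<le> bnd"
proof -
  have "ln (path e w x 1) \<le> ln x + bnd"
    using ln_path[OF assms, of e w 1] path_growth_le[of 1 e w] ln_denominator_nonneg[OF assms, of e w 1] by simp
  then show ?thesis using bnd_pos by (auto simp: truncated_ln_def max_def min_def)
qed

lemma truncated_ln_measurable [measurable]: "truncated_ln N \<in> borel_measurable borel"
  unfolding truncated_ln_def[abs_def] by measurable

text \<open>
  By stationarity the truncated logarithmic increments have mean zero. They are bounded above,
  so Fatou's lemma bounds the mean of \<open>- ln (X\<^sub>1 / X\<^sub>0)\<close> from above without any integrability
  of \<open>ln X\<^sub>0\<close>.
\<close>

lemma no_positive_invariant:
  assumes inv: "invariant \<nu>" and pos: "emeasure \<nu> Pos = 1" and mg: "mean_growth \<le> 0"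
  shows False
proof -
  interpret prob_space \<nu> by (rule invariantD(1)[OF inv])
  have S[measurable_cong]: "sets \<nu> = sets state_space" by (rule invariantD(2)[OF inv])
  have PS: "Pos \<in> events" unfolding S by (rule Pos_sets)
  have "AE z in \<nu>. z \<in> Pos"
    using pos PS by (subst AE_in_set_eq_1) (auto simp: measure_def)
  then have AEpos: "AE z in \<nu>. 0 < fst z" by eventually_elim auto
  let ?H = "\<lambda>z. holding (snd z)"
  \<comment> \<open>As \<open>N\<close> grows, \<open>D\<close> becomes \<open>A + L\<close>: the
    shifted growth plus the loss \<open>ln (1 + x I)\<close> caused by the quadratic term of the
    fields.\<close>
  define D where "D = (\<lambda>N e w x. ennreal (bnd - (truncated_ln N (path e w x 1) - truncated_ln N x)))"
  define L where "L = (\<lambda>e w x. ennreal (ln (1 + \<bar>x\<bar> * path_mass e w 1)))"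
  define A where "A = (\<lambda>e w (x::real). ennreal (bnd - path_growth e w 1))"
  have Dm: "(\<lambda>p. D N e (fst p) (snd p)) \<in> borel_measurable (path_space \<Otimes>\<^sub>M borel)" for N e
    unfolding D_def by measurable
  have Lm: "(\<lambda>p. L e (fst p) (snd p)) \<in> borel_measurable (path_space \<Otimes>\<^sub>M borel)" for e
    unfolding L_def by measurable
  have Am: "(\<lambda>p. A e (fst p) (snd p)) \<in> borel_measurable (path_space \<Otimes>\<^sub>M borel)" for e
    unfolding A_def by measurable
  note [measurable] = holding_integral_measurable[of "D _", OF Dm snd_state_space fst_state_space]
    holding_integral_measurable[of L, OF Lm snd_state_space fst_state_space]
    holding_integral_measurable[of A, OF Am snd_state_space fst_state_space]
  have Dm' [measurable]: "(\<lambda>w. D N e w x) \<in> borel_measurable (holding e)" for N e x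
    unfolding D_def by measurable
  have Lm' [measurable]: "(\<lambda>w. L e w x) \<in> borel_measurable (holding e)" for e x
    unfolding L_def by measurable
  have Am' [measurable]: "(\<lambda>w. A e w x) \<in> borel_measurable (holding e)" for e x
    unfolding A_def by measurable
  have mean: "(\<integral>\<^sup>+ z. \<integral>\<^sup>+ w. D N (snd z) w (fst z) \<partial>?H z \<partial>\<nu>) = ennreal bnd" for N
  proof -
    \<comment> \<open>The shift by \<open>N\<close> makes \<open>h\<close> nonnegative. Path by
      path, \<open>D\<close> plus \<open>h\<close> at time 1 equals \<open>bnd\<close> plus
      \<open>h\<close> at time 0; stationarity then cancels the finite mean of
      \<open>h\<close>.\<close>
    define h where "h = (\<lambda>(i::int) x. ennreal (truncated_ln N x + real N))"
    have hm [measurable]: "h i \<in> borel_measurable borel" for i unfolding h_def by measurable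
    note [measurable (raw)] = indexed_measurable[OF hm]
    have "(\<integral>\<^sup>+ z. \<integral>\<^sup>+ w. D N (snd z) w (fst z) \<partial>?H z \<partial>\<nu>) + mean \<nu> h =
       (\<integral>\<^sup>+ z. \<integral>\<^sup>+ w. D N (snd z) w (fst z) \<partial>?H z \<partial>\<nu>) + mean \<nu> (expect h 1)"
      by (subst invariantD(3)[OF inv _ hm]) auto
    also have "\<dots> = (\<integral>\<^sup>+ z. (\<integral>\<^sup>+ w. D N (snd z) w (fst z) \<partial>?H z) + expect h 1 (snd z) (fst z) \<partial>\<nu>)"
      by (intro nn_integral_add[symmetric]) measurable
    also have "\<dots> = (\<integral>\<^sup>+ z. ennreal bnd + h (snd z) (fst z) \<partial>\<nu>)"
    proof (rule nn_integral_cong_AE)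
      show "AE z in \<nu>. (\<integral>\<^sup>+ w. D N (snd z) w (fst z) \<partial>?H z) + expect h 1 (snd z) (fst z) = ennreal bnd + h (snd z) (fst z)"
        using AEpos
      proof eventually_elim
        case (elim z)
        interpret H: prob_space "?H z" by (rule prob_holding)
        have "(\<integral>\<^sup>+ w. D N (snd z) w (fst z) \<partial>?H z) + expect h 1 (snd z) (fst z) =
          (\<integral>\<^sup>+ w. D N (snd z) w (fst z) + h (chain (snd z) w 1) (path (snd z) w (fst z) 1) \<partial>?H z)"
          unfolding expect_def by (intro nn_integral_add[symmetric]) measurable
        also have "\<dots> = (\<integral>\<^sup>+ w. ennreal bnd + h (snd z) (fst z) \<partial>?H z)"
        proof (intro nn_integral_cong)
          fix w
          show "D N (snd z) w (fst z) + h (chain (snd z) w 1) (path (snd z) w (fst z) 1) = ennreal bnd + h (snd z) (fst z)"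
          proof -
            have "0 \<le> truncated_ln N x + real N" for x using truncated_ln_bounds(1)[of N x] by linarith
            then show ?thesis
              using truncated_ln_path[OF elim, of N "snd z" w] bnd_pos
              unfolding D_def h_def by (simp add: ennreal_plus[symmetric] del: ennreal_plus)
          qed
        qed
        also have "\<dots> = ennreal bnd + h (snd z) (fst z)" using H.emeasure_space_1 by simp
        finally show ?case .
      qed
    qed
    also have "\<dots> = ennreal bnd + mean \<nu> h"
      using emeasure_space_1 by (subst nn_integral_add) auto
    finally have eq: "mean \<nu> h + (\<integral>\<^sup>+ z. \<integral>\<^sup>+ w. D N (snd z) w (fst z) \<partial>?H z \<partial>\<nu>) =
       mean \<nu> h + ennreal bnd" by (simp add: add.commute)
    have "mean \<nu> h \<le> (\<integral>\<^sup>+ z. ennreal (2 * real N) \<partial>\<nu>)"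
      unfolding h_def using truncated_ln_bounds(2)[of N]
      by (intro nn_integral_mono ennreal_leI) (simp add: algebra_simps)
    also have "\<dots> < \<infinity>" using emeasure_space_1 by simp
    finally show ?thesis using eq by (auto simp: ennreal_add_left_cancel)
  qed
  have lim: "A e w x + L e w x = liminf (\<lambda>N. D N e w x)" if x: "0 < x" for e w x
  proof -
    \<comment> \<open>For a fixed path and start the truncation is inactive from some
      \<open>N\<close> on, so the limit is attained.\<close>
    obtain N0 :: nat where N0: "\<bar>ln x\<bar> \<le> real N0" "\<bar>ln (path e w x 1)\<bar> \<le> real N0"
      using real_arch_simple[of "max \<bar>ln x\<bar> \<bar>ln (path e w x 1)\<bar>"] by auto
    have "\<forall>\<^sub>F N in sequentially. D N e w x = A e w x + L e w x"
      using eventually_ge_at_top[of N0]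
    proof eventually_elim
      case (elim N)
      then have N: "\<bar>ln x\<bar> \<le> real N" "\<bar>ln (path e w x 1)\<bar> \<le> real N" using N0 by (auto intro: order_trans)
      have "truncated_ln N (path e w x 1) - truncated_ln N x = ln (path e w x 1) - ln x"
        using N by (auto simp: truncated_ln_def)
      also have "\<dots> = path_growth e w 1 - ln (1 + x * path_mass e w 1)"
        using ln_path[OF x] by simp
      finally have d: "truncated_ln N (path e w x 1) - truncated_ln N x = path_growth e w 1 - ln (1 + x * path_mass e w 1)" .
      have "D N e w x = ennreal ((bnd - path_growth e w 1) + ln (1 + x * path_mass e w 1))"
        unfolding D_def d by (intro arg_cong[where f = ennreal]) simp
      then show ?case using x ln_denominator_nonneg[OF x, of e w 1] path_growth_le[of 1 e w]
        unfolding A_def L_def by (subst (asm) ennreal_plus) auto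
    qed
    then have "(\<lambda>N. D N e w x) \<longlonglongrightarrow> A e w x + L e w x"
      by (rule tendsto_eventually)
    then show ?thesis using lim_imp_Liminf[OF sequentially_bot] by metis
  qed
  have "(\<integral>\<^sup>+ z. \<integral>\<^sup>+ w. A (snd z) w (fst z) \<partial>?H z \<partial>\<nu>) + (\<integral>\<^sup>+ z. \<integral>\<^sup>+ w. L (snd z) w (fst z) \<partial>?H z \<partial>\<nu>) =
     (\<integral>\<^sup>+ z. (\<integral>\<^sup>+ w. A (snd z) w (fst z) \<partial>?H z) + (\<integral>\<^sup>+ w. L (snd z) w (fst z) \<partial>?H z) \<partial>\<nu>)"
    by (intro nn_integral_add[symmetric]) measurable
  also have "\<dots> = (\<integral>\<^sup>+ z. (\<integral>\<^sup>+ w. A (snd z) w (fst z) + L (snd z) w (fst z) \<partial>?H z) \<partial>\<nu>)"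
    by (intro nn_integral_cong nn_integral_add[symmetric]) measurable
  also have "\<dots> = (\<integral>\<^sup>+ z. (\<integral>\<^sup>+ w. liminf (\<lambda>N. D N (snd z) w (fst z)) \<partial>?H z) \<partial>\<nu>)"
    using AEpos by (intro nn_integral_cong_AE) (auto elim!: eventually_mono simp: lim)
  also have "\<dots> \<le> (\<integral>\<^sup>+ z. liminf (\<lambda>N. \<integral>\<^sup>+ w. D N (snd z) w (fst z) \<partial>?H z) \<partial>\<nu>)"
    by (intro nn_integral_mono nn_integral_liminf) measurable
  also have "\<dots> \<le> liminf (\<lambda>N. \<integral>\<^sup>+ z. \<integral>\<^sup>+ w. D N (snd z) w (fst z) \<partial>?H z \<partial>\<nu>)"
    by (intro nn_integral_liminf) measurable
  also have "\<dots> = ennreal bnd" by (simp add: mean Liminf_const)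
  \<comment> \<open>Nonpositive mean growth, equality included, leaves no room for a positive mean
    of \<open>L\<close>.\<close>
  also have "\<dots> \<le> ennreal (bnd - mean_growth)" using mg by (intro ennreal_leI) simp
  finally have "ennreal (bnd - mean_growth) + (\<integral>\<^sup>+ z. \<integral>\<^sup>+ w. L (snd z) w (fst z) \<partial>?H z \<partial>\<nu>) \<le> ennreal (bnd - mean_growth) + 0"
    unfolding A_def nn_integral_path_growth[OF inv] by simp
  then have "(\<integral>\<^sup>+ z. \<integral>\<^sup>+ w. L (snd z) w (fst z) \<partial>?H z \<partial>\<nu>) = 0"
    by (subst (asm) ennreal_add_left_cancel_le) auto
  then have "AE z in \<nu>. (\<integral>\<^sup>+ w. L (snd z) w (fst z) \<partial>?H z) = 0"
    by (subst (asm) nn_integral_0_iff_AE) measurable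
  with AEpos have "AE z in \<nu>. False"
  proof eventually_elim
    case (elim z)
    interpret H: prob_space "?H z" by (rule prob_holding)
    have "AE w in ?H z. L (snd z) w (fst z) = 0"
      using elim(2) by (subst (asm) nn_integral_0_iff_AE) measurable
    then have "AE w in ?H z. False"
    proof eventually_elim
      case (elim w)
      have "0 < fst z * path_mass (snd z) w 1" using \<open>0 < fst z\<close> by (intro mult_pos_pos path_mass_pos) auto
      then show ?case using elim \<open>0 < fst z\<close> by (simp add: L_def ln_le_zero_iff ennreal_eq_0_iff)
    qed
    then show False by simp
  qed
  then show False by simp
qed

end

section \<open>Uniqueness for positive mean growth\<close>

text \<open>Turns an error that is both bounded by 1 and linear into a small power, since decay is
  available only for moments of \<open>exp (- A)\<close> of some small order.\<close>

lemma min_one_le_powr: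
  assumes "0 \<le> (u::real)" "0 < a" "a \<le> 1" shows "min 1 u \<le> u powr a"
proof (cases "u \<le> 1")
  case True
  show ?thesis
  proof (cases "u = 0")
    case False
    then have "u powr 1 \<le> u powr a" using True assms by (intro powr_mono') auto
    then show ?thesis using assms by simp
  qed simp
next
  case False
  then have "1 powr a \<le> u powr a" using assms by (intro powr_mono2) auto
  then show ?thesis by simp
qed

context logistic_switching begin

text \<open>With \<open>Q\<close> the generator of the chain, the condition reads
  \<open>(Q - \<theta> growth) v \<le> - \<kappa> v\<close>. The ansatz is a perturbation of the
  constant 1, equal to \<open>1 + \<theta> * c\<close> at \<open>-1\<close> and 1 at
  \<open>1\<close>. To first order in \<open>\<theta>\<close> it works if \<open>c\<close> lies
  between \<open>- pm / lm\<close> and \<open>pp / lp\<close>, an interval that positive mean growth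
  makes nonempty.\<close>

lemma supersolution_exists:
  assumes "0 < mean_growth"
  obtains \<theta> \<kappa> :: real and v :: "int \<Rightarrow> real"
  where "0 < \<theta>" "\<theta> \<le> 1" "0 < \<kappa>" "\<And>e. 1 \<le> v e"
    "\<And>e. e \<in> state_index \<Longrightarrow> rate e * v (-e) \<le> (rate e + \<theta> * growth e - \<kappa>) * v e"
proof -
  have "\<not> (- (lm / pm) \<le> lp / pp)" using assms mean_growth_le_0_iff by simp
  then have "- pm / lm < pp / lp"
    using pm pp lm lp by (simp add: field_simps)
  then obtain c where c: "- pm / lm < c" "c < pp / lp" using dense by blast
  have c0: "0 < c" using c(1) pm lm by (smt (verit) divide_pos_pos)
  have c1: "- pm < lm * c" using c(1) lm by (simp add: field_simps)
  have c2: "lp * c < pp" using c(2) lp by (simp add: field_simps)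
  \<comment> \<open>\<open>\<kappa>\<close> will be \<open>\<theta> * k\<close>. The bound
    \<open>pp - lp * c\<close> settles the state \<open>1\<close>; half of
    \<open>lm * c + pm\<close> keeps a margin in the state \<open>-1\<close> for the term of second
    order in \<open>\<theta>\<close>.\<close>
  define k where "k = min (pp - lp * c) ((lm * c + pm) / 2)"
  have k: "0 < k" "k \<le> pp - lp * c" "k - pm < lm * c" using c1 c2 by (auto simp: k_def min_def field_simps)
  have kp: "0 < k - pm" using k pm by simp
  \<comment> \<open>The largest value for which that margin absorbs the second-order term, capped at
    1 for \<open>min_one_le_powr\<close>.\<close>
  define \<theta> where "\<theta> = min 1 ((lm * c / (k - pm) - 1) / c)"
  have q: "1 < lm * c / (k - pm)" using k kp by (simp add: field_simps)
  then have \<theta>: "0 < \<theta>" "\<theta> \<le> 1" using c0 by (auto simp: \<theta>_def)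
  have "\<theta> * c \<le> (lm * c / (k - pm) - 1) / c * c"
    using c0 by (intro mult_right_mono) (auto simp: \<theta>_def)
  then have "\<theta> * c \<le> lm * c / (k - pm) - 1" using c0 by simp
  then have t: "(k - pm) * (1 + \<theta> * c) \<le> lm * c" using kp by (simp add: field_simps)
  show ?thesis
  proof (rule that[of \<theta> "\<theta> * k" "\<lambda>e. if e = -1 then 1 + \<theta> * c else 1"])
    fix e :: int assume e: "e \<in> state_index"
    show "rate e * (if -e = -1 then 1 + \<theta> * c else 1) \<le> (rate e + \<theta> * growth e - \<theta> * k) * (if e = -1 then 1 + \<theta> * c else 1)"
    proof (cases "e = -1")
      case True
      have "\<theta> * ((k - pm) * (1 + \<theta> * c)) \<le> \<theta> * (lm * c)" using t \<theta> by (intro mult_left_mono) auto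
      then show ?thesis using True by (simp add: switch_rate_def growth_def algebra_simps)
    next
      case False
      then have "e = 1" using e by simp
      moreover have "\<theta> * k \<le> \<theta> * (pp - lp * c)" using k \<theta> by (intro mult_left_mono) auto
      ultimately show ?thesis by (simp add: switch_rate_def growth_def algebra_simps)
    qed
  qed (use \<theta> c0 k in auto)
qed

text \<open>Restricting to \<open>t < jump_time w n\<close> permits induction on the number of
  switches: \<open>jump_time w 0 = 0\<close> makes the case \<open>n = 0\<close> void, and splitting
  off the first holding time lowers \<open>n\<close> by one.\<close>

lemma exponential_growth_bound_truncated:
  assumes \<theta>: "0 < \<theta>" and \<kappa>: "0 < \<kappa>" and v: "\<And>e. 1 \<le> v e"
    and super: "\<And>e. e \<in> state_index \<Longrightarrow> rate e * v (-e) \<le> (rate e + \<theta> * growth e - \<kappa>) * v e"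
    and e: "e \<in> state_index" and t: "0 \<le> t"
  shows "(\<integral>\<^sup>+ w. ennreal (exp (- (\<theta> * path_growth e w t))) * (if t < jump_time w n then 1 else 0) \<partial>holding e) \<le> ennreal (v e * exp (- (\<kappa> * t)))"
  using e t
proof (induction n arbitrary: e t)
  case 0
  then show ?case by (simp add: jump_time_def)
next
  case (Suc n)
  interpret H: prob_space "holding (-e)" by (rule prob_holding)
  have e': "-e \<in> state_index" using Suc.prems by auto
  \<comment> \<open>The rate of the first holding time after tilting by
    \<open>exp (- (\<theta> * A))\<close> and taking out the decay
    \<open>exp (- (\<kappa> * t))\<close>. The supersolution inequality makes it positive.\<close>
  define a where "a = rate e + \<theta> * growth e - \<kappa>"
  have av: "rate e * v (-e) \<le> a * v e" using super[OF Suc.prems(1)] by (simp add: a_def)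
  have ap: "0 < a"
  proof -
    have "0 < rate e * v (-e)" using rate_pos[of e] v[of "-e"] by (intro mult_pos_pos) auto
    then have "0 < a * v e" using av by linarith
    then show ?thesis using v[of e] by (simp add: zero_less_mult_iff)
  qed
  let ?F = "\<lambda>e t w. ennreal (exp (- (\<theta> * path_growth e w t))) * (if t < jump_time w (Suc n) then 1 else 0)"
  let ?G = "\<lambda>e t w. ennreal (exp (- (\<theta> * path_growth e w t))) * (if t < jump_time w n then 1 else 0)"
  have "(\<integral>\<^sup>+ w. ?F e t w \<partial>holding e) =
    (\<integral>\<^sup>+ s. ennreal (exponential_density (rate e) s) * (\<integral>\<^sup>+ w. ?F e t (case_nat s w) \<partial>holding (-e)) \<partial>lborel)"
    by (rule nn_integral_holding_space[OF rate_pos]) measurable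
  also have "\<dots> \<le> (\<integral>\<^sup>+ s. weight e s * indicator {t..} s * ennreal (exp (- (\<theta> * (growth e * t)))) +
      ennreal (a * exp (- (a * s))) * indicator {0..t} s * ennreal (v e * exp (- (\<kappa> * t))) \<partial>lborel)"
  proof (intro nn_integral_mono)
    fix s :: real
    show "ennreal (exponential_density (rate e) s) * (\<integral>\<^sup>+ w. ?F e t (case_nat s w) \<partial>holding (-e)) \<le>
      weight e s * indicator {t..} s * ennreal (exp (- (\<theta> * (growth e * t)))) +
      ennreal (a * exp (- (a * s))) * indicator {0..t} s * ennreal (v e * exp (- (\<kappa> * t)))"
    proof (cases "s < 0")
      case True
      then show ?thesis by (simp add: exponential_density_def)
    next
      case False
      then have s: "0 \<le> s" by simp
      have w: "ennreal (exponential_density (rate e) s) = weight e s"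
        using False by (simp add: exponential_density_def weight_def mult.commute)
      show ?thesis
      proof (cases "t < s")
        case True
        have "(\<integral>\<^sup>+ w. ?F e t (case_nat s w) \<partial>holding (-e)) \<le> (\<integral>\<^sup>+ w. ennreal (exp (- (\<theta> * (growth e * t)))) \<partial>holding (-e))"
        proof (rule nn_integral_mono_AE)
          show "AE w in holding (-e). ?F e t (case_nat s w) \<le> ennreal (exp (- (\<theta> * (growth e * t))))"
            using AE_regular_holding by eventually_elim (use True Suc.prems in \<open>auto simp: path_growth_case_nat s\<close>)
        qed
        also have "\<dots> = ennreal (exp (- (\<theta> * (growth e * t))))" using H.emeasure_space_1 by simp
        finally show ?thesis using True by (simp add: w mult_left_mono)
      next
        case ts: False
        have "(\<integral>\<^sup>+ w. ?F e t (case_nat s w) \<partial>holding (-e)) =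
          (\<integral>\<^sup>+ w. ennreal (exp (- (\<theta> * (growth e * s)))) * ?G (-e) (t - s) w \<partial>holding (-e))"
        proof (rule nn_integral_cong_AE)
          show "AE w in holding (-e). ?F e t (case_nat s w) = ennreal (exp (- (\<theta> * (growth e * s)))) * ?G (-e) (t - s) w"
            using AE_regular_holding
          proof eventually_elim
            case (elim w)
            have "exp (- (\<theta> * path_growth e (case_nat s w) t)) = exp (- (\<theta> * (growth e * s))) * exp (- (\<theta> * path_growth (-e) w (t - s)))"
              using ts by (simp add: path_growth_case_nat[OF elim s] exp_add[symmetric] algebra_simps)
            then show ?case by (auto simp: jump_time_case_nat ennreal_mult' less_diff_eq add.commute)
          qed
        qed
        also have "\<dots> = ennreal (exp (- (\<theta> * (growth e * s)))) * (\<integral>\<^sup>+ w. ?G (-e) (t - s) w \<partial>holding (-e))"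
          by (rule nn_integral_cmult) measurable
        also have "\<dots> \<le> ennreal (exp (- (\<theta> * (growth e * s)))) * ennreal (v (-e) * exp (- (\<kappa> * (t - s))))"
          using ts by (intro mult_left_mono Suc.IH e') auto
        finally have "weight e s * (\<integral>\<^sup>+ w. ?F e t (case_nat s w) \<partial>holding (-e)) \<le>
          weight e s * (ennreal (exp (- (\<theta> * (growth e * s)))) * ennreal (v (-e) * exp (- (\<kappa> * (t - s)))))"
          by (rule mult_left_mono) simp
        also have "\<dots> = ennreal (rate e * exp (- (rate e * s)) * (exp (- (\<theta> * (growth e * s))) * (v (-e) * exp (- (\<kappa> * (t - s))))))"
          using v[of "-e"] rate_pos[of e] unfolding weight_def by (simp add: ennreal_mult)
        also have "rate e * exp (- (rate e * s)) * (exp (- (\<theta> * (growth e * s))) * (v (-e) * exp (- (\<kappa> * (t - s))))) =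
           rate e * v (-e) * (exp (- (a * s)) * exp (- (\<kappa> * t)))"
        proof -
          have "exp (- (rate e * s)) * (exp (- (\<theta> * (growth e * s))) * exp (- (\<kappa> * (t - s)))) = exp (- (a * s)) * exp (- (\<kappa> * t))"
            unfolding exp_add[symmetric] by (simp add: a_def algebra_simps)
          then show ?thesis by (simp add: mult_ac)
        qed
        also have "\<dots> \<le> a * v e * (exp (- (a * s)) * exp (- (\<kappa> * t)))"
          using av by (intro mult_right_mono) auto
        also have "ennreal (a * v e * (exp (- (a * s)) * exp (- (\<kappa> * t)))) = ennreal (a * exp (- (a * s))) * ennreal (v e * exp (- (\<kappa> * t)))"
          using ap v[of e] by (simp add: ennreal_mult[symmetric] mult_ac)
        finally have "weight e s * (\<integral>\<^sup>+ w. ?F e t (case_nat s w) \<partial>holding (-e)) \<le>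
          ennreal (a * exp (- (a * s))) * ennreal (v e * exp (- (\<kappa> * t)))"
          by (simp add: ennreal_leI)
        then show ?thesis using s ts by (simp add: w add_increasing)
      qed
    qed
  qed
  also have "\<dots> = (\<integral>\<^sup>+ s. weight e s * indicator {t..} s \<partial>lborel) * ennreal (exp (- (\<theta> * (growth e * t)))) +
      (\<integral>\<^sup>+ s. ennreal (a * exp (- (a * s))) * indicator {0..t} s \<partial>lborel) * ennreal (v e * exp (- (\<kappa> * t)))"
    by (subst nn_integral_add) (auto simp: nn_integral_multc)
  also have "\<dots> = ennreal (exp (- (rate e * t))) * ennreal (exp (- (\<theta> * (growth e * t)))) + ennreal (1 - exp (- (a * t))) * ennreal (v e * exp (- (\<kappa> * t)))"
    using Suc.prems unfolding weight_def
    by (simp only: nn_integral_exponential_tail[OF rate_pos] nn_integral_exponential_weight[OF ap])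
  also have "\<dots> = ennreal (exp (- (rate e * t)) * exp (- (\<theta> * (growth e * t))) + (1 - exp (- (a * t))) * (v e * exp (- (\<kappa> * t))))"
    using ap v[of e] Suc.prems by (simp add: ennreal_mult[symmetric])
  \<comment> \<open>After tilting, the part without a switch has weight
    \<open>exp (- (a * t))\<close> and the other part the complementary one;
    \<open>1 \<le> v e\<close> lets both carry the factor \<open>v e\<close>.\<close>
  also have "exp (- (rate e * t)) * exp (- (\<theta> * (growth e * t))) + (1 - exp (- (a * t))) * (v e * exp (- (\<kappa> * t))) \<le> v e * exp (- (\<kappa> * t))"
  proof -
    have "exp (- (rate e * t)) * exp (- (\<theta> * (growth e * t))) = 1 * (exp (- (a * t)) * exp (- (\<kappa> * t)))"
      by (simp add: a_def exp_add[symmetric] algebra_simps)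
    also have "\<dots> \<le> v e * (exp (- (a * t)) * exp (- (\<kappa> * t)))"
      using v[of e] by (intro mult_right_mono) auto
    finally show ?thesis by (simp add: algebra_simps)
  qed
  finally show ?case by (simp add: ennreal_leI)
qed

text \<open>On regular paths the truncation is inactive for large \<open>n\<close>, and Fatou's
  lemma removes it.\<close>

lemma exponential_growth_bound:
  assumes \<theta>: "0 < \<theta>" and \<kappa>: "0 < \<kappa>" and v: "\<And>e. 1 \<le> v e"
    and super: "\<And>e. e \<in> state_index \<Longrightarrow> rate e * v (-e) \<le> (rate e + \<theta> * growth e - \<kappa>) * v e"
    and e: "e \<in> state_index" and t: "0 \<le> t"
  shows "(\<integral>\<^sup>+ w. ennreal (exp (- (\<theta> * path_growth e w t))) \<partial>holding e) \<le> ennreal (v e * exp (- (\<kappa> * t)))"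
proof -
  let ?F = "\<lambda>n w. ennreal (exp (- (\<theta> * path_growth e w t))) * (if t < jump_time w n then 1 else 0)"
  have "(\<integral>\<^sup>+ w. ennreal (exp (- (\<theta> * path_growth e w t))) \<partial>holding e) = (\<integral>\<^sup>+ w. liminf (\<lambda>n. ?F n w) \<partial>holding e)"
  proof (rule nn_integral_cong_AE)
    show "AE w in holding e. ennreal (exp (- (\<theta> * path_growth e w t))) = liminf (\<lambda>n. ?F n w)"
      using AE_regular_holding
    proof eventually_elim
      case (elim w)
      then have "finite {n. jump_time w n \<le> t}" by (simp add: regular_def)
      then obtain N where "\<And>n. jump_time w n \<le> t \<Longrightarrow> n < N" by (auto simp: finite_nat_set_iff_bounded)
      then have "t < jump_time w n" if "N \<le> n" for n using that by (meson not_le)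
      then have "\<forall>\<^sub>F n in sequentially. ?F n w = ennreal (exp (- (\<theta> * path_growth e w t)))"
        by (intro eventually_mono[OF eventually_ge_at_top[of N]]) simp
      then have "(\<lambda>n. ?F n w) \<longlonglongrightarrow> ennreal (exp (- (\<theta> * path_growth e w t)))"
        by (rule tendsto_eventually)
      then show ?case using lim_imp_Liminf[OF sequentially_bot] by metis
    qed
  qed
  also have "\<dots> \<le> liminf (\<lambda>n. \<integral>\<^sup>+ w. ?F n w \<partial>holding e)"
    by (rule nn_integral_liminf) measurable
  also have "\<dots> \<le> liminf (\<lambda>n::nat. ennreal (v e * exp (- (\<kappa> * t))))"
    by (intro Liminf_mono always_eventually allI exponential_growth_bound_truncated assms)
  also have "\<dots> = ennreal (v e * exp (- (\<kappa> * t)))" by (simp add: Liminf_const)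
  finally show ?thesis .
qed

section \<open>Synchronous coupling in the coordinate 1/x\<close>

definition ramp :: "real \<Rightarrow> real \<Rightarrow> real \<Rightarrow> real" where
  "ramp b m y = max 0 (min 1 (m * (b - y)))"

lemma ramp_measurable [measurable]: "ramp b m \<in> borel_measurable borel"
  unfolding ramp_def[abs_def] by measurable

lemma ramp_bounds: "0 \<le> ramp b m y" "ramp b m y \<le> 1" by (auto simp: ramp_def)

text \<open>A ramp has values in \<open>{0..1}\<close> and Lipschitz constant \<open>m\<close>, and
  approaches the indicator of \<open>y < b\<close> as \<open>m\<close> grows. Both bounds are kept
  in one estimate, ready for \<open>min_one_le_powr\<close>.\<close>

lemma ramp_lipschitz:
  assumes "0 \<le> m" shows "ramp b m y \<le> ramp b m y' + min 1 (m * \<bar>y - y'\<bar>)"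
proof -
  have "m * (b - y) \<le> m * (b - y') + m * \<bar>y - y'\<bar>"
    using assms mult_left_mono[of "y' - y" "\<bar>y - y'\<bar>" m] by (simp add: algebra_simps)
  moreover have "0 \<le> m * \<bar>y - y'\<bar>" using assms by simp
  ultimately show ?thesis by (auto simp: ramp_def max_def min_def)
qed

lemma inverse_path:
  assumes "0 < x"
  shows "1 / path e w x t = exp (- path_growth e w t) * (1 / x + path_mass e w t)"
  using assms path_denominator_pos[of x e w t]
  by (simp add: path_def flow_def exp_minus field_simps)

definition ramp_test :: "int \<Rightarrow> real \<Rightarrow> real \<Rightarrow> int \<Rightarrow> real \<Rightarrow> ennreal" where
  "ramp_test i b m j x = (if j = i then ennreal (ramp b m (1 / x)) else 0)"

lemma ramp_test_measurable [measurable]: "ramp_test i b m j \<in> borel_measurable borel"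
  unfolding ramp_test_def[abs_def] by measurable

lemma ramp_test_le_1: "ramp_test i b m j x \<le> 1"
  by (simp add: ramp_test_def ramp_bounds)

text \<open>Both positions are driven by the same \<open>w\<close>: the states coincide, and the
  distance of the inverse positions is multiplied by \<open>exp (- A)\<close>.\<close>

lemma ramp_test_coupling:
  assumes \<theta>: "0 < \<theta>" "\<theta> \<le> 1" and m: "0 \<le> m" and x: "0 < x" "0 < y"
  shows "ramp_test i b m j (path e w x t) \<le> ramp_test i b m j (path e w y t) +
    ennreal ((m * \<bar>1 / x - 1 / y\<bar>) powr \<theta>) * ennreal (exp (- (\<theta> * path_growth e w t)))"
proof -
  let ?u = "m * \<bar>1 / x - 1 / y\<bar>" and ?a = "path_growth e w t"
  have "1 / path e w x t - 1 / path e w y t = exp (- ?a) * (1 / x - 1 / y)"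
    using inverse_path[OF x(1), of e w t] inverse_path[OF x(2), of e w t] by (simp add: algebra_simps)
  then have "ramp b m (1 / path e w x t) \<le> ramp b m (1 / path e w y t) + min 1 (m * (exp (- ?a) * \<bar>1 / x - 1 / y\<bar>))"
    using ramp_lipschitz[OF m, of b "1 / path e w x t" "1 / path e w y t"] by (simp add: abs_mult)
  also have "min 1 (m * (exp (- ?a) * \<bar>1 / x - 1 / y\<bar>)) \<le> (m * (exp (- ?a) * \<bar>1 / x - 1 / y\<bar>)) powr \<theta>"
    using m \<theta> by (intro min_one_le_powr) auto
  also have "(m * (exp (- ?a) * \<bar>1 / x - 1 / y\<bar>)) powr \<theta> = (exp (- ?a) * ?u) powr \<theta>"
    by (simp add: mult_ac)
  also have "\<dots> = exp (- (\<theta> * ?a)) * ?u powr \<theta>"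
    using m by (subst powr_mult) (auto simp: powr_def)
  finally have "ramp b m (1 / path e w x t) \<le> ramp b m (1 / path e w y t) + ?u powr \<theta> * exp (- (\<theta> * ?a))"
    by (simp add: mult.commute)
  then have "ennreal (ramp b m (1 / path e w x t)) \<le> ennreal (ramp b m (1 / path e w y t)) + ennreal (?u powr \<theta>) * ennreal (exp (- (\<theta> * ?a)))"
    using ramp_bounds(1)[of b m "1 / path e w y t"]
    by (simp add: ennreal_mult[symmetric] ennreal_plus[symmetric] ennreal_leI del: ennreal_plus)
  then show ?thesis by (simp add: ramp_test_def)
qed

text \<open>Each measure is compared with the process started at position 1 with the stationary law
  of the state, which both measures share. The two coupling errors vanish as time goes to
  infinity.\<close>

lemma invariant_ramp_le:
  assumes inv: "invariant \<nu>" "emeasure \<nu> Pos = 1"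
    and inv': "invariant \<nu>'" "emeasure \<nu>' Pos = 1"
    and mg: "0 < mean_growth" and m: "0 \<le> m"
  shows "mean \<nu> (ramp_test i b m) \<le> mean \<nu>' (ramp_test i b m)"
proof -
  let ?h = "ramp_test i b m"
  obtain \<theta> \<kappa> v where *: "0 < \<theta>" "\<theta> \<le> 1" "0 < \<kappa>" "\<And>e. 1 \<le> v e"
    "\<And>e. e \<in> state_index \<Longrightarrow> rate e * v (-e) \<le> (rate e + \<theta> * growth e - \<kappa>) * v e"
    using supersolution_exists[OF mg] by metis
  define V where "V = max (v (-1)) (v 1)"
  have V: "v e \<le> V" if "e \<in> state_index" for e using that by (auto simp: V_def)
  have V0: "0 \<le> V" using *(4)[of 1] by (simp add: V_def)
  have bound: "(\<integral>\<^sup>+ w. ennreal (exp (- (\<theta> * path_growth e w t))) \<partial>holding e) \<le> ennreal (V * exp (- (\<kappa> * t)))"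
    if "e \<in> state_index" "0 \<le> t" for e t
    using exponential_growth_bound[OF *(1,3,4,5) that]
    by (rule order_trans) (use V[OF that(1)] in \<open>auto intro!: ennreal_leI mult_right_mono\<close>)
  define C where "C = (\<lambda>x. (m * \<bar>1 / x - 1\<bar>) powr \<theta>)"
  \<comment> \<open>The cap at 1 provides the dominating function, as \<open>C\<close> may fail to
    be integrable under an invariant measure.\<close>
  define g where "g = (\<lambda>n x. ennreal (min 1 (C x * (V * exp (- (\<kappa> * real n))))))"
  have gm [measurable]: "g n \<in> borel_measurable borel" for n unfolding g_def C_def by measurable
  have compare: "expect ?h t e x \<le> expect ?h t e y + ennreal ((m * \<bar>1 / x - 1 / y\<bar>) powr \<theta> * (V * exp (- (\<kappa> * t))))"
    if e: "e \<in> state_index" and t: "0 \<le> t" and xy: "0 < x" "0 < y" for t e x y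
  proof -
    note [measurable (raw)] = indexed_measurable[of ?h, OF ramp_test_measurable]
    let ?u = "(m * \<bar>1 / x - 1 / y\<bar>) powr \<theta>"
    have "expect ?h t e x \<le> (\<integral>\<^sup>+ w. ?h (chain e w t) (path e w y t) + ennreal ?u * ennreal (exp (- (\<theta> * path_growth e w t))) \<partial>holding e)"
      unfolding expect_def by (intro nn_integral_mono ramp_test_coupling * m xy)
    also have "\<dots> = expect ?h t e y + ennreal ?u * (\<integral>\<^sup>+ w. ennreal (exp (- (\<theta> * path_growth e w t))) \<partial>holding e)"
      unfolding expect_def by (subst nn_integral_add) (auto simp: nn_integral_cmult)
    also have "\<dots> \<le> expect ?h t e y + ennreal ?u * ennreal (V * exp (- (\<kappa> * t)))"
      by (intro add_left_mono mult_left_mono bound e t) simp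
    finally show ?thesis using V0 by (simp add: ennreal_mult)
  qed
  have e1: "expect ?h t e x \<le> 1" for t e x by (rule expect_le_1) (rule ramp_test_le_1)
  have min_ennreal: "a \<le> c + ennreal (min 1 d)" if "a \<le> 1" "a \<le> c + ennreal d" for a c :: ennreal and d
    using that by (cases "d \<le> 1") (auto simp: min_def intro: add_increasing)
  have up: "expect ?h (real n) e x \<le> expect ?h (real n) e 1 + g n x" if "e \<in> state_index" "0 < x" for n e x
    unfolding g_def C_def using compare[OF that(1) _ that(2), of "real n" 1] by (intro min_ennreal e1) simp
  have down: "expect ?h (real n) e 1 \<le> expect ?h (real n) e x + g n x" if "e \<in> state_index" "0 < x" for n e x
    unfolding g_def C_def using compare[OF that(1) _ _ that(2), of "real n" 1] by (intro min_ennreal e1) (simp add: abs_minus_commute)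
  let ?S = "\<lambda>n. ennreal (chain_weight (-1)) * expect ?h (real n) (-1) 1 + ennreal (chain_weight 1) * expect ?h (real n) 1 1"
  have gen: "mean \<nu> ?h \<le> ?S n + (\<integral>\<^sup>+ z. g n (fst z) \<partial>\<nu>)"
      "?S n \<le> mean \<nu> ?h + (\<integral>\<^sup>+ z. g n (fst z) \<partial>\<nu>)"
      "(\<lambda>n. \<integral>\<^sup>+ z. g n (fst z) \<partial>\<nu>) \<longlonglongrightarrow> 0"
    if inv: "invariant \<nu>" "emeasure \<nu> Pos = 1" for \<nu> n
  proof -
    interpret prob_space \<nu> by (rule invariantD(1)[OF inv(1)])
    have S[measurable_cong]: "sets \<nu> = sets state_space" by (rule invariantD(2)[OF inv(1)])
    have PS: "Pos \<in> events" unfolding S by (rule Pos_sets)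
    have AEp: "AE z in \<nu>. z \<in> Pos"
      using inv(2) PS by (subst AE_in_set_eq_1) (auto simp: measure_def)
    have S_eq: "?S n = (\<integral>\<^sup>+ z. expect ?h (real n) (snd z) 1 \<partial>\<nu>)"
      by (rule nn_integral_invariant_index[OF inv(1), symmetric])
    have h_eq: "(mean \<nu> ?h) = mean \<nu> (expect ?h (real n))"
      by (rule invariantD(3)[OF inv(1), symmetric]) auto
    have "mean \<nu> (expect ?h (real n)) \<le> (\<integral>\<^sup>+ z. expect ?h (real n) (snd z) 1 + g n (fst z) \<partial>\<nu>)"
      using AEp by (intro nn_integral_mono_AE) (auto elim!: eventually_mono intro!: up)
    then show "mean \<nu> ?h \<le> ?S n + (\<integral>\<^sup>+ z. g n (fst z) \<partial>\<nu>)"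
      unfolding S_eq h_eq by (subst (asm) nn_integral_add) measurable
    have "(\<integral>\<^sup>+ z. expect ?h (real n) (snd z) 1 \<partial>\<nu>) \<le> (\<integral>\<^sup>+ z. expect ?h (real n) (snd z) (fst z) + g n (fst z) \<partial>\<nu>)"
      using AEp by (intro nn_integral_mono_AE) (auto elim!: eventually_mono intro!: down)
    then show "?S n \<le> mean \<nu> ?h + (\<integral>\<^sup>+ z. g n (fst z) \<partial>\<nu>)"
      unfolding S_eq h_eq by (subst (asm) nn_integral_add) measurable
    have "(\<lambda>n. \<integral>\<^sup>+ z. g n (fst z) \<partial>\<nu>) \<longlonglongrightarrow> (\<integral>\<^sup>+ z. 0 \<partial>\<nu>)"
    proof (rule nn_integral_dominated_convergence[where w = "\<lambda>_. 1"])
      show "AE z in \<nu>. (\<lambda>n. g n (fst z)) \<longlonglongrightarrow> 0"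
      proof (intro AE_I2)
        fix z :: "real \<times> int"
        have "filterlim (\<lambda>n. \<kappa> * real n) at_top sequentially"
          by (intro filterlim_tendsto_pos_mult_at_top[OF tendsto_const *(3)] filterlim_real_sequentially)
        then have "(\<lambda>n. exp (- (\<kappa> * real n))) \<longlonglongrightarrow> 0"
          by (intro filterlim_compose[OF exp_at_bot] filterlim_compose[OF filterlim_uminus_at_bot_at_top])
        then have "(\<lambda>n. min 1 (C (fst z) * (V * exp (- (\<kappa> * real n))))) \<longlonglongrightarrow> min 1 (C (fst z) * (V * 0))"
          by (intro tendsto_intros)
        then show "(\<lambda>n. g n (fst z)) \<longlonglongrightarrow> 0"
          unfolding g_def by (intro tendsto_ennrealI[where x = 0, simplified]) simp
      qed
      show "AE z in \<nu>. g n (fst z) \<le> 1" for n by (auto simp: g_def)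
    qed (use emeasure_space_1 in auto)
    then show "(\<lambda>n. \<integral>\<^sup>+ z. g n (fst z) \<partial>\<nu>) \<longlonglongrightarrow> 0" by simp
  qed
  have lim: "(\<lambda>n. mean \<nu>' ?h + ((\<integral>\<^sup>+ z. g n (fst z) \<partial>\<nu>') + (\<integral>\<^sup>+ z. g n (fst z) \<partial>\<nu>))) \<longlonglongrightarrow>
    mean \<nu>' ?h + (0 + 0)"
    by (intro tendsto_add tendsto_const gen(3) inv inv')
  have "mean \<nu> ?h \<le> mean \<nu>' ?h + (0 + 0)"
  proof (rule tendsto_lowerbound[OF lim])
    show "\<forall>\<^sub>F n in sequentially. mean \<nu> ?h \<le>
      mean \<nu>' ?h + ((\<integral>\<^sup>+ z. g n (fst z) \<partial>\<nu>') + (\<integral>\<^sup>+ z. g n (fst z) \<partial>\<nu>))"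
    proof (intro always_eventually allI)
      fix n
      have "mean \<nu> ?h \<le> ?S n + (\<integral>\<^sup>+ z. g n (fst z) \<partial>\<nu>)" by (rule gen(1)[OF inv])
      also have "\<dots> \<le> (mean \<nu>' ?h + (\<integral>\<^sup>+ z. g n (fst z) \<partial>\<nu>')) + (\<integral>\<^sup>+ z. g n (fst z) \<partial>\<nu>)"
        by (intro add_right_mono gen(2)[OF inv'])
      finally show "mean \<nu> ?h \<le>
        mean \<nu>' ?h + ((\<integral>\<^sup>+ z. g n (fst z) \<partial>\<nu>') + (\<integral>\<^sup>+ z. g n (fst z) \<partial>\<nu>))"
        by (simp add: add.assoc)
    qed
  qed simp
  then show ?thesis by simp
qed

lemma ramp_tendsto: "(\<lambda>n. ramp b (real n) y) \<longlonglongrightarrow> (if y < b then 1 else 0)"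
proof (cases "y < b")
  case True
  obtain N :: nat where N: "1 / (b - y) \<le> real N" using real_arch_simple by blast
  have "\<forall>\<^sub>F n in sequentially. ramp b (real n) y = 1"
    using eventually_ge_at_top[of N]
  proof eventually_elim
    case (elim n)
    then have "1 / (b - y) \<le> real n" using N by linarith
    then have "1 \<le> real n * (b - y)" using True by (simp add: field_simps)
    then show ?case by (simp add: ramp_def)
  qed
  then show ?thesis using True by (simp add: tendsto_eventually)
next
  case False
  then have "real n * (b - y) \<le> 0" for n by (intro mult_nonneg_nonpos) auto
  then have "ramp b (real n) y = 0" for n
    unfolding ramp_def by (smt (verit))
  then show ?thesis using False by simp
qed

text \<open>Ramps at \<open>b = 1 / a\<close> with growing slope yield the masses of the rays
  \<open>x > a\<close> in each state, and these determine the slice of the measure in that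
  state.\<close>

lemma positive_invariant_unique:
  assumes inv: "invariant \<nu>" "emeasure \<nu> Pos = 1"
    and inv': "invariant \<nu>'" "emeasure \<nu>' Pos = 1"
    and mg: "0 < mean_growth"
  shows "\<nu> = \<nu>'"
proof -
  have AEp: "AE z in \<nu>. z \<in> Pos" if "invariant \<nu>" "emeasure \<nu> Pos = 1" for \<nu>
  proof -
    interpret prob_space \<nu> by (rule invariantD(1)[OF that(1)])
    have "Pos \<in> events" unfolding invariantD(2)[OF that(1)] by (rule Pos_sets)
    then show ?thesis using that(2) by (subst AE_in_set_eq_1) (auto simp: measure_def)
  qed
  have lim: "(\<lambda>n. \<integral>\<^sup>+ z. ramp_test i (1 / a) (real n) (snd z) (fst z) \<partial>\<nu>) \<longlonglongrightarrow> emeasure \<nu> {z\<in>space \<nu>. a < fst z \<and> snd z = i}"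
    if inv: "invariant \<nu>" "emeasure \<nu> Pos = 1" and a: "0 < a" for \<nu> i a
  proof -
    interpret prob_space \<nu> by (rule invariantD(1)[OF inv(1)])
    have S[measurable_cong]: "sets \<nu> = sets state_space" by (rule invariantD(2)[OF inv(1)])
    note [measurable (raw)] = indexed_measurable[of "ramp_test _ _ _", OF ramp_test_measurable]
    have "(\<lambda>n. \<integral>\<^sup>+ z. ramp_test i (1 / a) (real n) (snd z) (fst z) \<partial>\<nu>) \<longlonglongrightarrow>
      (\<integral>\<^sup>+ z. indicator {z\<in>space \<nu>. a < fst z \<and> snd z = i} z \<partial>\<nu>)"
    proof (rule nn_integral_dominated_convergence[where w = "\<lambda>_. 1"])
      show "AE z in \<nu>. (\<lambda>n. ramp_test i (1 / a) (real n) (snd z) (fst z)) \<longlonglongrightarrow> indicator {z\<in>space \<nu>. a < fst z \<and> snd z = i} z"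
        using AEp[OF inv] AE_space
      proof eventually_elim
        case (elim z)
        then have x: "0 < fst z" by auto
        have "(\<lambda>n. ennreal (ramp (1 / a) (real n) (1 / fst z))) \<longlonglongrightarrow> ennreal (if 1 / fst z < 1 / a then 1 else 0)"
          by (intro tendsto_ennrealI ramp_tendsto)
        moreover have "1 / fst z < 1 / a \<longleftrightarrow> a < fst z" using x a by (simp add: field_simps)
        ultimately show ?case using elim(2)
          by (cases "snd z = i") (auto simp: ramp_test_def indicator_def)
      qed
    qed (use emeasure_space_1 ramp_test_le_1 in auto)
    then show ?thesis by simp
  qed
  have pos: "emeasure \<nu> {z\<in>space \<nu>. a < fst z \<and> snd z = i} = emeasure \<nu>' {z\<in>space \<nu>'. a < fst z \<and> snd z = i}" if a: "0 < a" for i a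
  proof -
    have "mean \<nu> (ramp_test i (1 / a) (real n)) = mean \<nu>' (ramp_test i (1 / a) (real n))" for n
      using invariant_ramp_le[OF inv inv' mg] invariant_ramp_le[OF inv' inv mg] by (intro antisym) auto
    then show ?thesis using lim[OF inv a, of i] lim[OF inv' a, of i] LIMSEQ_unique by simp
  qed
  \<comment> \<open>For \<open>a \<le> 0\<close> the ray is, up to a null set, the whole slice,
    whose mass is given by the second marginal.\<close>
  have nonpos: "emeasure \<nu> {z\<in>space \<nu>. a < fst z \<and> snd z = i} = emeasure \<nu> {z\<in>space \<nu>. snd z = i}"
    if inv: "invariant \<nu>" "emeasure \<nu> Pos = 1" and a: "a \<le> 0" for \<nu> i a
  proof -
    have [measurable_cong]: "sets \<nu> = sets state_space" by (rule invariantD(2)[OF inv(1)])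
    show ?thesis
      using AEp[OF inv] a by (intro emeasure_eq_AE) (auto elim!: eventually_mono)
  qed
  have ray: "emeasure \<nu> {z\<in>space \<nu>. a < fst z \<and> snd z = i} = emeasure \<nu>' {z\<in>space \<nu>'. a < fst z \<and> snd z = i}" if "i \<in> state_index" for i a
    using pos[of a i] nonpos[OF inv, of a i] nonpos[OF inv', of a i] invariant_index[OF inv(1) that] invariant_index[OF inv'(1) that]
    by (cases "0 < a") auto
  define M where "M = (\<lambda>\<nu> i. distr (density \<nu> (\<lambda>z. indicator {i::int} (snd z))) borel (fst :: real \<times> int \<Rightarrow> real))"
  have M: "emeasure (M \<nu> i) B = emeasure \<nu> {z\<in>space \<nu>. fst z \<in> B \<and> snd z = i}"
    if "sets \<nu> = sets state_space" "B \<in> sets borel" for \<nu> i B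
  proof -
    have [measurable_cong]: "sets \<nu> = sets state_space" by (rule that(1))
    have [measurable]: "B \<in> sets borel" by (rule that(2))
    have "(\<lambda>z. indicator {i} (snd z) :: ennreal) \<in> borel_measurable \<nu>"
    proof (rule measurable_compose[where f = snd and N = "count_space UNIV"])
      show "snd \<in> \<nu> \<rightarrow>\<^sub>M count_space UNIV" by measurable
    qed simp
    then have "emeasure (M \<nu> i) B = (\<integral>\<^sup>+ z. indicator {i} (snd z) * indicator (fst -` B \<inter> space \<nu>) z \<partial>\<nu>)"
      unfolding M_def by (subst emeasure_distr) (auto simp: emeasure_density)
    also have "\<dots> = (\<integral>\<^sup>+ z. indicator {z\<in>space \<nu>. fst z \<in> B \<and> snd z = i} z \<partial>\<nu>)"
      by (intro nn_integral_cong) (auto simp: indicator_def)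
    also have "\<dots> = emeasure \<nu> {z\<in>space \<nu>. fst z \<in> B \<and> snd z = i}" by simp
    finally show ?thesis .
  qed
  note s = invariantD(2)[OF inv(1)] and s' = invariantD(2)[OF inv'(1)]
  interpret p: prob_space \<nu> by (rule invariantD(1)[OF inv(1)])
  have MM: "M \<nu> i = M \<nu>' i" if "i \<in> state_index" for i
  proof (rule measure_eqI_lessThan)
    show "emeasure (M \<nu> i) {x<..} < \<infinity>" for x
      by (simp add: M[OF s] p.emeasure_eq_measure)
    show "emeasure (M \<nu> i) {x<..} = emeasure (M \<nu>' i) {x<..}" for x
      using ray[OF that, of x] by (simp add: M[OF s] M[OF s'])
  qed (simp_all add: M_def)
  have section_eq: "emeasure \<nu> {z\<in>space \<nu>. fst z \<in> B \<and> snd z = i} = emeasure \<nu>' {z\<in>space \<nu>'. fst z \<in> B \<and> snd z = i}"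
    if "B \<in> sets borel" "i \<in> state_index" for B i
    using MM[OF that(2)] M[OF s that(1)] M[OF s' that(1)] by metis
  show ?thesis
  proof (rule measure_eqI)
    show "sets \<nu> = sets \<nu>'" by (simp add: s s')
    fix A assume "A \<in> sets \<nu>"
    then have A: "A \<in> sets state_space" by (simp add: s)
    have split: "emeasure \<nu> A = emeasure \<nu> {z\<in>space \<nu>. fst z \<in> {x. (x, -1) \<in> A} \<and> snd z = -1} + emeasure \<nu> {z\<in>space \<nu>. fst z \<in> {x. (x, 1) \<in> A} \<and> snd z = 1}"
      if s: "sets \<nu> = sets state_space" for \<nu>
    proof -
      have [measurable_cong]: "sets \<nu> = sets state_space" by (rule s)
      have [measurable]: "{x. (x, i) \<in> A} \<in> sets borel" for i by (rule section_borel[OF A])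
      have sp: "space \<nu> = space state_space" using s by (rule sets_eq_imp_space_eq)
      have "emeasure \<nu> {z\<in>space \<nu>. fst z \<in> {x. (x, -1) \<in> A} \<and> snd z = -1} + emeasure \<nu> {z\<in>space \<nu>. fst z \<in> {x. (x, 1) \<in> A} \<and> snd z = 1} =
        emeasure \<nu> ({z\<in>space \<nu>. fst z \<in> {x. (x, -1) \<in> A} \<and> snd z = -1} \<union> {z\<in>space \<nu>. fst z \<in> {x. (x, 1) \<in> A} \<and> snd z = 1})"
        by (intro plus_emeasure) (measurable, auto)
      also have "{z\<in>space \<nu>. fst z \<in> {x. (x, -1) \<in> A} \<and> snd z = -1} \<union> {z\<in>space \<nu>. fst z \<in> {x. (x, 1) \<in> A} \<and> snd z = 1} = A"
        using sets.sets_into_space[OF A] unfolding sp by (fastforce simp: space_state_space)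
      finally show ?thesis by simp
    qed
    show "emeasure \<nu> A = emeasure \<nu>' A"
      unfolding split[OF s] split[OF s'] by (intro arg_cong2[where f = "(+)"] section_eq section_borel[OF A]) auto
  qed
qed

end

section \<open>Existence for positive mean growth\<close>

lemma has_real_derivative_cong_at:
  assumes "(f has_real_derivative D) (at x)" "open S" "x \<in> S" "\<And>y. y \<in> S \<Longrightarrow> f y = g y"
  shows "(g has_real_derivative D) (at x)"
  using has_field_derivative_transform_within_open[OF assms(1-3)] assms(4) by auto

context logistic_switching begin

text \<open>
  In the coordinate \<open>y = 1/x\<close> the flow is affine with vector field \<open>1 - growth e * y\<close>. The
  conditional distribution functions \<open>F e\<close> of the stationary law satisfy
  \<open>F e' * (1 - growth e * y) = rate e * (F (-e) - F e)\<close>. Hence \<open>F 1 - F (-1)\<close> solves a scalar linear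
  equation, with the explicit solution \<open>gap\<close> up to a constant factor.
\<close>

definition gap :: "real \<Rightarrow> real" where
  "gap y = (if y \<le> 1 / pp then 0 else (pp * y - 1) powr (lp / pp) * (1 - pm * y) powr (lm / pm))"

lemma gap_nonneg: "0 \<le> gap y" by (simp add: gap_def)

lemma above_threshold: "1 / pp < y \<longleftrightarrow> 0 < pp * y - 1"
  using pp by (simp add: field_simps)

lemma minus_field_pos: "0 \<le> y \<Longrightarrow> 0 < 1 - pm * y"
  using pm by (smt (verit) mult_nonneg_nonpos2)

lemma threshold_pos: "0 < 1 / pp" using pp by simp

text \<open>Subtracting the equations of the two distribution functions prescribes exactly this
  logarithmic derivative; integrating its two fractions gives the exponents \<open>lp / pp\<close>
  and \<open>lm / pm\<close>.\<close>

lemma gap_deriv: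
  assumes y: "1 / pp < y"
  shows "(gap has_real_derivative gap y * (lp / (pp * y - 1) - lm / (1 - pm * y))) (at y)"
proof -
  have p: "0 < pp * y - 1" using y above_threshold by simp
  have m: "0 < 1 - pm * y" using y threshold_pos by (intro minus_field_pos) linarith
  let ?g = "\<lambda>y. (pp * y - 1) powr (lp / pp) * (1 - pm * y) powr (lm / pm)"
  have "(?g has_real_derivative
     (pp * y - 1) powr (lp / pp) * (lp / (pp * y - 1)) * (1 - pm * y) powr (lm / pm) +
     (pp * y - 1) powr (lp / pp) * ((1 - pm * y) powr (lm / pm) * - (lm / (1 - pm * y)))) (at y)"
    using p m pp pm by (auto intro!: derivative_eq_intros simp: powr_diff mult_ac)
  then have "(?g has_real_derivative gap y * (lp / (pp * y - 1) - lm / (1 - pm * y))) (at y)"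
    using y by (simp add: gap_def algebra_simps)
  then show ?thesis
    by (rule has_real_derivative_cong_at[where S = "{1/pp<..}"]) (use y in \<open>auto simp: gap_def\<close>)
qed

text \<open>Cut-offs give a formula without case distinction: at and below the threshold the base of
  the positive power \<open>lp / pp\<close> is 0, while the base of the negative power stays
  positive.\<close>

lemma gap_continuous: "continuous_on UNIV gap"
proof -
  have pos: "0 < 1 - pm * max 0 y" for y by (rule minus_field_pos) simp
  have c1: "continuous_on UNIV (\<lambda>y. max 0 (pp * y - 1) powr (lp / pp))"
    by (rule continuous_on_powr') (use lp pp in \<open>auto intro!: continuous_intros\<close>)
  have c2: "continuous_on UNIV (\<lambda>y. (1 - pm * max 0 y) powr (lm / pm))"
  proof (rule continuous_on_powr')
    show "\<forall>y\<in>UNIV. 0 \<le> 1 - pm * max 0 y \<and> (1 - pm * max 0 y = 0 \<longrightarrow> 0 < lm / pm)"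
      using pos by (metis less_imp_le less_irrefl)
  qed (auto intro!: continuous_intros)
  have eq: "gap y = max 0 (pp * y - 1) powr (lp / pp) * (1 - pm * max 0 y) powr (lm / pm)" for y
  proof (cases "1 / pp < y")
    case True
    then have "0 < y" "0 < pp * y - 1" using less_trans[OF threshold_pos] above_threshold[of y] by blast+
    then have "max 0 y = y" "max 0 (pp * y - 1) = pp * y - 1" by auto
    then show ?thesis using True by (simp only: gap_def not_le[symmetric] if_False)
  next
    case False
    then have "max 0 (pp * y - 1) = 0" using above_threshold[of y] by simp
    then show ?thesis using False by (simp add: gap_def not_less)
  qed
  show ?thesis unfolding eq[abs_def] by (rule continuous_on_mult[OF c1 c2])
qed

text \<open>\<open>F (-1)\<close> before normalisation, obtained by integrating
  \<open>F' * (1 - pm * y) = lm * gap\<close> from \<open>1 / pp\<close>, the equilibrium of the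
  flow in the state \<open>1\<close>.\<close>

definition base :: "real \<Rightarrow> real" where
  "base y = integral {1 / pp..y} (\<lambda>u. lm * gap u / (1 - pm * u))"

lemma base_integrand_continuous: "continuous_on {1/pp..y} (\<lambda>u. lm * gap u / (1 - pm * u))"
proof -
  have "1 - pm * u \<noteq> 0" if "u \<in> {1/pp..y}" for u
    using minus_field_pos[of u] that threshold_pos by (metis atLeastAtMost_iff less_imp_le less_irrefl order_trans)
  then show ?thesis by (intro continuous_intros continuous_on_subset[OF gap_continuous]) auto
qed

lemma base_below: "y \<le> 1 / pp \<Longrightarrow> base y = 0"
  by (cases "y = 1 / pp") (auto simp: base_def)

lemma base_deriv:
  assumes y: "1 / pp < y"
  shows "(base has_real_derivative lm * gap y / (1 - pm * y)) (at y)"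
proof -
  have "(base has_real_derivative lm * gap y / (1 - pm * y)) (at y within {1/pp..y+1})"
    unfolding base_def[abs_def] using y by (intro integral_has_real_derivative base_integrand_continuous) auto
  then show ?thesis using y by (subst (asm) at_within_Icc_at) auto
qed

lemma base_continuous: "continuous_on UNIV base"
proof -
  have "continuous_on ({..1/pp} \<union> {1/pp..}) base"
  proof (rule continuous_on_closed_Un)
    show "continuous_on {..1/pp} base"
      by (rule continuous_on_eq[of _ "\<lambda>_. 0"]) (auto simp: base_below)
    show "continuous_on {1/pp..} base"
      unfolding continuous_on_eq_continuous_within
    proof
      fix y assume y: "y \<in> {1/pp..}"
      have "continuous_on {1/pp..y+1} base"
        unfolding base_def[abs_def]
        by (intro indefinite_integral_continuous_1 integrable_continuous_real base_integrand_continuous)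
      then have "continuous (at y within {1/pp..y+1}) base"
        using y by (auto simp: continuous_on_eq_continuous_within)
      moreover have "at y within {1/pp..y+1} = at y within {1/pp..}"
        by (rule at_within_nhd[of _ "{y-1<..<y+1}"]) auto
      ultimately show "continuous (at y within {1/pp..}) base" by simp
    qed
  qed auto
  moreover have "{..1/pp} \<union> {1/pp..} = (UNIV :: real set)" by auto
  ultimately show ?thesis by simp
qed

definition primitive :: "int \<Rightarrow> real \<Rightarrow> real" where
  "primitive e y = (if e = -1 then base y else base y + gap y)"

lemma primitive_below: "y \<le> 1 / pp \<Longrightarrow> primitive e y = 0"
  by (simp add: primitive_def base_below gap_def)

lemma primitive_continuous: "continuous_on UNIV (primitive e)"
  unfolding primitive_def[abs_def]
  by (cases "e = -1") (auto intro!: continuous_intros base_continuous gap_continuous)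

lemma field_nonzero: "1 / pp < y \<Longrightarrow> 1 - growth e * y \<noteq> 0"
  using above_threshold[of y] minus_field_pos[of y] threshold_pos by (auto simp: growth_def)

lemma primitive_deriv:
  assumes e: "e \<in> state_index" and y: "1 / pp < y"
  shows "(primitive e has_real_derivative rate e * (primitive (-e) y - primitive e y) / (1 - growth e * y)) (at y)"
proof (cases "e = -1")
  case True
  then show ?thesis using base_deriv[OF y] by (simp add: primitive_def[abs_def] switch_rate_def growth_def)
next
  case False
  then have e1: "e = 1" using e by simp
  have p: "0 < pp * y - 1" using y above_threshold by simp
  have "((\<lambda>y. base y + gap y) has_real_derivative
      lm * gap y / (1 - pm * y) + gap y * (lp / (pp * y - 1) - lm / (1 - pm * y))) (at y)"
    by (intro DERIV_add base_deriv gap_deriv y)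
  also have "lm * gap y / (1 - pm * y) + gap y * (lp / (pp * y - 1) - lm / (1 - pm * y)) = gap y * lp / (pp * y - 1)"
    by (simp add: algebra_simps)
  also have "\<dots> = rate e * (primitive (-e) y - primitive e y) / (1 - growth e * y)"
  proof -
    have "g * l / d = l * (b - (b + g)) / d'" if "d \<noteq> 0" "d' = - d" for g l b d d' :: real
      using that by simp
    from this[of "pp * y - 1" "1 - pp * y"] p show ?thesis
      unfolding e1 by (simp add: primitive_def switch_rate_def growth_def)
  qed
  finally show ?thesis by (simp add: primitive_def[abs_def] e1)
qed

text \<open>The derivative is a quotient of two terms of the same sign: nonnegative over positive in
  the state \<open>-1\<close>, nonpositive over negative in the state \<open>1\<close>.\<close>

lemma primitive_mono: "mono (primitive e)"
proof -
  have key: "primitive e x \<le> primitive e y" if e: "e \<in> state_index" and xy: "1 / pp \<le> x" "x \<le> y" for e x y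
  proof (rule DERIV_nonneg_imp_increasing_open[OF xy(2)])
    fix u assume u: "x < u" "u < y"
    then have p: "1 / pp < u" using xy by simp
    have "0 \<le> rate e * (primitive (-e) u - primitive e u) / (1 - growth e * u)"
    proof (cases "e = -1")
      case True
      then show ?thesis using gap_nonneg[of u] minus_field_pos[of u] p threshold_pos lm
        by (simp add: primitive_def switch_rate_def growth_def)
    next
      case False
      then have "e = 1" using e by simp
      moreover have "1 - pp * u < 0" using p above_threshold[of u] by simp
      ultimately show ?thesis using gap_nonneg[of u] lp
        by (simp add: primitive_def switch_rate_def growth_def divide_nonneg_neg)
    qed
    then show "\<exists>d. (primitive e has_real_derivative d) (at u) \<and> 0 \<le> d"
      using primitive_deriv[OF e p] by blast
  qed (rule continuous_on_subset[OF primitive_continuous], simp)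
  have key': "primitive e x \<le> primitive e y" if "e \<in> state_index" "x \<le> y" for e x y
  proof (cases "1 / pp \<le> x")
    case True then show ?thesis using key that by blast
  next
    case False
    have "primitive e (1/pp) \<le> primitive e (max (1/pp) y)" by (rule key) (use that in auto)
    then show ?thesis using False primitive_below[of x e] primitive_below[of "1/pp" e] primitive_below[of y e]
      by (auto simp: max_def split: if_splits)
  qed
  \<comment> \<open>The definition treats every index other than \<open>-1\<close> like
    \<open>1\<close>, so monotonicity extends to all integers.\<close>
  have "primitive e = primitive (if e = -1 then -1 else 1)" by (auto simp: primitive_def fun_eq_iff)
  then show ?thesis using key'[of "if e = -1 then -1 else 1"] by (auto simp: mono_def)
qed

text \<open>The base \<open>1 - pm * y\<close> is bounded from below by \<open>- pm * y\<close>, the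
  right direction for the negative exponent \<open>lm / pm\<close>. The total exponent
  \<open>lp / pp + lm / pm\<close> is negative exactly for positive mean growth.\<close>

lemma gap_power_bound:
  assumes y: "1 / pp < y"
  shows "gap y \<le> pp powr (lp / pp) * (- pm) powr (lm / pm) * y powr (lp / pp + lm / pm)"
proof -
  have y0: "0 < y" using y threshold_pos by linarith
  have p: "0 < pp * y - 1" using y above_threshold by simp
  have "(pp * y - 1) powr (lp / pp) \<le> (pp * y) powr (lp / pp)"
    using p lp pp by (intro powr_mono2) auto
  moreover have "(1 - pm * y) powr (lm / pm) \<le> (- pm * y) powr (lm / pm)"
    using pm lm y0 by (intro powr_mono2') (auto simp: divide_nonneg_neg mult_neg_pos)
  ultimately have "gap y \<le> (pp * y) powr (lp / pp) * (- pm * y) powr (lm / pm)"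
    using y by (simp add: gap_def mult_mono)
  also have "\<dots> = pp powr (lp / pp) * (- pm) powr (lm / pm) * y powr (lp / pp + lm / pm)"
    using pp pm y0 powr_mult[of pp y "lp / pp"] powr_mult[of "- pm" y "lm / pm"]
    by (simp add: powr_add mult_ac)
  finally show ?thesis .
qed

section \<open>Normalisation for positive mean growth\<close>

context
  assumes mg: "0 < mean_growth"
begin

definition decay :: real where "decay = - (lp / pp + lm / pm)"

lemma decay_pos: "0 < decay"
  using mg mean_growth_le_0_iff by (simp add: decay_def)

lemma gap_tendsto: "(gap \<longlongrightarrow> 0) at_top"
proof (rule tendsto_sandwich[of "\<lambda>_. 0"])
  show "\<forall>\<^sub>F y in at_top. gap y \<le> pp powr (lp / pp) * (- pm) powr (lm / pm) * y powr (- decay)"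
    using eventually_gt_at_top[of "1/pp"] by eventually_elim (use gap_power_bound in \<open>simp only: decay_def minus_minus\<close>)
  have "((\<lambda>y. y powr (- decay)) \<longlongrightarrow> 0) at_top"
    using decay_pos by (intro tendsto_neg_powr filterlim_ident) auto
  then show "((\<lambda>y. pp powr (lp / pp) * (- pm) powr (lm / pm) * y powr (- decay)) \<longlongrightarrow> 0) at_top"
    by (rule tendsto_mult_right_zero)
qed (auto simp: gap_nonneg)

text \<open>The integrand of \<open>base\<close> is at most \<open>C * u powr (- decay - 1)\<close>.
  Adding \<open>C / decay * y powr (- decay)\<close>, whose derivative is the negative of this
  bound, makes \<open>K\<close> decreasing.\<close>

lemma base_bounded: "\<exists>B. \<forall>y. base y \<le> B"
proof -
  define C where "C = lm / (- pm) * (pp powr (lp / pp) * (- pm) powr (lm / pm))"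
  have C: "0 \<le> C" using lm pm by (simp add: C_def divide_nonneg_neg)
  define K where "K = (\<lambda>y. base y + C / decay * y powr (- decay))"
  have "base y \<le> C / decay * (1/pp) powr (- decay)" if y: "1/pp \<le> y" for y
  proof -
    have "K y \<le> K (1/pp)"
    proof (rule DERIV_nonpos_imp_decreasing_open[OF y])
      fix u assume u: "1/pp < u" "u < y"
      have u0: "0 < u" using u threshold_pos by linarith
      have "(K has_real_derivative lm * gap u / (1 - pm * u) - C * u powr (- decay - 1)) (at u)"
        unfolding K_def using decay_pos u0
        by (auto intro!: derivative_eq_intros base_deriv u)
      moreover have "lm * gap u / (1 - pm * u) \<le> C * u powr (- decay - 1)"
      proof -
        have "lm * gap u / (1 - pm * u) \<le> lm * gap u / (- pm * u)"
        proof (intro divide_left_mono mult_pos_pos)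
          show "0 < - pm" "0 < u" using pm u0 by auto
          show "0 < 1 - pm * u" using u0 by (intro minus_field_pos) simp
        qed (use lm gap_nonneg[of u] in auto)
        also have "\<dots> = lm / (- pm) * gap u / u" using pm u0 by (simp add: field_simps)
        also have "\<dots> \<le> lm / (- pm) * (pp powr (lp / pp) * (- pm) powr (lm / pm) * u powr (- decay)) / u"
        proof (intro divide_right_mono mult_left_mono)
          show "gap u \<le> pp powr (lp / pp) * (- pm) powr (lm / pm) * u powr (- decay)"
            using gap_power_bound[OF u(1)] by (simp only: decay_def minus_minus)
        qed (use pm lm u0 in \<open>auto simp: divide_nonneg_neg\<close>)
        also have "\<dots> = C * u powr (- decay - 1)"
          using u0 by (simp add: C_def powr_diff)
        finally show ?thesis .
      qed
      ultimately show "\<exists>d. (K has_real_derivative d) (at u) \<and> d \<le> 0" by force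
    next
      show "continuous_on {1/pp..y} K"
        unfolding K_def using threshold_pos
        by (intro continuous_intros continuous_on_subset[OF base_continuous]) (auto, linarith?)
    qed
    moreover have "base y \<le> K y" using C decay_pos by (simp add: K_def)
    ultimately show ?thesis by (simp add: K_def base_below)
  qed
  moreover have "base y \<le> C / decay * (1/pp) powr (- decay)" if "\<not> 1/pp \<le> y" for y
    using base_below[of y] that C decay_pos by simp
  ultimately show ?thesis by blast
qed

text \<open>As \<open>gap\<close> tends to 0, this is the limit of both primitives, so one constant
  normalises both states.\<close>

definition total :: real where "total = Sup (range base)"

lemma base_mono: "mono base"
  using primitive_mono[of "-1"] by (simp add: primitive_def[abs_def])

lemma base_tendsto: "(base \<longlongrightarrow> total) at_top"
proof (rule order_tendstoI)
  have bdd: "bdd_above (range base)" using base_bounded by (auto simp: bdd_above_def)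
  fix a
  show "\<forall>\<^sub>F y in at_top. base y < a" if "total < a"
  proof (intro always_eventually allI)
    fix y
    have "base y \<le> total" unfolding total_def using bdd by (intro cSUP_upper) auto
    then show "base y < a" using that by simp
  qed
  show "\<forall>\<^sub>F y in at_top. a < base y" if "a < total"
  proof -
    have "\<exists>x\<in>range base. a < x"
      using that bdd less_cSup_iff[of "range base" a] unfolding total_def by blast
    then obtain y0 where "a < base y0" by blast
    then show ?thesis
      using monoD[OF base_mono] by (intro eventually_mono[OF eventually_ge_at_top[of y0]]) (blast intro: less_le_trans)
  qed
qed

lemma total_pos: "0 < total"
proof -
  obtain a b where ab: "1 / pp < a" "a < b" using dense gt_ex by metis
  have "base a < base b"
  proof (rule DERIV_pos_imp_increasing_open[OF ab(2)])
    fix u assume u: "a < u" "u < b"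
    then have p: "1 / pp < u" using ab by simp
    then have "0 < gap u" using above_threshold[of u] minus_field_pos[of u] threshold_pos
      by (auto simp: gap_def)
    then have "0 < lm * gap u / (1 - pm * u)" using lm minus_field_pos[of u] p threshold_pos by simp
    then show "\<exists>d. (base has_real_derivative d) (at u) \<and> 0 < d" using base_deriv[OF p] by blast
  qed (rule continuous_on_subset[OF base_continuous], simp)
  also have "base b \<le> total"
    unfolding total_def using base_bounded by (intro cSUP_upper) (auto simp: bdd_above_def)
  finally show ?thesis
    using monoD[OF base_mono, of "1/pp" a] base_below[of "1/pp"] ab by simp
qed

end

section \<open>Distribution functions along the backward flow\<close>

definition pull :: "int \<Rightarrow> real \<Rightarrow> real \<Rightarrow> real" where
  "pull e s b = exp (growth e * s) * b - mass (growth e) s"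

lemma pull_0 [simp]: "pull e 0 b = b" by (simp add: pull_def mass_def)

lemma one_minus_pull: "1 - growth e * pull e s b = exp (growth e * s) * (1 - growth e * b)"
  using growth_nonzero[of e] by (simp add: pull_def mass_def field_simps)

text \<open>\<open>pull e s\<close> runs the field \<open>1 - growth e * y\<close> backwards for the
  time \<open>s\<close>; it is the inverse of \<open>fwd e s\<close>.\<close>

lemma pull_deriv: "((\<lambda>s. pull e s b) has_real_derivative - (1 - growth e * pull e s b)) (at s)"
proof -
  have "((\<lambda>s. pull e s b) has_real_derivative exp (growth e * s) * growth e * b - exp (growth e * s) * growth e / growth e) (at s)"
    unfolding pull_def[abs_def] mass_def
    by (auto intro!: derivative_eq_intros simp: growth_nonzero)
  then show ?thesis unfolding one_minus_pull using growth_nonzero[of e] by (simp add: algebra_simps)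
qed

lemma pull_continuous: "continuous_on A (\<lambda>s. pull e s b)"
  by (rule DERIV_continuous_on) (rule DERIV_subset[OF pull_deriv subset_UNIV])

text \<open>Away from the equilibrium an orbit is injective in time and meets each level at most
  once. The level in question is \<open>1 / pp\<close>, where \<open>F\<close> may fail to be
  differentiable.\<close>

lemma pull_threshold:
  assumes "growth e * b \<noteq> 1"
  shows "finite {s. pull e s b = c}"
proof -
  have "inj_on (\<lambda>s. pull e s b) UNIV"
  proof (rule inj_onI)
    fix s t assume "pull e s b = pull e t b"
    then have "exp (growth e * s) * (1 - growth e * b) = exp (growth e * t) * (1 - growth e * b)"
      unfolding one_minus_pull[symmetric] by (simp only:)
    moreover have "1 - growth e * b \<noteq> 0" using assms by simp
    ultimately have "exp (growth e * s) = exp (growth e * t)" 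
      using mult_right_cancel[of "1 - growth e * b"] by blast
    then have "growth e * s = growth e * t" by (simp only: exp_inj_iff)
    then show "s = t" by (simp only: mult_left_cancel[OF growth_nonzero])
  qed
  then have "finite ((\<lambda>s. pull e s b) -` {c} \<inter> UNIV)" by (intro finite_vimage_IntI) auto
  then show ?thesis by (simp add: vimage_def)
qed

context
  assumes mg: "0 < mean_growth"
begin

definition F :: "int \<Rightarrow> real \<Rightarrow> real" where "F e y = primitive e y / total"

lemma F_below: "y \<le> 1 / pp \<Longrightarrow> F e y = 0" by (simp add: F_def primitive_below)

lemma F_continuous: "continuous_on UNIV (F e)"
  unfolding F_def[abs_def] using total_pos[OF mg]
  by (intro continuous_on_divide primitive_continuous continuous_on_const) auto

lemma F_mono: "x \<le> y \<Longrightarrow> F e x \<le> F e y"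
  unfolding F_def using total_pos[OF mg] monoD[OF primitive_mono, of x y e] by (simp add: divide_right_mono)

lemma F_deriv:
  assumes "e \<in> state_index" "1 / pp < y"
  shows "(F e has_real_derivative rate e * (F (-e) y - F e y) / (1 - growth e * y)) (at y)"
  using DERIV_cdivide[OF primitive_deriv[OF assms], of total]
  by (simp add: F_def[abs_def] diff_divide_distrib algebra_simps)

lemma F_tendsto_top: "(F e \<longlongrightarrow> 1) at_top"
proof -
  have "(primitive e \<longlongrightarrow> total) at_top"
    using base_tendsto[OF mg] tendsto_add[OF base_tendsto[OF mg] gap_tendsto[OF mg]]
    by (cases "e = -1") (auto simp: primitive_def[abs_def])
  then have "(F e \<longlongrightarrow> total / total) at_top"
    unfolding F_def[abs_def] using total_pos[OF mg] by (intro tendsto_intros) auto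
  then show ?thesis using total_pos[OF mg] by simp
qed

lemma F_tendsto_bot: "(F e \<longlongrightarrow> 0) at_bot"
  by (rule tendsto_eventually) (auto intro!: eventually_mono[OF eventually_le_at_bot[of "1/pp"]] F_below)

text \<open>Method of characteristics: along the backward flow the equation of \<open>F e\<close>
  says that \<open>- exp (- (rate e * s)) * F e\<close> has derivative
  \<open>rate e * exp (- (rate e * s)) * F (-e)\<close>.\<close>

lemma F_stationary:
  assumes e: "e \<in> state_index" and t: "0 \<le> t"
  shows "((\<lambda>s. rate e * exp (- (rate e * s)) * F (-e) (pull e s b)) has_integral
    (F e b - exp (- (rate e * t)) * F e (pull e t b))) {0..t}"
proof (cases "growth e * b = 1")
  case True
  \<comment> \<open>At the equilibrium the orbit is constant, and it lies at or below the threshold,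
    where \<open>F\<close> vanishes in both states.\<close>
  then have b: "b = 1 / growth e" using growth_nonzero[of e] by (simp add: field_simps)
  have "1 / pm < 0" using pm by simp
  then have "1 / pm \<le> 1 / pp" using threshold_pos by linarith
  then have "b \<le> 1 / pp" unfolding b growth_def by simp
  moreover have "pull e s b = b" for s
  proof -
    have "1 - growth e * pull e s b = 0" using one_minus_pull[of e s b] True by simp
    then have "growth e * pull e s b = growth e * b" using True by simp
    then show ?thesis using growth_nonzero[of e] by simp
  qed
  ultimately show ?thesis by (simp add: F_below)
next
  case False
  have "((\<lambda>s. rate e * exp (- (rate e * s)) * F (-e) (pull e s b)) has_integral
    (- (exp (- (rate e * t)) * F e (pull e t b)) - - (exp (- (rate e * 0)) * F e (pull e 0 b)))) {0..t}"
  proof (rule fundamental_theorem_of_calculus_interior_strong[OF pull_threshold[OF False, of "1 / pp"] t])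
    show "continuous_on {0..t} (\<lambda>s. - (exp (- (rate e * s)) * F e (pull e s b)))"
      using continuous_on_compose2[OF F_continuous[of e] pull_continuous[of "{0..t}" e b]]
      by (intro continuous_intros) auto
    fix s assume "s \<in> {0<..<t} - {s. pull e s b = 1 / pp}"
    then have ne: "pull e s b \<noteq> 1 / pp" by simp
    have "((\<lambda>s. F e (pull e s b)) has_real_derivative - (rate e * (F (-e) (pull e s b) - F e (pull e s b)))) (at s)"
    proof (cases "1 / pp < pull e s b")
      case True
      have "rate e * (F (-e) (pull e s b) - F e (pull e s b)) / (1 - growth e * pull e s b) * - (1 - growth e * pull e s b) =
        - (rate e * (F (-e) (pull e s b) - F e (pull e s b)))"
        using field_nonzero[OF True, of e]
        by (simp only: mult_minus_right times_divide_eq_left nonzero_mult_div_cancel_right not_False_eq_True)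
      then show ?thesis
        using DERIV_chain2[OF F_deriv[OF e True] pull_deriv[of e b s]] by (simp only:)
    next
      \<comment> \<open>Below the threshold \<open>F\<close> vanishes near the orbit point in both
        states, so both sides of the equation are 0.\<close>
      case False
      then have lt: "pull e s b < 1 / pp" using ne by simp
      have "isCont (\<lambda>s. pull e s b) s" using pull_deriv by (rule DERIV_isCont)
      then have "\<forall>\<^sub>F u in at s. pull e u b < 1 / pp"
        using lt by (auto simp: isCont_def intro: order_tendstoD(2))
      then have "\<forall>\<^sub>F u in nhds s. F e (pull e u b) = 0"
        using lt by (auto simp: eventually_nhds_conv_at F_below elim!: eventually_mono)
      then have "((\<lambda>s. F e (pull e s b)) has_real_derivative 0) (at s)"
        by (subst DERIV_cong_ev[OF refl _ refl]) auto
      then show ?thesis using lt by (simp add: F_below)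
    qed
    then have "((\<lambda>s. - (exp (- (rate e * s)) * F e (pull e s b))) has_real_derivative
       rate e * exp (- (rate e * s)) * F (-e) (pull e s b)) (at s)"
      by (auto intro!: derivative_eq_intros simp: algebra_simps)
    then show "((\<lambda>s. - (exp (- (rate e * s)) * F e (pull e s b))) has_vector_derivative
       rate e * exp (- (rate e * s)) * F (-e) (pull e s b)) (at s)"
      by (simp add: has_real_derivative_iff_has_vector_derivative)
  qed
  then show ?thesis by simp
qed

section \<open>Conditional laws of 1/x given the state\<close>

definition law :: "int \<Rightarrow> real measure" where "law e = interval_measure (F e)"

lemma F_right_continuous: "continuous (at_right a) (F e)"
  using F_continuous[of e] by (simp add: continuous_on_eq_continuous_within continuous_at_imp_continuous_at_within)

lemma real_distribution_law: "real_distribution (law e)"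
  unfolding law_def
  by (intro real_distribution_interval_measure F_mono F_right_continuous F_tendsto_bot F_tendsto_top)

lemma cdf_law: "cdf (law e) = F e"
  unfolding law_def by (intro cdf_interval_measure F_mono F_right_continuous F_tendsto_bot)

lemma prob_space_law: "prob_space (law e)"
  using real_distribution_law by (simp add: real_distribution_def)

lemma sets_law [simp, measurable_cong]: "sets (law e) = sets borel"
  by (simp add: law_def)

lemma space_law [simp]: "space (law e) = UNIV"
  by (simp add: law_def)

lemma emeasure_law: "emeasure (law e) {..b} = ennreal (F e b)"
proof -
  interpret prob_space "law e" by (rule prob_space_law)
  show ?thesis using cdf_law[of e] by (simp add: emeasure_eq_measure cdf_def fun_eq_iff)
qed

lemma AE_law: "AE y in law e. 1 / pp < y"
proof -
  have "emeasure (law e) {..1/pp} = 0" by (simp add: emeasure_law F_below)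
  then have "{..1/pp} \<in> null_sets (law e)" by (auto simp: null_sets_def)
  from AE_not_in[OF this] show ?thesis by eventually_elim simp
qed

definition fwd :: "int \<Rightarrow> real \<Rightarrow> real \<Rightarrow> real" where
  "fwd e s y = exp (- (growth e * s)) * (y + mass (growth e) s)"

lemma fwd_le_iff: "fwd e s y \<le> b \<longleftrightarrow> y \<le> pull e s b"
proof -
  have "fwd e s y \<le> b \<longleftrightarrow> exp (growth e * s) * fwd e s y \<le> exp (growth e * s) * b" by simp
  also have "exp (growth e * s) * fwd e s y = y + mass (growth e) s"
    by (simp add: fwd_def exp_minus)
  finally show ?thesis by (simp add: pull_def le_diff_eq)
qed

lemma fwd_measurable [measurable]:
  assumes [measurable]: "f \<in> borel_measurable M" "g \<in> borel_measurable M"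
  shows "(\<lambda>x. fwd e (f x) (g x)) \<in> borel_measurable M"
  unfolding fwd_def mass_def by measurable

text \<open>
  The stationarity equation says that \<open>law e\<close> is the law of a point moved along the flow of \<open>e\<close>
  for the time \<open>min S t\<close>, with \<open>S\<close> exponential, started from \<open>law e\<close> if \<open>S > t\<close> and from
  \<open>law (-e)\<close> otherwise.
\<close>

lemma law_stationary:
  assumes e: "e \<in> state_index" and t: "0 \<le> t" and k [measurable]: "k \<in> borel_measurable borel"
  shows "ennreal (exp (- (rate e * t))) * (\<integral>\<^sup>+ y. k (fwd e t y) \<partial>law e) +
    (\<integral>\<^sup>+ s. indicator {0..t} s * (weight e s * (\<integral>\<^sup>+ y. k (fwd e s y) \<partial>law (-e))) \<partial>lborel) = (\<integral>\<^sup>+ y. k y \<partial>law e)"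
proof -
  interpret N: prob_space "law i" for i by (rule prob_space_law)
  let ?E = "density lborel (exponential_density (rate e))"
  interpret E: prob_space ?E by (rule prob_space_exponential_density) (rule rate_pos)
  let ?R = "law e \<Otimes>\<^sub>M law (-e)"
  interpret R: pair_prob_space "law e" "law (-e)" ..
  interpret ER: pair_prob_space ?E ?R ..
  \<comment> \<open>The moved point as a random variable of the holding time and of one independent
    starting point from each law. Its law \<open>D\<close> is a probability measure, so it can be
    identified through its distribution function.\<close>
  define \<phi> where "\<phi> = (\<lambda>p::real \<times> real \<times> real. if t < fst p then fwd e t (fst (snd p)) else fwd e (fst p) (snd (snd p)))"
  have \<phi> [measurable]: "\<phi> \<in> ?E \<Otimes>\<^sub>M ?R \<rightarrow>\<^sub>M borel" unfolding \<phi>_def by measurable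
  define D where "D = distr (?E \<Otimes>\<^sub>M ?R) borel \<phi>"
  have D: "(\<integral>\<^sup>+ y. g y \<partial>D) = ennreal (exp (- (rate e * t))) * (\<integral>\<^sup>+ y. g (fwd e t y) \<partial>law e) +
    (\<integral>\<^sup>+ s. indicator {0..t} s * (weight e s * (\<integral>\<^sup>+ y. g (fwd e s y) \<partial>law (-e))) \<partial>lborel)"
    if [measurable]: "g \<in> borel_measurable borel" for g
  proof -
    have "(\<integral>\<^sup>+ y. g y \<partial>D) = (\<integral>\<^sup>+ p. g (\<phi> p) \<partial>(?E \<Otimes>\<^sub>M ?R))"
      unfolding D_def by (rule nn_integral_distr) measurable
    also have "\<dots> = (\<integral>\<^sup>+ s. \<integral>\<^sup>+ q. g (\<phi> (s, q)) \<partial>?R \<partial>?E)"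
      by (rule R.P.nn_integral_fst[symmetric]) measurable
    also have "\<dots> = (\<integral>\<^sup>+ s. ennreal (exponential_density (rate e) s) * (\<integral>\<^sup>+ q. g (\<phi> (s, q)) \<partial>?R) \<partial>lborel)"
      by (rule nn_integral_density) measurable
    also have "\<dots> = (\<integral>\<^sup>+ s. weight e s * indicator {t..} s * (\<integral>\<^sup>+ y. g (fwd e t y) \<partial>law e) +
        indicator {0..t} s * (weight e s * (\<integral>\<^sup>+ y. g (fwd e s y) \<partial>law (-e))) \<partial>lborel)"
    proof (rule nn_integral_cong_AE)
      show "AE s in lborel. ennreal (exponential_density (rate e) s) * (\<integral>\<^sup>+ q. g (\<phi> (s, q)) \<partial>?R) =
        weight e s * indicator {t..} s * (\<integral>\<^sup>+ y. g (fwd e t y) \<partial>law e) +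
        indicator {0..t} s * (weight e s * (\<integral>\<^sup>+ y. g (fwd e s y) \<partial>law (-e)))"
        using AE_lborel_singleton[of t]
      proof eventually_elim
        case (elim s)
        have "(\<integral>\<^sup>+ q. g (\<phi> (s, q)) \<partial>?R) = (\<integral>\<^sup>+ a. \<integral>\<^sup>+ c. g (\<phi> (s, a, c)) \<partial>law (-e) \<partial>law e)"
          by (rule N.nn_integral_fst[symmetric]) measurable
        also have "\<dots> = (if t < s then (\<integral>\<^sup>+ y. g (fwd e t y) \<partial>law e) else (\<integral>\<^sup>+ y. g (fwd e s y) \<partial>law (-e)))"
          using N.emeasure_space_1 by (simp add: \<phi>_def)
        finally have i: "(\<integral>\<^sup>+ q. g (\<phi> (s, q)) \<partial>?R) = \<dots>" .
        have w: "ennreal (exponential_density (rate e) s) = (if s < 0 then 0 else weight e s)"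
          by (simp add: exponential_density_def weight_def mult.commute)
        show ?case unfolding i w using elim t by (auto simp: indicator_def)
      qed
    qed
    also have "\<dots> = (\<integral>\<^sup>+ s. weight e s * indicator {t..} s \<partial>lborel) * (\<integral>\<^sup>+ y. g (fwd e t y) \<partial>law e) +
      (\<integral>\<^sup>+ s. indicator {0..t} s * (weight e s * (\<integral>\<^sup>+ y. g (fwd e s y) \<partial>law (-e))) \<partial>lborel)"
    proof (subst nn_integral_add)
      show "(\<lambda>s. weight e s * indicator {t..} s * (\<integral>\<^sup>+ y. g (fwd e t y) \<partial>law e)) \<in> borel_measurable lborel" by measurable
      show "(\<lambda>s. indicator {0..t} s * (weight e s * (\<integral>\<^sup>+ y. g (fwd e s y) \<partial>law (-e)))) \<in> borel_measurable lborel" by measurable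
    qed (simp add: nn_integral_multc)
    finally show ?thesis unfolding weight_def nn_integral_exponential_tail[OF rate_pos t] .
  qed
  have "D = law e"
  proof (rule cdf_unique)
    interpret D: prob_space D unfolding D_def by (rule ER.prob_space_distr) (rule \<phi>)
    show "real_distribution D"
      by unfold_locales (simp_all add: D_def)
    show "real_distribution (law e)" by (rule real_distribution_law)
    show "cdf D = cdf (law e)"
    proof
      fix b
      have ib: "(\<integral>\<^sup>+ y. indicator {..b} (fwd e s y) \<partial>law i) = ennreal (F i (pull e s b))" for i s
      proof -
        have "(\<integral>\<^sup>+ y. indicator {..b} (fwd e s y) \<partial>law i) = (\<integral>\<^sup>+ y. indicator {..pull e s b} y \<partial>law i)"
          by (intro nn_integral_cong) (simp add: indicator_def fwd_le_iff)
        then show ?thesis by (simp add: emeasure_law)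
      qed
      have F0: "0 \<le> F i y" for i y
        using cdf_law[of i] by (simp add: fun_eq_iff cdf_def) (metis measure_nonneg)
      have "emeasure D {..b} = (\<integral>\<^sup>+ y. indicator {..b} y \<partial>D)" by (simp add: D_def)
      also have "\<dots> = ennreal (exp (- (rate e * t))) * ennreal (F e (pull e t b)) +
        (\<integral>\<^sup>+ s. indicator {0..t} s * (weight e s * ennreal (F (-e) (pull e s b))) \<partial>lborel)"
        by (subst D) (auto simp: ib)
      also have "(\<integral>\<^sup>+ s. indicator {0..t} s * (weight e s * ennreal (F (-e) (pull e s b))) \<partial>lborel) =
        (\<integral>\<^sup>+ s. ennreal (rate e * exp (- (rate e * s)) * F (-e) (pull e s b)) * indicator {0..t} s \<partial>lborel)"
        unfolding weight_def using rate_pos[of e] F0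
        by (intro nn_integral_cong) (simp add: ennreal_mult mult.commute)
      also have "\<dots> = ennreal (F e b - exp (- (rate e * t)) * F e (pull e t b))"
        using F_stationary[OF e t, of b] rate_pos[of e] F0 by (intro nn_integral_has_integral_lebesgue') auto
      also have "ennreal (exp (- (rate e * t))) * ennreal (F e (pull e t b)) + \<dots> = ennreal (F e b)"
      proof -
        have "0 \<le> F e b - exp (- (rate e * t)) * F e (pull e t b)"
          using F_stationary[OF e t, of b] rate_pos[of e] F0 by (intro has_integral_nonneg[OF F_stationary[OF e t]]) auto
        then show ?thesis using F0 by (simp add: ennreal_mult[symmetric] ennreal_plus[symmetric] del: ennreal_plus)
      qed
      finally show "cdf D b = cdf (law e) b"
        unfolding cdf_law using F0 by (simp add: cdf_def measure_def)
    qed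
  qed
  then show ?thesis using D[OF k] by simp
qed

text \<open>The mixture as a \<open>distr\<close>: a point is drawn from each law and the state
  selects one of them. The absolute value keeps the result in \<open>[0,\<infinity>)\<close> for
  every sample point and almost surely has no effect.\<close>

definition stationary :: "(real \<times> int) measure" where
  "stationary = distr (point_measure state_index (\<lambda>i. ennreal (chain_weight i)) \<Otimes>\<^sub>M (law (-1) \<Otimes>\<^sub>M law 1)) state_space
     (\<lambda>p. (\<bar>1 / (if fst p = -1 then fst (snd p) else snd (snd p))\<bar>, fst p))"

lemma sets_stationary: "sets stationary = sets state_space"
  by (simp add: stationary_def)

lemma nn_integral_stationary:
  fixes h :: "int \<Rightarrow> real \<Rightarrow> ennreal"
  assumes h [measurable]: "\<And>i. h i \<in> borel_measurable borel"
  shows "mean stationary h = (\<Sum>e\<in>state_index. ennreal (chain_weight e) * (\<integral>\<^sup>+ y. h e \<bar>1 / y\<bar> \<partial>law e))"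
proof -
  note [measurable (raw)] = indexed_measurable[OF h]
  interpret N: prob_space "law i" for i by (rule prob_space_law)
  let ?Q = "point_measure state_index (\<lambda>i. ennreal (chain_weight i))"
  let ?R = "law (-1) \<Otimes>\<^sub>M law 1"
  interpret R: pair_prob_space "law (-1)" "law 1" ..
  let ?f = "\<lambda>p. (\<bar>1 / (if fst p = -1 then fst (snd p) else snd (snd p))\<bar>, fst p)"
  have fstm: "fst \<in> ?Q \<Otimes>\<^sub>M ?R \<rightarrow>\<^sub>M count_space UNIV"
    by (rule measurable_compose[OF measurable_fst]) simp
  note [measurable] = fstm
  have fm [measurable]: "?f \<in> ?Q \<Otimes>\<^sub>M ?R \<rightarrow>\<^sub>M state_space"
    by (intro pair_in_state_space fstm) (measurable, auto simp: space_pair_measure space_point_measure)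
  have "mean stationary h = (\<integral>\<^sup>+ p. h (snd (?f p)) (fst (?f p)) \<partial>(?Q \<Otimes>\<^sub>M ?R))"
    unfolding stationary_def by (rule nn_integral_distr) measurable
  also have "\<dots> = (\<integral>\<^sup>+ e. \<integral>\<^sup>+ q. h (snd (?f (e, q))) (fst (?f (e, q))) \<partial>?R \<partial>?Q)"
    by (rule R.P.nn_integral_fst[symmetric]) measurable
  also have "\<dots> = (\<Sum>e\<in>state_index. ennreal (chain_weight e) * (\<integral>\<^sup>+ q. h (snd (?f (e, q))) (fst (?f (e, q))) \<partial>?R))"
    by (rule nn_integral_point_measure_finite) auto
  also have "\<dots> = (\<Sum>e\<in>state_index. ennreal (chain_weight e) * (\<integral>\<^sup>+ y. h e \<bar>1 / y\<bar> \<partial>law e))"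
  proof (intro sum.cong refl arg_cong2[where f = "(*)"])
    fix e :: int assume e: "e \<in> state_index"
    have "(\<integral>\<^sup>+ q. h (snd (?f (e, q))) (fst (?f (e, q))) \<partial>?R) = (\<integral>\<^sup>+ a. \<integral>\<^sup>+ c. h e \<bar>1 / (if e = -1 then a else c)\<bar> \<partial>law 1 \<partial>law (-1))"
    proof -
      have "(\<integral>\<^sup>+ q. h (snd (?f (e, q))) (fst (?f (e, q))) \<partial>?R) = (\<integral>\<^sup>+ q. h e \<bar>1 / (if e = -1 then fst q else snd q)\<bar> \<partial>?R)"
        by (simp only: fst_conv snd_conv)
      also have "\<dots> = (\<integral>\<^sup>+ a. \<integral>\<^sup>+ c. h e \<bar>1 / (if e = -1 then fst (a, c) else snd (a, c))\<bar> \<partial>law 1 \<partial>law (-1))"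
        by (rule N.nn_integral_fst[symmetric]) measurable
      finally show ?thesis by (simp only: fst_conv snd_conv)
    qed
    also have "\<dots> = (\<integral>\<^sup>+ y. h e \<bar>1 / y\<bar> \<partial>law e)"
      using e N.emeasure_space_1 by (cases "e = -1") auto
    finally show "(\<integral>\<^sup>+ q. h (snd (?f (e, q))) (fst (?f (e, q))) \<partial>?R) = (\<integral>\<^sup>+ y. h e \<bar>1 / y\<bar> \<partial>law e)" .
  qed
  finally show ?thesis .
qed

lemma prob_space_stationary: "prob_space stationary"
proof
  interpret N: prob_space "law i" for i by (rule prob_space_law)
  have "mean stationary (\<lambda>i x. 1 :: ennreal) = (\<Sum>e\<in>state_index. ennreal (chain_weight e) * (\<integral>\<^sup>+ y. 1 \<partial>law e))"
    by (rule nn_integral_stationary) auto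
  also have "\<dots> = 1" using N.emeasure_space_1 by (simp add: ennreal_chain_weight_sum)
  finally show "emeasure stationary (space stationary) = 1" by simp
qed

text \<open>The affine form of the flow in \<open>1/x\<close>, for a single leg.\<close>

lemma leg_inverse:
  assumes "0 < y" "0 \<le> s" shows "leg e s \<bar>1 / y\<bar> = \<bar>1 / fwd e s y\<bar>"
proof -
  have m: "0 \<le> mass (growth e) s" using mass_nonneg[OF growth_nonzero assms(2)] .
  have "leg e s \<bar>1 / y\<bar> = exp (growth e * s) / (y + mass (growth e) s)"
    using assms m by (simp add: leg_def flow_def field_simps)
  also have "\<dots> = 1 / fwd e s y" by (simp add: fwd_def exp_minus field_simps)
  finally show ?thesis using assms m by (simp add: fwd_def)
qed

text \<open>\<open>law_stationary\<close> transported from \<open>y\<close> to \<open>1/y\<close>,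
  where \<open>AE_law\<close> guarantees that \<open>y\<close> is positive.\<close>

lemma invariant_stationary: "invariant stationary"
proof (rule mild_invariant[OF prob_space_stationary sets_stationary],
    rule mild_mixture[where N = "\<lambda>e. distr (law e) borel (\<lambda>y. \<bar>1 / y\<bar>)"])
  fix h :: "int \<Rightarrow> real \<Rightarrow> ennreal" assume h [measurable]: "\<And>i. h i \<in> borel_measurable borel"
  show "mean stationary h = (\<Sum>e\<in>state_index. ennreal (chain_weight e) * (\<integral>\<^sup>+ x. h e x \<partial>distr (law e) borel (\<lambda>y. \<bar>1 / y\<bar>)))"
    unfolding nn_integral_stationary[of h, OF h]
    by (intro sum.cong refl arg_cong2[where f = "(*)"] nn_integral_distr[symmetric]) measurable
next
  fix e show "prob_space (distr (law e) borel (\<lambda>y. \<bar>1 / y\<bar>))"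
    by (intro prob_space.prob_space_distr prob_space_law) measurable
next
  fix e :: int and k :: "real \<Rightarrow> ennreal" and t :: real
  assume e: "e \<in> state_index" and k [measurable]: "k \<in> borel_measurable borel" and t: "0 \<le> t"
  have i: "(\<integral>\<^sup>+ x. k (leg e s x) \<partial>distr (law i) borel (\<lambda>y. \<bar>1 / y\<bar>)) = (\<integral>\<^sup>+ y. k \<bar>1 / fwd e s y\<bar> \<partial>law i)" if "0 \<le> s" for i s
  proof -
    have "(\<integral>\<^sup>+ x. k (leg e s x) \<partial>distr (law i) borel (\<lambda>y. \<bar>1 / y\<bar>)) = (\<integral>\<^sup>+ y. k (leg e s \<bar>1 / y\<bar>) \<partial>law i)"
      by (rule nn_integral_distr) measurable
    also have "\<dots> = (\<integral>\<^sup>+ y. k \<bar>1 / fwd e s y\<bar> \<partial>law i)"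
    proof (rule nn_integral_cong_AE)
      show "AE y in law i. k (leg e s \<bar>1 / y\<bar>) = k \<bar>1 / fwd e s y\<bar>"
        using AE_law
      proof eventually_elim
        case (elim y)
        then have "0 < y" using less_trans[OF threshold_pos] by blast
        then show ?case by (simp only: leg_inverse[OF _ that])
      qed
    qed
    finally show ?thesis .
  qed
  have "ennreal (exp (- (rate e * t))) * (\<integral>\<^sup>+ x. k (leg e t x) \<partial>distr (law e) borel (\<lambda>y. \<bar>1 / y\<bar>)) +
      (\<integral>\<^sup>+ s. indicator {0..t} s * (weight e s * (\<integral>\<^sup>+ x. k (leg e s x) \<partial>distr (law (-e)) borel (\<lambda>y. \<bar>1 / y\<bar>))) \<partial>lborel) =
    ennreal (exp (- (rate e * t))) * (\<integral>\<^sup>+ y. k \<bar>1 / fwd e t y\<bar> \<partial>law e) +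
      (\<integral>\<^sup>+ s. indicator {0..t} s * (weight e s * (\<integral>\<^sup>+ y. k \<bar>1 / fwd e s y\<bar> \<partial>law (-e))) \<partial>lborel)"
  proof (intro arg_cong2[where f = "(+)"] nn_integral_cong)
    fix s
    show "indicator {0..t} s * (weight e s * (\<integral>\<^sup>+ x. k (leg e s x) \<partial>distr (law (-e)) borel (\<lambda>y. \<bar>1 / y\<bar>))) =
      indicator {0..t} s * (weight e s * (\<integral>\<^sup>+ y. k \<bar>1 / fwd e s y\<bar> \<partial>law (-e)))"
    proof (cases "s \<in> {0..t}")
      case True
      then have "0 \<le> s" by simp
      from i[OF this] show ?thesis by (simp only:)
    next
      case False
      show ?thesis by (simp only: indicator_simps(2)[OF False] mult_zero_left)
    qed
  qed (simp only: i[OF t])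
  also have "\<dots> = (\<integral>\<^sup>+ y. k \<bar>1 / y\<bar> \<partial>law e)"
    by (rule law_stationary[OF e t, of "\<lambda>y. k \<bar>1 / y\<bar>"]) measurable
  also have "\<dots> = (\<integral>\<^sup>+ x. k x \<partial>distr (law e) borel (\<lambda>y. \<bar>1 / y\<bar>))"
    by (rule nn_integral_distr[symmetric]) measurable
  finally show "ennreal (exp (- (rate e * t))) * (\<integral>\<^sup>+ x. k (leg e t x) \<partial>distr (law e) borel (\<lambda>y. \<bar>1 / y\<bar>)) +
      (\<integral>\<^sup>+ s. indicator {0..t} s * (weight e s * (\<integral>\<^sup>+ x. k (leg e s x) \<partial>distr (law (-e)) borel (\<lambda>y. \<bar>1 / y\<bar>))) \<partial>lborel) =
     (\<integral>\<^sup>+ x. k x \<partial>distr (law e) borel (\<lambda>y. \<bar>1 / y\<bar>))" .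
qed simp

lemma stationary_Pos: "emeasure stationary Pos = 1"
proof -
  interpret N: prob_space "law i" for i by (rule prob_space_law)
  have "emeasure stationary Pos = (\<integral>\<^sup>+ z. indicator Pos (fst z, snd z) \<partial>stationary)"
    using Pos_sets sets_stationary by simp
  also have "\<dots> = (\<Sum>e\<in>state_index. ennreal (chain_weight e) * (\<integral>\<^sup>+ y. indicator Pos (\<bar>1 / y\<bar>, e) \<partial>law e))"
    by (rule nn_integral_stationary[of "\<lambda>i x. indicator Pos (x, i)"]) (rule indicator_section_measurable[OF Pos_sets])
  also have "\<dots> = (\<Sum>e\<in>state_index. ennreal (chain_weight e) * (\<integral>\<^sup>+ y. 1 \<partial>law e))"
  proof (intro sum.cong refl arg_cong2[where f = "(*)"] nn_integral_cong_AE)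
    fix e :: int assume e: "e \<in> state_index"
    show "AE y in law e. indicator Pos (\<bar>1 / y\<bar>, e) = (1 :: ennreal)"
      using AE_law
    proof eventually_elim
      case (elim y)
      then have "0 < y" using less_trans[OF threshold_pos] by blast
      then show ?case using e by (auto simp: indicator_def)
    qed
  qed
  also have "\<dots> = 1" using N.emeasure_space_1 by (simp add: ennreal_chain_weight_sum)
  finally show ?thesis .
qed

end

end

theorem theorem3p4:
  fixes pm pp lm lp :: real
  assumes "pm < 0" and "0 < pp" and "0 < lm" and "0 < lp"
  shows "(lp / pp < - (lm / pm) \<longrightarrow>
           (\<exists>\<mu>. {\<nu>. ergodic_prob (logistic_field pm pp) (switch_rate lm lp) \<nu>}
                   = {extinction_measure lm lp, \<mu>}
              \<and> \<mu> \<noteq> extinction_measure lm lp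
              \<and> measure \<mu> ({0<..} \<times> state_index) = 1))
       \<and> (lp / pp \<ge> - (lm / pm) \<longrightarrow>
           {\<nu>. invariant_prob (logistic_field pm pp) (switch_rate lm lp) \<nu>}
             = {extinction_measure lm lp})"
proof -
  interpret logistic_switching pm pp lm lp by unfold_locales (use assms in auto)
  show ?thesis
  proof (intro conjI impI)
    assume "lp / pp < - (lm / pm)"
    then have mg: "0 < mean_growth" using mean_growth_le_0_iff by simp
    note inv = invariant_stationary[OF mg] and pos = stationary_Pos[OF mg]
    \<comment> \<open>Used twice: for the ergodicity of \<open>stationary\<close> and for excluding
      any third ergodic measure.\<close>
    have uniq: "\<nu> = stationary" if "invariant \<nu>" "emeasure \<nu> Pos = 1" for \<nu>
      by (rule positive_invariant_unique[OF that inv pos mg])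
    have erg: "ergodic stationary"
      by (rule ergodic_if_unique[OF inv Pos_sets pos uniq])
    \<comment> \<open>\<open>\<delta>\<close> has mass 1 on \<open>Zero\<close> and hence mass 0 on
      \<open>Pos\<close>.\<close>
    have "stationary \<noteq> \<delta>"
      using emeasure_Zero_Pos[OF invariant_extinction] emeasure_extinction_Zero pos
      by (auto simp: ennreal_add_left_cancel[of 1 1 0, simplified])
    moreover have "\<nu> = \<delta> \<or> \<nu> = stationary" if e: "ergodic \<nu>" for \<nu>
    proof -
      have "invariant \<nu>" using e by (simp add: ergodic_prob_def)
      with ergodic_Zero_or_Pos[OF e] show ?thesis using extinction_unique uniq by blast
    qed
    ultimately show "\<exists>\<mu>. {\<nu>. ergodic \<nu>} = {\<delta>, \<mu>} \<and> \<mu> \<noteq> \<delta> \<and> measure \<mu> Pos = 1"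
      using erg ergodic_extinction pos by (intro exI[of _ stationary]) (auto simp: measure_def)
  next
    assume "- (lm / pm) \<le> lp / pp"
    then have "mean_growth \<le> 0" by (simp add: mean_growth_le_0_iff)
    then have "\<nu> = \<delta>" if "invariant \<nu>" for \<nu>
      using no_positive_imp_extinction[OF that] no_positive_invariant by blast
    then show "{\<nu>. invariant \<nu>} = {\<delta>}"
      using invariant_extinction by blast
  qed
qed

end
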